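(* Assume the coefficients have a symmetric distribution, unit variance and a finite moment of order four. Then $\mathbb P$-almost surely, \[ \lim_{n\to\infty}\frac{\mathcal N(f_n,[0,2\pi])}{n}=\frac{2}{\sqrt3}, \] and more generally, $\mathbb P$-almost surely, for every interval $[a,b]\subset[0,2\pi]$, \[ \lim_{n\to\infty}\frac{\mathcal N(f_n,[a,b])}{n}=\frac{b-a}{\pi\sqrt3}. \]
   Context: On a probability space $(\Omega,\mathcal F,\mathbb P)$ let $(a_k)_{k\ge1}$ and $(b_k)_{k\ge1}$ be random variables such that all the $a_k,b_k$ are mutually independent with a common distribution. For $n\ge1$ and $t\in\mathbb R$ let $f_n(t)=\frac{1}{\sqrt n}\sum_{k=1}^n \big(a_k\cos(kt)+b_k\sin(kt)\big)$. For a function $f$ and an interval $I$, $\mathcal N(f,I):=\#\{t\in I: f(t)=0\}$. *)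

theory Defs
  imports "HOL-Probability.Probability"
begin

definition trig_poly :: "(nat \<Rightarrow> real) \<Rightarrow> (nat \<Rightarrow> real) \<Rightarrow> nat \<Rightarrow> real \<Rightarrow> real" where
  "trig_poly a b n t = (1 / sqrt (real n)) * (\<Sum>k=1..n. a k * cos (real k * t) + b k * sin (real k * t))"

text \<open>Number of zeros of f in I (card convention: 0 if infinite).\<close>
definition num_zeros :: "(real \<Rightarrow> real) \<Rightarrow> real set \<Rightarrow> nat" where
  "num_zeros f I = card {t \<in> I. f t = 0}"

end

theory Submission
  imports Defs "HOL-Real_Asymp.Real_Asymp"
begin

text \<open>
  Cut the circle into cells of length \<open>h = d / N\<close>, where \<open>N\<close> is the least fourth power with \<open>N \<ge> n\<close>.
  The measure of the points \<open>t\<close> at which \<open>f\<^sub>n(t) f\<^sub>n(t + h) \<le> 0\<close>, divided by \<open>h\<close>, counts the zeros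
  from below, and it counts them up to the excess in cells with at least two zeros.

  At a uniformly random point of \<open>[0, q]\<close> the pair \<open>(f\<^sub>n(t), f\<^sub>n(t + h))\<close> is almost surely asymptotically
  Gaussian with correlation \<open>sin d / d\<close>: a second moment computation bounds the squared deviation
  of its characteristic function by \<open>O(n^(-1/2))\<close> in mean, which is summable along \<open>n = j^4\<close>, and the
  \<open>L\<^sup>1\<close> distance between \<open>f\<^sub>n\<close> and \<open>f\<^sub>N\<close> fills the gaps. Hence a proportion
  \<open>d / (pi sqrt 3) + o(d)\<close> of all points \<open>t\<close> sees a sign change, as \<open>n\<close> tends to infinity.

  If a cell starting at \<open>t\<close> has \<open>k\<close> zeros, then Rolle's theorem bounds \<open>f\<^sub>n(t)\<^sup>2\<close> by \<open>h^(2k-1)\<close> times the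
  integral of the squared \<open>k\<close>-th derivative over the cell; Parseval's identity and a small ball estimate for
  \<open>f\<^sub>n\<close> make this rare as long as \<open>k\<close> is at most a small multiple of \<open>log n\<close>. The remaining cells
  contribute little because no cell has more than \<open>O((log n)\<^sup>2)\<close> zeros: otherwise \<open>f\<^sub>n\<close> would be tiny
  on a window of length of order \<open>(log n)\<^sup>2 / n\<close>, and this is excluded by anticoncentration of the
  \<open>(log n)\<^sup>2\<close> coefficients whose frequencies are multiples of the reciprocal window length.
\<close>

text \<open>For a Gaussian pair with correlation sin d / d, opposite signs have probability (2/pi)
  arctan (\<open>slope d\<close>), and \<open>slope d\<close> is asymptotic to d / sqrt 12. Cells
  have length close to d / n, so dividing the proportion by d gives 1 / (pi sqrt 3). The limit in n
  is taken for fixed d = 1 / l^3, and l tends to infinity afterwards, so errors must be o(l^(-3)).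

  Having k zeros in a cell forces smallness of order l^(-2k), but small balls are controlled only
  down to a small negative power of n. Beyond that scale every exceptional cell is charged the
  largest possible count, and a polylogarithmic count is affordable there.

  Fourth powers serve two opposite needs: they are sparse enough for summability, with room left for
  many frequencies at once, and dense enough that the ratio of consecutive ones tends to 1, which
  makes it harmless to replace n by N.\<close>

section \<open>Rolle's theorem and the smallness forced by many zeros\<close>

lemma rolle_zeros:
  fixes f :: "real \<Rightarrow> real"
  assumes der: "\<And>x. (f has_real_derivative f' x) (at x)"
    and "finite Z" "\<And>z. z \<in> Z \<Longrightarrow> f z = 0" "card Z = Suc k"
  shows "\<exists>Z'. finite Z' \<and> card Z' = k \<and> Z' \<subseteq> {Min Z<..<Max Z} \<and> (\<forall>z\<in>Z'. f' z = 0)"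
  using assms(2-)
proof (induction k arbitrary: Z)
  case 0
  then show ?case by (intro exI[of _ "{}"]) auto
next
  case (Suc k)
  \<comment> \<open>The derivative zeros obtained from \<open>Y\<close> lie strictly below
    \<open>Max Y\<close>, while the additional one from Rolle's theorem lies between
    \<open>Max Y\<close> and \<open>Max Z\<close>. The open interval in the conclusion makes the new
    zero visibly distinct.\<close>
  define Y where "Y = Z - {Max Z}"
  have ne: "Z \<noteq> {}" using Suc.prems by auto
  have mz: "Max Z \<in> Z" using ne Suc.prems by auto
  have cY: "card Y = Suc k" "finite Y" using Suc.prems mz by (auto simp: Y_def)
  then have neY: "Y \<noteq> {}" by auto
  obtain Y' where Y': "finite Y'" "card Y' = k" "Y' \<subseteq> {Min Y<..<Max Y}" "\<forall>z\<in>Y'. f' z = 0"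
    using Suc.IH[of Y] cY Suc.prems by (auto simp: Y_def)
  have MY: "Max Y \<in> Y" using neY cY by auto
  have lt: "Max Y < Max Z"
  proof -
    have "Max Y \<in> Z" "Max Y \<noteq> Max Z" using MY by (auto simp: Y_def)
    then show ?thesis using Suc.prems by (meson Max_ge less_le)
  qed
  have "\<exists>z. Max Y < z \<and> z < Max Z \<and> DERIV f z :> 0"
    using lt MY mz Suc.prems der
    by (intro Rolle) (auto simp: Y_def real_differentiable_def intro!: continuous_at_imp_continuous_on DERIV_isCont der)
  then have "\<exists>z. Max Y < z \<and> z < Max Z \<and> f' z = 0"
    using DERIV_unique der by blast
  then obtain z where z: "Max Y < z" "z < Max Z" "f' z = 0" by auto
  have minle: "Min Z \<le> Min Y"
    using neY Suc.prems by (intro Min_antimono) (auto simp: Y_def)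
  have minY: "Min Y \<le> Max Y" using neY cY by auto
  have "z \<notin> Y'" using Y'(3) z by auto
  then have "card (insert z Y') = Suc k" using Y' by simp
  moreover have "insert z Y' \<subseteq> {Min Z<..<Max Z}"
  proof
    fix x assume "x \<in> insert z Y'"
    then consider "x = z" | "Min Y < x" "x < Max Y" using Y'(3) by auto
    then show "x \<in> {Min Z<..<Max Z}" using z minle minY lt by cases auto
  qed
  ultimately show ?case
    using Y' z by (intro exI[of _ "insert z Y'"]) auto
qed

lemma rolle_zeros_Icc:
  fixes f :: "real \<Rightarrow> real"
  assumes "\<And>x. (f has_real_derivative f' x) (at x)"
    and "finite Z" "Z \<subseteq> {a..b}" "\<And>z. z \<in> Z \<Longrightarrow> f z = 0" "card Z = Suc k"
  obtains Z' where "finite Z'" "card Z' = k" "Z' \<subseteq> {a..b}" "\<And>z. z \<in> Z' \<Longrightarrow> f' z = 0"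
proof -
  obtain Z' where Z': "finite Z'" "card Z' = k" "Z' \<subseteq> {Min Z<..<Max Z}" "\<forall>z\<in>Z'. f' z = 0"
    using rolle_zeros[OF assms(1) assms(2) assms(4) assms(5)] by blast
  have ne: "Z \<noteq> {}" using assms(5) by auto
  then have "Min Z \<in> {a..b}" "Max Z \<in> {a..b}"
    using assms(2,3) by (meson Min_in Max_in subsetD)+
  then have "Z' \<subseteq> {a..b}" using Z'(3) by fastforce
  then show ?thesis using Z' that by blast
qed

text \<open>Each of \<open>k\<close> reductions trades one zero for a factor \<open>h\<close> by the
  mean value inequality. The base case uses the fundamental theorem of calculus, so the top
  derivative enters through an integral rather than a supremum; this is what Parseval's identity can
  handle later. The derivatives form an indexed family so that the induction can shift
  \<open>i\<close>.\<close>

lemma deriv_family_bound_integral: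
  fixes F :: "nat \<Rightarrow> real \<Rightarrow> real"
  assumes der: "\<And>j x. (F j has_real_derivative F (Suc j) x) (at x)"
    and h: "0 \<le> h"
    and "finite Z" "Z \<subseteq> {s..s+h}" "\<And>z. z \<in> Z \<Longrightarrow> F i z = 0" "card Z = Suc k"
    and "u \<in> {s..s+h}"
  shows "\<bar>F i u\<bar> \<le> h ^ k * integral {s..s+h} (\<lambda>x. \<bar>F (i + Suc k) x\<bar>)"
  using assms(3-)
proof (induction k arbitrary: i Z u)
  case 0
  then obtain z where z: "z \<in> {s..s+h}" "F i z = 0"
    by (metis card_1_singletonE One_nat_def insertI1 subsetD)
  have cont: "continuous_on S (F j)" for j S
    using der by (meson DERIV_continuous_on has_field_derivative_at_within)
  have key: "\<bar>F i y - F i x\<bar> \<le> integral {s..s+h} (\<lambda>x. \<bar>F (Suc i) x\<bar>)"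
    if "x \<le> y" "x \<in> {s..s+h}" "y \<in> {s..s+h}" for x y
  proof -
    have "(F (Suc i) has_integral (F i y - F i x)) {x..y}"
      using that(1) der
      by (intro fundamental_theorem_of_calculus)
        (auto simp: has_real_derivative_iff_has_vector_derivative[symmetric] has_field_derivative_at_within)
    then have "F i y - F i x = integral {x..y} (F (Suc i))" by (simp add: integral_unique)
    also have "\<bar>\<dots>\<bar> \<le> integral {x..y} (\<lambda>x. \<bar>F (Suc i) x\<bar>)"
      using integral_norm_bound_integral[of "F (Suc i)" "{x..y}" "\<lambda>x. \<bar>F (Suc i) x\<bar>"]
      by (auto intro!: integrable_continuous_real continuous_intros cont)
    also have "\<dots> \<le> integral {s..s+h} (\<lambda>x. \<bar>F (Suc i) x\<bar>)"
      using that by (intro integral_subset_le)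
        (auto intro!: integrable_continuous_real continuous_intros cont)
    finally show ?thesis .
  qed
  have "\<bar>F i u - F i z\<bar> \<le> integral {s..s+h} (\<lambda>x. \<bar>F (Suc i) x\<bar>)"
    using key[of u z] key[of z u] z(1) "0.prems"(5) by (cases "u \<le> z") auto
  then show ?case using z by simp
next
  case (Suc k)
  then obtain z where z: "z \<in> Z" by fastforce
  obtain Z' where Z': "finite Z'" "card Z' = Suc k" "Z' \<subseteq> {s..s+h}" "\<And>z. z \<in> Z' \<Longrightarrow> F (Suc i) z = 0"
    using rolle_zeros_Icc[of "F i" "F (Suc i)" Z s "s+h" "Suc k"] der Suc.prems by blast
  define B where "B = h ^ k * integral {s..s+h} (\<lambda>x. \<bar>F (i + Suc (Suc k)) x\<bar>)"
  have B: "\<bar>F (Suc i) x\<bar> \<le> B" if "x \<in> {s..s+h}" for x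
    using Suc.IH[OF Z'(1,3) _ Z'(2) that, of "Suc i"] Z'(4) by (simp add: B_def)
  have "norm (F i u - F i z) \<le> B * norm (u - z)"
    using B der Suc.prems z
    by (intro field_differentiable_bound[of "{s..s+h}" "F i" "F (Suc i)"])
      (auto simp: has_field_derivative_at_within)
  also have "\<dots> \<le> B * h"
    using Suc.prems z B[of u] by (intro mult_left_mono) (auto, fastforce+)
  finally show ?case using Suc.prems z by (simp add: B_def mult_ac)
qed

text \<open>The derivative of order \<open>j\<close> still has \<open>k - j\<close> zeros, each
  worth a factor \<open>h\<close>. All orders up to \<open>k\<close> are recorded because the Taylor
  expansion in \<open>many_zeros_small\<close> needs them at one common point.\<close>

lemma deriv_family_bound_sup:
  fixes F :: "nat \<Rightarrow> real \<Rightarrow> real"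
  assumes der: "\<And>j x. (F j has_real_derivative F (Suc j) x) (at x)"
    and h: "0 \<le> h"
    and "finite Z" "Z \<subseteq> {s..s+h}" "\<And>z. z \<in> Z \<Longrightarrow> F i z = 0" "card Z = k"
    and "\<And>x. \<bar>F (i + k) x\<bar> \<le> B"
    and "u \<in> {s..s+h}" "j \<le> k"
  shows "\<bar>F (i + j) u\<bar> \<le> h ^ (k - j) * B"
  using assms(3-)
proof (induction k arbitrary: i Z u j)
  case 0
  then show ?case by simp
next
  case (Suc k)
  then obtain z where z: "z \<in> Z" by fastforce
  obtain Z' where Z': "finite Z'" "card Z' = k" "Z' \<subseteq> {s..s+h}" "\<And>z. z \<in> Z' \<Longrightarrow> F (Suc i) z = 0"
    using rolle_zeros_Icc[of "F i" "F (Suc i)" Z s "s+h" "k"] der Suc.prems by blast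
  have IH: "\<bar>F (Suc i + j) u\<bar> \<le> h ^ (k - j) * B" if "u \<in> {s..s+h}" "j \<le> k" for u j
    using Suc.IH[OF Z'(1,3) _ Z'(2) _ that, of "Suc i"] Z'(4) Suc.prems(5) by simp
  show ?case
  proof (cases j)
    case 0
    have "norm (F i u - F i z) \<le> (h ^ k * B) * norm (u - z)"
      using IH[of _ 0] der Suc.prems z
      by (intro field_differentiable_bound[of "{s..s+h}" "F i" "F (Suc i)"])
        (auto simp: has_field_derivative_at_within)
    also have "\<dots> \<le> (h ^ k * B) * h"
      using Suc.prems z IH[of u 0] by (intro mult_left_mono) (auto, fastforce+)
    finally show ?thesis using Suc.prems z 0 by (simp add: mult_ac)
  next
    case (Suc j')
    then show ?thesis using IH[of u j'] Suc.prems by simp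
  qed
qed

text \<open>Taylor expansion of order \<open>k\<close> at \<open>s\<close>: the zeros make the
  derivative of order m at \<open>s\<close> at most \<open>h ^ (k - m) * B * N ^ k\<close>, so with
  y = |u - s| / h the m-th term is at most \<open>B * (N * h) ^ k\<close> times y^m / m!, and these
  sum to an exponential. For \<open>N * h\<close> small the power wins over the exponential up to
  distances of order \<open>k * h\<close>.\<close>

lemma many_zeros_small:
  fixes F :: "nat \<Rightarrow> real \<Rightarrow> real"
  assumes der: "\<And>j x. (F j has_real_derivative F (Suc j) x) (at x)"
    and h: "0 < h"
    and Z: "finite Z" "Z \<subseteq> {s..s+h}" "\<And>z. z \<in> Z \<Longrightarrow> F 0 z = 0" "card Z = k"
    and bd: "\<And>j x. \<bar>F j x\<bar> \<le> B * N ^ j" and N: "0 \<le> N"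
  shows "\<bar>F 0 u\<bar> \<le> B * (N * h) ^ k * exp (\<bar>u - s\<bar> / h)"
proof -
  define y where "y = \<bar>u - s\<bar> / h"
  have y: "0 \<le> y" "\<bar>u - s\<bar> = y * h" using h by (auto simp: y_def)
  have B0: "0 \<le> B" using bd[of 0 0] by simp
  have der_s: "\<bar>F j s\<bar> \<le> h ^ (k - j) * (B * N ^ k)" if "j \<le> k" for j
    using deriv_family_bound_sup[of F h Z s 0 k "B * N ^ k" s j] that der h Z bd by auto
  have ty: "\<exists>t. F 0 u = (\<Sum>m<k. F m s / fact m * (u - s) ^ m) + F k t / fact k * (u - s) ^ k"
  proof (cases "k = 0 \<or> u = s")
    case True
    then show ?thesis
    proof
      assume "u = s"
      then show ?thesis by (cases k) (auto simp: lessThan_Suc_eq_insert_0 zero_notin_Suc_image intro!: exI[of _ s] sum.neutral)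
    qed auto
  next
    case False
    then have "\<exists>t. (if u < s then u < t \<and> t < s else s < t \<and> t < u) \<and>
       F 0 u = (\<Sum>m<k. F m s / fact m * (u - s) ^ m) + F k t / fact k * (u - s) ^ k"
      using der by (intro Taylor[where a="min u s" and b="max u s"]) auto
    then show ?thesis by auto
  qed
  then obtain t where t: "F 0 u = (\<Sum>m<k. F m s / fact m * (u - s) ^ m) + F k t / fact k * (u - s) ^ k"
    by auto
  have each: "\<bar>x / fact m * (u - s) ^ m\<bar> \<le> B * (N * h) ^ k * (y ^ m / fact m)"
    if "\<bar>x\<bar> \<le> h ^ (k - m) * (B * N ^ k)" "m \<le> k" for x m
  proof -
    have "\<bar>x / fact m * (u - s) ^ m\<bar> = \<bar>x\<bar> * (y * h) ^ m / fact m"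
      using y by (simp add: abs_mult power_abs)
    also have "\<dots> \<le> (h ^ (k - m) * (B * N ^ k)) * (y * h) ^ m / fact m"
      using that y h by (intro divide_right_mono mult_right_mono) auto
    also have "\<dots> = (h ^ (k - m) * h ^ m) * (B * N ^ k) * (y ^ m / fact m)"
      by (simp add: power_mult_distrib)
    also have "h ^ (k - m) * h ^ m = h ^ k" using that by (simp flip: power_add)
    finally show ?thesis by (simp add: power_mult_distrib mult_ac)
  qed
  have "\<bar>F 0 u\<bar> \<le> (\<Sum>m<k. \<bar>F m s / fact m * (u - s) ^ m\<bar>) + \<bar>F k t / fact k * (u - s) ^ k\<bar>"
    unfolding t using sum_abs[of "\<lambda>m. F m s / fact m * (u - s) ^ m" "{..<k}"] by linarith
  also have "\<dots> \<le> (\<Sum>m<k. B * (N * h) ^ k * (y ^ m / fact m)) + B * (N * h) ^ k * (y ^ k / fact k)"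
    using der_s bd[of k t] by (intro add_mono sum_mono each) auto
  also have "\<dots> = B * (N * h) ^ k * (\<Sum>m<Suc k. y ^ m / fact m)"
    by (simp add: sum_distrib_left ring_distribs)
  also have "\<dots> \<le> B * (N * h) ^ k * exp y"
  proof (intro mult_left_mono)
    have "(\<Sum>m<Suc k. y ^ m / fact m) \<le> (\<Sum>m. y ^ m / fact m)"
      using y by (intro sum_le_suminf)
        (auto simp: divide_inverse_commute intro: summable_exp)
    then show "(\<Sum>m<Suc k. y ^ m / fact m) \<le> exp y"
      by (simp add: exp_def scaleR_conv_of_real divide_inverse_commute)
  qed (use B0 N h in auto)
  finally show ?thesis unfolding y_def .
qed

section \<open>Trigonometric sums with phases and Parseval's identity\<close>

text \<open>The \<open>j\<close>-th derivative of a trigonometric sum, each derivative being a phase shift by \<open>pi / 2\<close>.\<close>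

definition phase_poly :: "(nat \<Rightarrow> real) \<Rightarrow> (nat \<Rightarrow> real) \<Rightarrow> nat \<Rightarrow> nat \<Rightarrow> real \<Rightarrow> real" where
  "phase_poly r p n j t = (\<Sum>k=1..n. r k * real k ^ j * cos (real k * t + p k + real j * (pi / 2)))"

lemma phase_poly_deriv: "(phase_poly r p n j has_real_derivative phase_poly r p n (Suc j) t) (at t)"
proof -
  have "((\<lambda>t. r k * real k ^ j * cos (real k * t + p k + real j * (pi / 2))) has_real_derivative
      r k * real k ^ Suc j * cos (real k * t + p k + real (Suc j) * (pi / 2))) (at t)" for k
  proof -
    have "cos (real k * t + p k + real (Suc j) * (pi / 2)) = - sin (real k * t + p k + real j * (pi / 2))"
      by (simp add: minus_sin_cos_eq algebra_simps add_divide_distrib)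
    then show ?thesis by (auto intro!: derivative_eq_intros)
  qed
  then show ?thesis unfolding phase_poly_def by (intro DERIV_sum) auto
qed

lemma phase_poly_bound: "\<bar>phase_poly r p n j t\<bar> \<le> (\<Sum>k=1..n. \<bar>r k\<bar>) * real n ^ j"
proof -
  have "\<bar>phase_poly r p n j t\<bar> \<le> (\<Sum>k=1..n. \<bar>r k * real k ^ j * cos (real k * t + p k + real j * (pi / 2))\<bar>)"
    unfolding phase_poly_def by (rule sum_abs)
  also have "\<dots> \<le> (\<Sum>k=1..n. \<bar>r k\<bar> * real n ^ j)"
  proof (rule sum_mono)
    fix k assume k: "k \<in> {1..n}"
    have "\<bar>r k * real k ^ j * cos (real k * t + p k + real j * (pi / 2))\<bar> \<le> \<bar>r k\<bar> * real k ^ j * 1"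
      unfolding abs_mult by (intro mult_mono) auto
    also have "\<dots> \<le> \<bar>r k\<bar> * real n ^ j"
      using k by (simp add: mult_left_mono power_mono)
    finally show "\<bar>r k * real k ^ j * cos (real k * t + p k + real j * (pi / 2))\<bar> \<le> \<bar>r k\<bar> * real n ^ j" .
  qed
  finally show ?thesis by (simp add: sum_distrib_right)
qed

lemma has_integral_cos_period:
  assumes "k \<noteq> 0"
  shows "((\<lambda>t. cos (real_of_int k * t + c)) has_integral 0) {0..2*pi}"
proof -
  have "((\<lambda>t. cos (real_of_int k * t + c)) has_integral
     sin (real_of_int k * (2*pi) + c) / real_of_int k - sin (real_of_int k * 0 + c) / real_of_int k) {0..2*pi}"
    using assms by (intro fundamental_theorem_of_calculus)
      (auto simp: has_real_derivative_iff_has_vector_derivative[symmetric] intro!: derivative_eq_intros)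
  moreover have "sin (real_of_int k * (2*pi) + c) = sin c"
    using sin_integer_2pi[of "of_int k"] cos_integer_2pi[of "of_int k"] by (simp add: sin_add mult_ac)
  ultimately show ?thesis by simp
qed

text \<open>Arbitrary phases cover shifts of the argument and all derivatives at once. Off the
  diagonal both the sum and the difference of the frequencies are nonzero integers and integrate to
  zero; on the diagonal the difference term is a constant.\<close>

lemma parseval_phase:
  "((\<lambda>t. (\<Sum>k=1..n. r k * cos (real k * t + p k))\<^sup>2) has_integral pi * (\<Sum>k=1..n. (r k)\<^sup>2)) {0..2*pi}"
proof -
  have one: "((\<lambda>t. (r k * cos (real k * t + p k)) * (r l * cos (real l * t + p l))) has_integral
      (if k = l then pi * (r k)\<^sup>2 else 0)) {0..2*pi}" if "k \<ge> 1" "l \<ge> 1" for k l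
  proof -
    have eq: "(r k * cos (real k * t + p k)) * (r l * cos (real l * t + p l)) =
      r k * r l / 2 * cos (real_of_int (int k - int l) * t + (p k - p l)) +
      r k * r l / 2 * cos (real_of_int (int k + int l) * t + (p k + p l))" for t
      using cos_times_cos[of "real k * t + p k" "real l * t + p l"] by (simp add: algebra_simps add_divide_distrib)
    have b: "((\<lambda>t. r k * r l / 2 * cos (real_of_int (int k + int l) * t + (p k + p l))) has_integral r k * r l / 2 * 0) {0..2*pi}"
      using that by (intro has_integral_mult_right has_integral_cos_period) auto
    have a: "((\<lambda>t. r k * r l / 2 * cos (real_of_int (int k - int l) * t + (p k - p l))) has_integral
         (if k = l then pi * (r k)\<^sup>2 else 0)) {0..2*pi}"
    proof (cases "k = l")
      case True
      have "((\<lambda>t. r k * r k / 2) has_integral (2*pi - 0) *\<^sub>R (r k * r k / 2)) {0..2*pi}"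
        using has_integral_const_real[of "r k * r k / 2" 0 "2*pi"] by simp
      then show ?thesis using True by (simp add: power2_eq_square)
    next
      case False
      then have "((\<lambda>t. r k * r l / 2 * cos (real_of_int (int k - int l) * t + (p k - p l))) has_integral r k * r l / 2 * 0) {0..2*pi}"
        by (intro has_integral_mult_right has_integral_cos_period) auto
      then show ?thesis using False by simp
    qed
    show ?thesis unfolding eq using has_integral_add[OF a b] by simp
  qed
  have "((\<lambda>t. \<Sum>k=1..n. \<Sum>l=1..n. (r k * cos (real k * t + p k)) * (r l * cos (real l * t + p l))) has_integral
      (\<Sum>k=1..n. \<Sum>l=1..n. if k = l then pi * (r k)\<^sup>2 else 0)) {0..2*pi}"
    by (intro has_integral_sum one) auto
  also have "(\<Sum>k=1..n. \<Sum>l=1..n. if k = l then pi * (r k)\<^sup>2 else 0) = pi * (\<Sum>k=1..n. (r k)\<^sup>2)"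
    by (simp add: sum_distrib_left)
  finally show ?thesis by (simp add: power2_eq_square sum_product)
qed

lemma phase_exists: "\<exists>r p. \<forall>x. c * cos x + d * sin x = r * cos (x + p) \<and> r\<^sup>2 = c\<^sup>2 + (d::real)\<^sup>2"
proof -
  obtain r a where ra: "c = r * cos a" "d = r * sin a" using polar_Ex by blast
  have "r\<^sup>2 * ((cos a)\<^sup>2 + (sin a)\<^sup>2) = c\<^sup>2 + d\<^sup>2"
    unfolding ra by (simp add: power_mult_distrib distrib_left del: sin_cos_squared_add sin_cos_squared_add2)
  then have "r\<^sup>2 = c\<^sup>2 + d\<^sup>2" by simp
  moreover have "c * cos x + d * sin x = r * cos (x + - a)" for x
    by (simp add: ra cos_diff distrib_left mult_ac)
  ultimately show ?thesis by blast
qed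

lemma deriv_family_continuous:
  fixes F :: "nat \<Rightarrow> real \<Rightarrow> real"
  assumes "\<And>j x. (F j has_real_derivative F (Suc j) x) (at x)"
  shows "continuous_on S (F j)"
  using assms by (meson DERIV_continuous_on has_field_derivative_at_within)

lemma markov_inequality_Icc:
  fixes G :: "real \<Rightarrow> real"
  assumes "continuous_on {a..b} G" "\<And>t. t \<in> {a..b} \<Longrightarrow> 0 \<le> G t" "0 < c"
  shows "measure lborel {t \<in> {a..b}. c \<le> G t} \<le> integral {a..b} G / c"
proof -
  have si: "set_integrable lborel {a..b} G"
    unfolding set_integrable_def using assms(1) by (intro borel_integrable_compact) auto
  have "measure lborel {t \<in> {a..b}. c \<le> G t} \<le> set_lebesgue_integral lborel {a..b} G / c"
    using si assms by (intro integral_Markov_inequality'_measure) auto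
  then show ?thesis using set_borel_integral_eq_integral(2)[OF si] by simp
qed

lemma integral_abs_square_le:
  fixes f :: "real \<Rightarrow> real"
  assumes "continuous_on {a..a+h} f" "0 < h"
  shows "(integral {a..a+h} (\<lambda>x. \<bar>f x\<bar>))\<^sup>2 \<le> h * integral {a..a+h} (\<lambda>x. (f x)\<^sup>2)"
proof -
  define I where "I = integral {a..a+h} (\<lambda>x. \<bar>f x\<bar>)"
  have int: "(\<lambda>x. \<bar>f x\<bar>) integrable_on {a..a+h}" "(\<lambda>x. (f x)\<^sup>2) integrable_on {a..a+h}"
    using assms(1) by (auto intro!: integrable_continuous_real continuous_intros)
  have "((\<lambda>x. (f x)\<^sup>2 - 2 * (I / h) * \<bar>f x\<bar> + (I / h)\<^sup>2) has_integral
      (integral {a..a+h} (\<lambda>x. (f x)\<^sup>2) - 2 * (I / h) * I + (a + h - a) *\<^sub>R (I / h)\<^sup>2)) {a..a+h}"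
    unfolding I_def using int assms(2) has_integral_const_real[of "(I / h)\<^sup>2" a "a+h"]
    by (intro has_integral_add has_integral_diff has_integral_mult_right integrable_integral) (auto simp: I_def)
  moreover have "(f x)\<^sup>2 - 2 * (I / h) * \<bar>f x\<bar> + (I / h)\<^sup>2 = (\<bar>f x\<bar> - I / h)\<^sup>2" for x
    by (simp add: power2_diff)
  ultimately have "0 \<le> integral {a..a+h} (\<lambda>x. (f x)\<^sup>2) - 2 * (I / h) * I + (a + h - a) *\<^sub>R (I / h)\<^sup>2"
    by (simp add: has_integral_nonneg)
  then have "0 \<le> h * (integral {a..a+h} (\<lambda>x. (f x)\<^sup>2) - 2 * (I / h) * I + (a + h - a) *\<^sub>R (I / h)\<^sup>2)"
    using assms(2) by (intro mult_nonneg_nonneg) auto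
  also have "\<dots> = h * integral {a..a+h} (\<lambda>x. (f x)\<^sup>2) - I\<^sup>2"
    using assms(2) by (simp add: field_simps power2_eq_square)
  finally show ?thesis by (simp add: I_def)
qed

section \<open>Counting zeros by sign changes\<close>

text \<open>If \<open>f\<close> is positive at both ends and vanishes somewhere in between, its
  minimum over the interval is at most 0, hence interior and critical. This handles zeros that leave
  no sign change, including a single double zero.\<close>

lemma deriv_zero_if_same_sign:
  fixes f :: "real \<Rightarrow> real"
  assumes der: "\<And>x. (f has_real_derivative f' x) (at x)"
    and "0 < f a * f b" "f z = 0" "z \<in> {a..b}"
  shows "\<exists>w\<in>{a..b}. f' w = 0"
proof -
  have pos: "\<exists>w\<in>{a..b}. g' w = 0"
    if der: "\<And>x. (g has_real_derivative g' x) (at x)" and g: "0 < g a" "0 < g b" "g z = 0" for g g' :: "real \<Rightarrow> real"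
  proof -
    have "continuous_on {a..b} g" using der by (meson DERIV_continuous_on has_field_derivative_at_within)
    then obtain w where w: "w \<in> {a..b}" "\<forall>y\<in>{a..b}. g w \<le> g y"
      using continuous_attains_inf[of "{a..b}" g] assms(4) by auto
    then have "g w \<le> 0" using g assms(4) by fastforce
    then have ne: "a < w" "w < b" using g w(1) by (auto simp: less_le)
    have "g' w = 0"
    proof (rule DERIV_local_min[OF der])
      show "0 < min (w - a) (b - w)" using ne by auto
      show "\<forall>y. \<bar>w - y\<bar> < min (w - a) (b - w) \<longrightarrow> g w \<le> g y"
        using w(2) by (auto simp: abs_less_iff)
    qed
    then show ?thesis using w by auto
  qed
  show ?thesis
  proof (cases "f a > 0")
    case True
    then show ?thesis using pos[of f f'] assms by (auto simp: zero_less_mult_iff)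
  next
    case False
    then show ?thesis using pos[of "\<lambda>x. - f x" "\<lambda>x. - f' x"] assms der
      by (auto simp: zero_less_mult_iff intro!: DERIV_minus)
  qed
qed

text \<open>Cauchy-Schwarz replaces the integral of the top derivative by that of its square, at the
  cost of one factor \<open>h\<close>; the exponent is 2(k - 1) + 1.\<close>

lemma square_le_if_zeros:
  fixes F :: "nat \<Rightarrow> real \<Rightarrow> real"
  assumes der: "\<And>j x. (F j has_real_derivative F (Suc j) x) (at x)"
    and h: "0 < h"
    and Z: "card {z \<in> {t..t+h}. F 0 z = 0} \<ge> k" "k \<ge> 1"
  shows "(F 0 t)\<^sup>2 \<le> h ^ (2 * k - 1) * integral {t..t+h} (\<lambda>x. (F k x)\<^sup>2)"
proof -
  obtain k' where k': "k = Suc k'" using Z(2) by (cases k) auto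
  obtain Y where Y: "Y \<subseteq> {z \<in> {t..t+h}. F 0 z = 0}" "card Y = k"
    using obtain_subset_with_card_n[OF Z(1)] by metis
  have "finite Y" using Y Z by (metis card.infinite not_one_le_zero)
  then have "\<bar>F 0 t\<bar> \<le> h ^ k' * integral {t..t+h} (\<lambda>x. \<bar>F (0 + Suc k') x\<bar>)"
    using Y h der by (intro deriv_family_bound_integral[where Z=Y]) (auto simp: k')
  then have "\<bar>F 0 t\<bar>\<^sup>2 \<le> (h ^ k' * integral {t..t+h} (\<lambda>x. \<bar>F k x\<bar>))\<^sup>2"
    by (intro power_mono) (auto simp: k')
  also have "\<dots> = h ^ (2 * k') * (integral {t..t+h} (\<lambda>x. \<bar>F k x\<bar>))\<^sup>2"
    by (simp add: power_mult_distrib power_mult mult.commute[of 2])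
  also have "\<dots> \<le> h ^ (2 * k') * (h * integral {t..t+h} (\<lambda>x. (F k x)\<^sup>2))"
    using h deriv_family_continuous[of F, OF der] by (intro mult_left_mono integral_abs_square_le) auto
  also have "\<dots> = h ^ (2 * k - 1) * integral {t..t+h} (\<lambda>x. (F k x)\<^sup>2)"
    by (simp add: k')
  finally show ?thesis by simp
qed

text \<open>A zero of the function together with a zero of its derivative acts like two zeros: the
  bound is the one for \<open>k = 2\<close> in \<open>square_le_if_zeros\<close>, so such a cell
  also starts in \<open>bad_set F h 2\<close>.\<close>

lemma square_le_if_deriv_zero:
  fixes F :: "nat \<Rightarrow> real \<Rightarrow> real"
  assumes der: "\<And>j x. (F j has_real_derivative F (Suc j) x) (at x)"
    and h: "0 < h"
    and z: "z \<in> {t..t+h}" "F 0 z = 0" and w: "w \<in> {t..t+h}" "F 1 w = 0"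
  shows "(F 0 t)\<^sup>2 \<le> h ^ 3 * integral {t..t+h} (\<lambda>x. (F 2 x)\<^sup>2)"
proof -
  define I where "I = integral {t..t+h} (\<lambda>x. \<bar>F 2 x\<bar>)"
  have F1: "\<bar>F 1 u\<bar> \<le> I" if "u \<in> {t..t+h}" for u
    using deriv_family_bound_integral[of F h "{w}" t 1 0 u] der h w that by (simp add: I_def numeral_2_eq_2)
  have "norm (F 0 t - F 0 z) \<le> I * norm (t - z)"
    using F1 z h der[of 0]
    by (intro field_differentiable_bound[of "{t..t+h}" "F 0" "F 1"])
      (auto simp: has_field_derivative_at_within)
  also have "\<dots> \<le> I * h" using z F1[of t] h by (intro mult_left_mono) auto
  finally have "\<bar>F 0 t\<bar> \<le> I * h" using z by simp
  then have "\<bar>F 0 t\<bar>\<^sup>2 \<le> (I * h)\<^sup>2" by (intro power_mono) auto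
  also have "\<dots> = h\<^sup>2 * I\<^sup>2" by (simp add: power_mult_distrib)
  also have "\<dots> \<le> h\<^sup>2 * (h * integral {t..t+h} (\<lambda>x. (F 2 x)\<^sup>2))"
    unfolding I_def using h deriv_family_continuous[of F, OF der]
    by (intro mult_left_mono integral_abs_square_le) auto
  finally show ?thesis by (simp add: power2_eq_square power3_eq_cube)
qed

text \<open>By Rolle's theorem this set contains every \<open>t\<close> such that \<open>[t, t + h]\<close> contains \<open>k\<close> zeros.\<close>

definition bad_set :: "(nat \<Rightarrow> real \<Rightarrow> real) \<Rightarrow> real \<Rightarrow> nat \<Rightarrow> real set" where
  "bad_set F h k = {t. (F 0 t)\<^sup>2 \<le> h ^ (2 * k - 1) * integral {0..h} (\<lambda>s. (F k (t + s))\<^sup>2)}"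

lemma integral_shift_0:
  fixes f :: "real \<Rightarrow> real" shows "integral {t..t+h} f =
    integral {0..h} (\<lambda>s. f (t + s))"
  using integral_shift_Icc_real[of 0 h f t] by (simp add: o_def add.commute)

text \<open>Layer counting. The first zero is paid for by a sign change, or else by
  \<open>bad_set F h 2\<close> via a critical point. Each further zero, the k-th for k at least 2,
  puts \<open>t\<close> into \<open>bad_set F h k\<close>. If the count exceeds \<open>k1\<close>,
  all of it is charged at the maximal price \<open>k0\<close> to the single set
  \<open>bad_set F h k1\<close>. The set of level 2 therefore occurs twice.\<close>

lemma card_zeros_cell:
  fixes F :: "nat \<Rightarrow> real \<Rightarrow> real"
  assumes der: "\<And>j x. (F j has_real_derivative F (Suc j) x) (at x)"
    and h: "0 < h" and k1: "2 \<le> k1"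
    and k0: "card {z \<in> {t..t+h}. F 0 z = 0} \<le> k0"
  shows "real (card {z \<in> {t..t+h}. F 0 z = 0}) \<le>
     indicator {t. F 0 t * F 0 (t + h) \<le> 0} t + indicator (bad_set F h 2) t
     + (\<Sum>k=2..k1. indicator (bad_set F h k) t) + real k0 * indicator (bad_set F h k1) t"
proof -
  define N where "N = card {z \<in> {t..t+h}. F 0 z = 0}"
  have bad: "t \<in> bad_set F h k" if "1 \<le> k" "k \<le> N" for k
    using square_le_if_zeros[of F h k t] der h that by (simp add: bad_set_def N_def integral_shift_0)
  have nn: "0 \<le> (\<Sum>k=2..k1. indicator (bad_set F h k) t :: real)" by (intro sum_nonneg) auto
  have first: "1 \<le> indicator {t. F 0 t * F 0 (t + h) \<le> 0} t + (indicator (bad_set F h 2) t :: real)" if "1 \<le> N"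
  proof (cases "F 0 t * F 0 (t + h) \<le> 0")
    case False
    have "{z \<in> {t..t+h}. F 0 z = 0} \<noteq> {}"
    proof
      assume "{z \<in> {t..t+h}. F 0 z = 0} = {}"
      then have "N = 0" unfolding N_def by (simp only: card.empty)
      then show False using that by simp
    qed
    then obtain z where z: "z \<in> {t..t+h}" "F 0 z = 0" by blast
    obtain w where "w \<in> {t..t+h}" "F 1 w = 0"
      using deriv_zero_if_same_sign[of "F 0" "F 1" t "t+h" z] False z der[of 0] by auto
    then have "t \<in> bad_set F h 2"
      using square_le_if_deriv_zero[of F h z t w] der h z by (simp add: bad_set_def integral_shift_0)
    then show ?thesis by simp
  qed simp
  have second: "real N - 1 \<le> (\<Sum>k=2..k1. indicator (bad_set F h k) t) + real k0 * indicator (bad_set F h k1) t" if "1 \<le> N"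
  proof (cases "N \<le> k1")
    case True
    have "real N - 1 = (\<Sum>k=2..N. indicator (bad_set F h k) t)"
      using bad that by (simp add: of_nat_diff)
    also have "\<dots> \<le> (\<Sum>k=2..k1. indicator (bad_set F h k) t)"
      using True by (intro sum_mono2) auto
    finally show ?thesis by (smt (verit) indicator_pos_le mult_nonneg_nonneg of_nat_0_le_iff)
  next
    case False
    then have "t \<in> bad_set F h k1" using bad[of k1] k1 by auto
    then show ?thesis using nn k0 by (simp add: N_def)
  qed
  show ?thesis
  proof (cases "N = 0")
    case True
    then show ?thesis unfolding N_def[symmetric] using nn by simp
  next
    case False
    then show ?thesis unfolding N_def[symmetric] using first second by simp
  qed
qed

lemma integral_window_continuous:
  fixes F :: "real \<Rightarrow> real"
  assumes "continuous_on UNIV F"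
  shows "continuous_on S (\<lambda>t. integral {0..h} (\<lambda>s. (F (t + s))\<^sup>2))"
proof -
  have "continuous_on (S \<times> cbox 0 h) (\<lambda>(t, s). (F (t + s))\<^sup>2)"
    unfolding case_prod_unfold
    by (intro continuous_intros continuous_on_compose2[OF assms]) auto
  from integral_continuous_on_param[OF this] show ?thesis by simp
qed

lemma bad_set_borel:
  assumes "\<And>j. continuous_on UNIV (F j)"
  shows "bad_set F h k \<in> sets lborel"
proof -
  have "closed (bad_set F h k)" unfolding bad_set_def
    using assms by (intro closed_Collect_le continuous_intros integral_window_continuous)
  then show ?thesis by simp
qed

lemma finite_zeros_Icc:
  fixes f :: "real \<Rightarrow> real"
  assumes h: "0 < h" and fin: "\<And>t. t \<in> {0..q} \<Longrightarrow> finite {z \<in> {t..t+h}. f z = 0}"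
  shows "finite {z \<in> {0..q}. f z = 0}"
proof -
  have "{z \<in> {0..q}. f z = 0} \<subseteq> (\<Union>i\<in>{i. i \<le> nat \<lfloor>q / h\<rfloor> \<and> real i * h \<in> {0..q}}. {z \<in> {real i * h..real i * h + h}. f z = 0})"
  proof
    fix z assume z: "z \<in> {z \<in> {0..q}. f z = 0}"
    define i where "i = nat \<lfloor>z / h\<rfloor>"
    have "real i = of_int \<lfloor>z / h\<rfloor>" using z h by (simp add: i_def)
    then have "real i \<le> z / h" "z / h \<le> real i + 1" by linarith+
    then have i: "real i * h \<le> z" "z \<le> real i * h + h" using h by (auto simp: field_simps)
    have "i \<le> nat \<lfloor>q / h\<rfloor>" using z h by (auto simp: i_def intro!: nat_mono floor_mono divide_right_mono)
    then show "z \<in> (\<Union>i\<in>{i. i \<le> nat \<lfloor>q / h\<rfloor> \<and> real i * h \<in> {0..q}}. {z \<in> {real i * h..real i * h + h}. f z = 0})"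
      using i z h by (intro UN_I[of i]) auto
  qed
  then show ?thesis
  proof (rule finite_subset)
    show "finite (\<Union>i\<in>{i. i \<le> nat \<lfloor>q / h\<rfloor> \<and> real i * h \<in> {0..q}}. {z \<in> {real i * h..real i * h + h}. f z = 0})"
    proof (rule finite_UN_I)
      show "finite {i. i \<le> nat \<lfloor>q / h\<rfloor> \<and> real i * h \<in> {0..q}}" by simp
    qed (use fin in blast)
  qed
qed

text \<open>Double counting: a zero \<open>z\<close> with \<open>h <= z\<close> is seen from exactly
  the starting points in \<open>{z-h..z}\<close>, an interval of length \<open>h\<close>, so
  integrating the cell bound over \<open>t\<close> counts each such zero with weight
  \<open>h\<close>. Zeros below \<open>h\<close>, whose intervals would leave \<open>{0..q}\<close>,
  lie in the first cell and account for \<open>h * k0\<close>.\<close>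

lemma card_zeros_upper:
  fixes F :: "nat \<Rightarrow> real \<Rightarrow> real"
  assumes der: "\<And>j x. (F j has_real_derivative F (Suc j) x) (at x)"
    and h: "0 < h" and k1: "2 \<le> k1" and q: "0 \<le> q"
    and fin: "\<And>t. t \<in> {0..q} \<Longrightarrow> finite {z \<in> {t..t+h}. F 0 z = 0}"
    and k0: "\<And>t. t \<in> {0..q} \<Longrightarrow> card {z \<in> {t..t+h}. F 0 z = 0} \<le> k0"
  shows "h * real (card {z \<in> {0..q}. F 0 z = 0}) \<le> h * real k0
     + measure lborel ({t. F 0 t * F 0 (t + h) \<le> 0} \<inter> {0..q})
     + measure lborel (bad_set F h 2 \<inter> {0..q})
     + (\<Sum>k=2..k1. measure lborel (bad_set F h k \<inter> {0..q}))
     + real k0 * measure lborel (bad_set F h k1 \<inter> {0..q})"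
proof -
  define Z where "Z = {z \<in> {0..q}. F 0 z = 0}"
  define Z1 where "Z1 = {z \<in> Z. h \<le> z}"
  have finZ: "finite Z" unfolding Z_def using h fin by (rule finite_zeros_Icc)
  then have finZ1: "finite Z1" by (simp add: Z1_def)
  have cont: "continuous_on UNIV (F j)" for j using deriv_family_continuous[of F, OF der] .
  have "card Z \<le> card ({z \<in> {0..0+h}. F 0 z = 0} \<union> Z1)"
    using fin[of 0] q finZ1 by (intro card_mono) (auto simp: Z1_def Z_def)
  also have "\<dots> \<le> card {z \<in> {0..0+h}. F 0 z = 0} + card Z1" by (rule card_Un_le)
  also have "\<dots> \<le> k0 + card Z1" using k0[of 0] q by (intro add_mono) auto
  finally have cardZ: "real (card Z) \<le> real k0 + real (card Z1)" by linarith
  define A where "A = {t. F 0 t * F 0 (t + h) \<le> 0}"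
  define R :: "real \<Rightarrow> real" where "R t = indicator (A \<inter> {0..q}) t + indicator (bad_set F h 2 \<inter> {0..q}) t
     + (\<Sum>k=2..k1. indicator (bad_set F h k \<inter> {0..q}) t) + real k0 * indicator (bad_set F h k1 \<inter> {0..q}) t" for t
  have hb: "has_bochner_integral lborel (indicator (S \<inter> {0..q})) (measure lborel (S \<inter> {0..q}))" if "S \<in> sets lborel" for S
  proof (rule has_bochner_integral_real_indicator)
    have "emeasure lborel (S \<inter> {0..q}) \<le> emeasure lborel {0..q}" by (intro emeasure_mono) auto
    also have "\<dots> < \<infinity>" using q by simp
    finally show "emeasure lborel (S \<inter> {0..q}) < \<infinity>" .
  qed (use that in auto)
  have "closed A" unfolding A_def
    by (intro closed_Collect_le continuous_intros continuous_on_compose2[OF cont]) auto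
  then have A: "A \<in> sets lborel" by simp
  have R: "has_bochner_integral lborel R (measure lborel (A \<inter> {0..q}) + measure lborel (bad_set F h 2 \<inter> {0..q})
     + (\<Sum>k=2..k1. measure lborel (bad_set F h k \<inter> {0..q})) + real k0 * measure lborel (bad_set F h k1 \<inter> {0..q}))"
    unfolding R_def
    by (intro has_bochner_integral_add has_bochner_integral_sum has_bochner_integral_mult_right hb A bad_set_borel cont)
  have L: "has_bochner_integral lborel (\<lambda>t. \<Sum>z\<in>Z1. indicator {z-h..z} t) (\<Sum>z\<in>Z1. measure lborel {z-h..z})"
    using h by (intro has_bochner_integral_sum has_bochner_integral_real_indicator) auto
  have "(\<Sum>z\<in>Z1. measure lborel {z-h..z}) \<le> measure lborel (A \<inter> {0..q}) + measure lborel (bad_set F h 2 \<inter> {0..q})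
     + (\<Sum>k=2..k1. measure lborel (bad_set F h k \<inter> {0..q})) + real k0 * measure lborel (bad_set F h k1 \<inter> {0..q})"
    unfolding has_bochner_integral_integral_eq[OF L, symmetric] has_bochner_integral_integral_eq[OF R, symmetric]
  proof (rule integral_mono[OF integrable.intros[OF L] integrable.intros[OF R]])
    fix t
    show "(\<Sum>z\<in>Z1. indicator {z-h..z} t) \<le> R t"
    proof (cases "t \<in> {0..q}")
      case True
      have "(\<Sum>z\<in>Z1. indicator {z-h..z} t :: real) = real (card {z \<in> Z1. t \<in> {z-h..z}})"
        using finZ1 by (simp add: indicator_def sum.If_cases Int_def)
      also have "\<dots> \<le> real (card {z \<in> {t..t+h}. F 0 z = 0})"
        unfolding of_nat_le_iff using fin[OF True] by (intro card_mono) (auto simp: Z1_def Z_def)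
      also have "\<dots> \<le> indicator A t + indicator (bad_set F h 2) t
         + (\<Sum>k=2..k1. indicator (bad_set F h k) t) + real k0 * indicator (bad_set F h k1) t"
        unfolding A_def using der h k1 k0[OF True] by (rule card_zeros_cell)
      also have "\<dots> = R t" using True by (simp add: R_def indicator_def)
      finally show ?thesis .
    next
      case False
      then have "(\<Sum>z\<in>Z1. indicator {z-h..z} t :: real) = 0"
        by (intro sum.neutral) (auto simp: Z1_def Z_def indicator_def)
      then show ?thesis using False by (simp add: R_def)
    qed
  qed
  moreover have "(\<Sum>z\<in>Z1. measure lborel {z-h..z}) = h * real (card Z1)" using h by simp
  moreover have "h * real (card Z) \<le> h * real k0 + h * real (card Z1)"
    using cardZ h by (metis distrib_left less_imp_le mult_left_mono)
  ultimately show ?thesis unfolding Z_def[symmetric] A_def[symmetric] by linarith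
qed

text \<open>By the intermediate value theorem every starting point with a sign change lies within
  \<open>h\<close> to the left of some zero, so the intervals \<open>{z-h..z}\<close> cover all of
  them. Stopping at \<open>q - h\<close> keeps that zero inside \<open>{0..q}\<close>.\<close>

lemma card_zeros_lower:
  fixes f :: "real \<Rightarrow> real"
  assumes cont: "continuous_on UNIV f" and h: "0 < h" and fin: "finite {z \<in> {0..q}. f z = 0}"
  shows "measure lborel ({t. f t * f (t + h) \<le> 0} \<inter> {0..q-h}) \<le> h * real (card {z \<in> {0..q}. f z = 0})"
proof -
  define Z where "Z = {z \<in> {0..q}. f z = 0}"
  have sub: "{t. f t * f (t + h) \<le> 0} \<inter> {0..q-h} \<subseteq> (\<Union>z\<in>Z. {z-h..z})"
  proof
    fix t assume t: "t \<in> {t. f t * f (t + h) \<le> 0} \<inter> {0..q-h}"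
    have c: "continuous_on {t..t+h} f" using cont continuous_on_subset by blast
    have "(f t \<le> 0 \<and> 0 \<le> f (t+h)) \<or> (f (t+h) \<le> 0 \<and> 0 \<le> f t)" using t by (auto simp: mult_le_0_iff)
    then have "\<exists>z\<ge>t. z \<le> t+h \<and> f z = 0"
      using IVT'[of f t 0 "t+h"] IVT2'[of f "t+h" 0 t] c h by auto
    then obtain z where "t \<le> z" "z \<le> t+h" "f z = 0" by auto
    then show "t \<in> (\<Union>z\<in>Z. {z-h..z})" using t h by (intro UN_I[of z]) (auto simp: Z_def)
  qed
  have cl: "closed ({t. f t * f (t + h) \<le> 0} \<inter> {0..q-h})"
    by (intro closed_Int closed_Collect_le continuous_intros continuous_on_compose2[OF cont]) auto
  have "measure lborel ({t. f t * f (t + h) \<le> 0} \<inter> {0..q-h}) \<le> measure lborel (\<Union>z\<in>Z. {z-h..z})"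
  proof (rule measure_mono_fmeasurable[OF sub])
    show "(\<Union>z\<in>Z. {z-h..z}) \<in> fmeasurable lborel"
      using fin by (intro fmeasurable.finite_UN fmeasurable_compact) (auto simp: Z_def)
  qed (use cl in simp)
  also have "\<dots> \<le> (\<Sum>z\<in>Z. measure lborel {z-h..z})"
    using fin h by (intro measure_UNION_le) (auto simp: Z_def)
  also have "\<dots> = h * real (card Z)" using h by simp
  finally show ?thesis by (simp add: Z_def)
qed

text \<open>Where the function exceeds \<open>c\<close> in modulus, membership in the bad set forces
  the squared \<open>k\<close>-th derivative to have integral at least c^2 / h^(2k-1) over the cell.
  Averaged over the circle this integral is, by Fubini and Parseval, at most \<open>h\<close> times
  pi n^(2k) times the sum of the squared amplitudes, and Markov's inequality gives the second
  term.\<close>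

lemma bad_set_measure:
  assumes h: "0 < h" and c: "0 < c" and k: "1 \<le> k"
  shows "measure lborel (bad_set (phase_poly r p n) h k \<inter> {0..2*pi})
     \<le> measure lborel ({t. \<bar>phase_poly r p n 0 t\<bar> \<le> c} \<inter> {0..2*pi})
       + pi * (real n * h) ^ (2 * k) * (\<Sum>j=1..n. (r j)\<^sup>2) / c\<^sup>2"
proof -
  let ?F = "phase_poly r p n"
  define G where "G t = integral {0..h} (\<lambda>s. (?F k (t + s))\<^sup>2)" for t
  have cont: "continuous_on S (?F j)" for S j
    using deriv_family_continuous[of ?F, OF phase_poly_deriv] .
  have G: "continuous_on S G" for S unfolding G_def by (intro integral_window_continuous cont)
  have G0: "0 \<le> G t" for t unfolding G_def
    by (intro integral_nonneg integrable_continuous_real continuous_intros continuous_on_compose2[OF cont[of UNIV]]) auto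
  define d where "d = c\<^sup>2 / h ^ (2 * k - 1)"
  have d: "0 < d" using c h by (simp add: d_def)
  have pars: "integral {0..2*pi} (\<lambda>t. (?F k (t + s))\<^sup>2) \<le> pi * real n ^ (2 * k) * (\<Sum>j=1..n. (r j)\<^sup>2)" for s
  proof -
    have "((\<lambda>t. (\<Sum>j=1..n. (r j * real j ^ k) * cos (real j * t + (real j * s + p j + real k * (pi / 2))))\<^sup>2) has_integral
        pi * (\<Sum>j=1..n. (r j * real j ^ k)\<^sup>2)) {0..2*pi}"
      by (rule parseval_phase)
    then have "integral {0..2*pi} (\<lambda>t. (?F k (t + s))\<^sup>2) = pi * (\<Sum>j=1..n. (r j * real j ^ k)\<^sup>2)"
      by (simp add: integral_unique phase_poly_def algebra_simps)
    also have "(\<Sum>j=1..n. (r j * real j ^ k)\<^sup>2) \<le> (\<Sum>j=1..n. real n ^ (2 * k) * (r j)\<^sup>2)"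
    proof (rule sum_mono)
      fix j assume j: "j \<in> {1..n}"
      have "(r j * real j ^ k)\<^sup>2 = real j ^ (2 * k) * (r j)\<^sup>2"
        by (simp add: power_mult_distrib power_mult mult.commute[of 2] mult.commute)
      also have "\<dots> \<le> real n ^ (2 * k) * (r j)\<^sup>2" using j by (intro mult_right_mono power_mono) auto
      finally show "(r j * real j ^ k)\<^sup>2 \<le> real n ^ (2 * k) * (r j)\<^sup>2" .
    qed
    finally show ?thesis by (simp add: sum_distrib_left mult.assoc)
  qed
  have "integral {0..2*pi} G = integral {0..h} (\<lambda>s. integral {0..2*pi} (\<lambda>t. (?F k (t + s))\<^sup>2))"
  proof -
    have "continuous_on (cbox (0, 0) (2*pi, h)) (\<lambda>(t, s). (?F k (t + s))\<^sup>2)"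
      unfolding case_prod_unfold by (intro continuous_intros continuous_on_compose2[OF cont[of UNIV]]) auto
    moreover have "G = (\<lambda>t. integral {0..h} (\<lambda>s. (?F k (t + s))\<^sup>2))" by (rule ext) (simp add: G_def)
    ultimately show ?thesis using integral_swap_continuous by fastforce
  qed
  also have "\<dots> \<le> integral {0..h} (\<lambda>s. pi * real n ^ (2 * k) * (\<Sum>j=1..n. (r j)\<^sup>2))"
  proof (rule integral_le)
    have "continuous_on ({0..h} \<times> cbox 0 (2*pi)) (\<lambda>(s, t). (?F k (t + s))\<^sup>2)"
      unfolding case_prod_unfold by (intro continuous_intros continuous_on_compose2[OF cont[of UNIV]]) auto
    from integral_continuous_on_param[OF this]
    show "(\<lambda>s. integral {0..2*pi} (\<lambda>t. (?F k (t + s))\<^sup>2)) integrable_on {0..h}"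
      by (intro integrable_continuous_real) simp
  qed (use pars in auto)
  also have "\<dots> = h * (pi * real n ^ (2 * k) * (\<Sum>j=1..n. (r j)\<^sup>2))" using h by simp
  finally have intG: "integral {0..2*pi} G \<le> h * (pi * real n ^ (2 * k) * (\<Sum>j=1..n. (r j)\<^sup>2))" .
  have sub: "bad_set ?F h k \<inter> {0..2*pi} \<subseteq> ({t. \<bar>?F 0 t\<bar> \<le> c} \<inter> {0..2*pi}) \<union> {t \<in> {0..2*pi}. d \<le> G t}"
  proof
    fix t assume t: "t \<in> bad_set ?F h k \<inter> {0..2*pi}"
    show "t \<in> ({t. \<bar>?F 0 t\<bar> \<le> c} \<inter> {0..2*pi}) \<union> {t \<in> {0..2*pi}. d \<le> G t}"
    proof (cases "\<bar>?F 0 t\<bar> \<le> c")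
      case False
      then have "c\<^sup>2 \<le> \<bar>?F 0 t\<bar>\<^sup>2" using c by (intro power_mono) auto
      also have "\<dots> \<le> h ^ (2 * k - 1) * G t" using t by (simp add: bad_set_def G_def)
      finally have "d \<le> G t" using h by (simp add: d_def field_simps)
      then show ?thesis using t by auto
    qed (use t in auto)
  qed
  have cl1: "closed ({t. \<bar>?F 0 t\<bar> \<le> c} \<inter> {0..2*pi})"
    by (intro closed_Int closed_Collect_le continuous_intros cont closed_atLeastAtMost)
  have "closed ({t. d \<le> G t} \<inter> {0..2*pi})"
    by (intro closed_Int closed_Collect_le continuous_intros G closed_atLeastAtMost)
  then have cl2: "closed {t \<in> {0..2*pi}. d \<le> G t}" 
    by (simp only: Int_def mem_Collect_eq conj_commute)
  have fm: "S \<in> fmeasurable lborel" if "closed S" "S \<subseteq> {0..2*pi}" for S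
    using that by (intro fmeasurable_compact) (meson bounded_closed_interval bounded_subset compact_eq_bounded_closed)
  have "measure lborel (bad_set ?F h k \<inter> {0..2*pi})
      \<le> measure lborel (({t. \<bar>?F 0 t\<bar> \<le> c} \<inter> {0..2*pi}) \<union> {t \<in> {0..2*pi}. d \<le> G t})"
    using bad_set_borel[of ?F h k] cont
    by (intro measure_mono_fmeasurable[OF sub] fmeasurable.Un fm cl1 cl2) auto
  also have "\<dots> \<le> measure lborel ({t. \<bar>?F 0 t\<bar> \<le> c} \<inter> {0..2*pi}) + measure lborel {t \<in> {0..2*pi}. d \<le> G t}"
    by (intro measure_Un_le fmeasurableD fm cl1 cl2) auto
  also have "measure lborel {t \<in> {0..2*pi}. d \<le> G t} \<le> integral {0..2*pi} G / d"
    by (intro markov_inequality_Icc G G0 d)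
  also have "\<dots> \<le> h * (pi * real n ^ (2 * k) * (\<Sum>j=1..n. (r j)\<^sup>2)) / d"
    using intG d by (intro divide_right_mono) auto
  also have "\<dots> = pi * (real n * h) ^ (2 * k) * (\<Sum>j=1..n. (r j)\<^sup>2) / c\<^sup>2"
  proof -
    have "h ^ (2 * k) = h * h ^ (2 * k - 1)" using k by (cases k) auto
    then show ?thesis by (simp add: d_def power_mult_distrib)
  qed
  finally show ?thesis by simp
qed

section \<open>Characteristic functions of weighted sums\<close>

lemma exp_minus_bound:
  fixes s :: real assumes "0 \<le> s"
  shows "\<bar>exp (- s) - (1 - s)\<bar> \<le> s\<^sup>2 / 2"
proof -
  have le: "1 - s \<le> exp (- s)" using exp_ge_add_one_self[of "-s"] by simp
  have "\<exists>t. \<bar>t\<bar> \<le> \<bar>-s\<bar> \<and> exp (- s) = (\<Sum>m<2. (- s) ^ m / fact m) + exp t / fact 2 * (- s) ^ 2 \<and> t \<le> 0"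
  proof (cases "s = 0")
    case False
    then have "- s < 0" using assms by simp
    then have "\<exists>t. - s < t \<and> t < 0 \<and> exp (- s) = (\<Sum>m<2. exp 0 / fact m * (- s) ^ m) + exp t / fact 2 * (- s) ^ 2"
      by (intro Maclaurin_minus) auto
    then show ?thesis by (auto simp: numeral_2_eq_2)
  qed (auto intro!: exI[of _ 0] simp: numeral_2_eq_2)
  then obtain t where t: "t \<le> 0" "exp (- s) = (\<Sum>m<2. (- s) ^ m / fact m) + exp t / fact 2 * (- s) ^ 2" by auto
  then have "exp (- s) = 1 - s + exp t / 2 * s\<^sup>2" by (simp add: numeral_2_eq_2)
  moreover have "exp t / 2 * s\<^sup>2 \<le> 1 / 2 * s\<^sup>2" using t by (intro mult_right_mono) auto
  ultimately show ?thesis using le by simp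
qed

lemma exp_neg_lipschitz:
  fixes x y :: real assumes "0 \<le> x" "0 \<le> y"
  shows "\<bar>exp (- x) - exp (- y)\<bar> \<le> \<bar>x - y\<bar>"
proof -
  have *: "exp (- x) - exp (- y) \<le> y - x \<and> 0 \<le> exp (- x) - exp (- y)" if "x \<le> y" "0 \<le> x" for x y :: real
  proof -
    define e where "e = exp (- (y - x))"
    have "1 + - (y - x) \<le> e" unfolding e_def by (rule exp_ge_add_one_self)
    moreover have "e \<le> 1" using that by (simp add: e_def)
    ultimately have e: "1 - (y - x) \<le> e" "e \<le> 1" by linarith+
    have "exp (- x) - exp (- y) = exp (- x) * (1 - e)" by (simp add: e_def algebra_simps mult_exp_exp)
    also have "\<dots> \<le> 1 * (1 - e)" using that e by (intro mult_right_mono) auto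
    finally show ?thesis using that e by simp
  qed
  show ?thesis using *[of x y] *[of y x] assms by (cases "x \<le> y") auto
qed

text \<open>The estimates concern linear forms in finite subfamilies, so the index set is abstract.
  It is later a sum type: \<open>Inl\<close> carries the cosine coefficients and \<open>Inr\<close>
  the sine coefficients.\<close>

locale iid_family = prob_space M for M :: "'w measure" +
  fixes X :: "'i \<Rightarrow> 'w \<Rightarrow> real" and I :: "'i set" and \<mu> :: "real measure"
  assumes indep: "indep_vars (\<lambda>_. borel) X I"
    and law: "\<And>i. i \<in> I \<Longrightarrow> distr M borel (X i) = \<mu>"
    and mu: "real_distribution \<mu>"
    and symm: "distr \<mu> borel uminus = \<mu>"
    and var1: "(\<integral>x. x\<^sup>2 \<partial>\<mu>) = 1"
    and fourth: "integrable \<mu> (\<lambda>x. x ^ 4)"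
begin

sublocale mu: real_distribution \<mu> by (rule mu)

lemma X_measurable [measurable]: "i \<in> I \<Longrightarrow> X i \<in> borel_measurable M"
  using indep by (auto simp: indep_vars_def)

lemma integrable_moment:
  assumes "k \<le> 4" shows "integrable \<mu> (\<lambda>x. x ^ k)"
proof (rule Bochner_Integration.integrable_bound[of \<mu> "\<lambda>x. 1 + x ^ 4"])
  show "integrable \<mu> (\<lambda>x. 1 + x ^ 4)" using fourth by simp
  show "AE x in \<mu>. norm (x ^ k) \<le> norm (1 + x ^ 4)"
  proof (rule AE_I2)
    fix x :: real
    have "\<bar>x\<bar> ^ k \<le> 1 + \<bar>x\<bar> ^ 4"
    proof (cases "\<bar>x\<bar> \<le> 1")
      case True
      then have "\<bar>x\<bar> ^ k \<le> 1" by (simp add: power_le_one)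
      then show ?thesis using zero_le_power[of "\<bar>x\<bar>" 4] by linarith
    next
      case False
      then have "\<bar>x\<bar> ^ k \<le> \<bar>x\<bar> ^ 4" using assms by (intro power_increasing) auto
      then show ?thesis by linarith
    qed
    then show "norm (x ^ k) \<le> norm (1 + x ^ 4)" by (simp add: power_abs)
  qed
qed auto

lemma odd_moment: "odd k \<Longrightarrow> (\<integral>x. x ^ k \<partial>\<mu>) = 0"
proof -
  assume "odd k"
  have "(\<integral>x. x ^ k \<partial>\<mu>) = (\<integral>x. x ^ k \<partial>distr \<mu> borel uminus)" by (simp add: symm)
  also have "\<dots> = (\<integral>x. (- x) ^ k \<partial>\<mu>)" by (intro integral_distr) auto
  also have "\<dots> = - (\<integral>x. x ^ k \<partial>\<mu>)" using \<open>odd k\<close> by simp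
  finally show ?thesis by simp
qed

text \<open>The added 1 pays for the fourth-order term of the Gaussian in \<open>char_bound\<close>,
  and it gives \<open>1 <= K4\<close>, which lets numerical constants be absorbed.\<close>

definition K4 :: real where "K4 = (\<integral>x. x ^ 4 \<partial>\<mu>) + 1"

lemma K4_pos: "1 \<le> K4" unfolding K4_def by (simp add: integral_nonneg_AE)

text \<open>By symmetry the first and third moments vanish, so the Taylor polynomial agrees with
  that of the Gaussian through third order and the discrepancy is of order t^4. Summed over 2n
  weights of size n^(-1/2), it becomes O(1/n).\<close>

lemma char_bound: "cmod (char \<mu> t - exp (- of_real (t\<^sup>2 / 2))) \<le> K4 * t ^ 4"
proof -
  define m4 where "m4 = (\<integral>x. x ^ 4 \<partial>\<mu>)"
  have m4: "0 \<le> m4" unfolding m4_def by (simp add: integral_nonneg_AE)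
  have "cmod (char \<mu> t - (\<Sum>k\<le>4. ((\<i> * t) ^ k / fact k) * (\<integral>x. x ^ k \<partial>\<mu>))) \<le> (2 * \<bar>t\<bar> ^ 4 / fact 4) * (\<integral>x. \<bar>x\<bar> ^ 4 \<partial>\<mu>)"
    using mu.char_approx1[of 4 t] integrable_moment by simp
  moreover have "(\<Sum>k\<le>4. ((\<i> * t) ^ k / fact k) * (\<integral>x. x ^ k \<partial>\<mu>)) = of_real (1 - t\<^sup>2 / 2 + t ^ 4 / 24 * m4)"
  proof -
    have "{..4::nat} = {0,1,2,3,4}" by auto
    moreover have "(\<integral>x. x ^ 3 \<partial>\<mu>) = 0" "(\<integral>x. x \<partial>\<mu>) = 0" using odd_moment[of 3] odd_moment[of 1] by auto
    moreover have sq: "(\<i> * complex_of_real t) ^ 2 = - of_real (t ^ 2)"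
      by (simp add: power_mult_distrib)
    moreover have "(\<i> * complex_of_real t) ^ 4 = of_real (t ^ 4)"
      using arg_cong[OF sq, of "\<lambda>z. z\<^sup>2"] by (simp flip: power_mult)
    ultimately show ?thesis using mu.prob_space
      by (simp add: var1 m4_def fact_numeral)
  qed
  ultimately have 1: "cmod (char \<mu> t - of_real (1 - t\<^sup>2 / 2 + t ^ 4 / 24 * m4)) \<le> t ^ 4 / 12 * m4"
    by (simp add: m4_def fact_numeral power_abs[symmetric] abs_of_nonneg)
  have 2: "cmod (of_real (1 - t\<^sup>2 / 2 + t ^ 4 / 24 * m4) - exp (- of_real (t\<^sup>2 / 2))) \<le> t ^ 4 / 24 * m4 + t ^ 4 / 8"
  proof -
    have "cmod (of_real (1 - t\<^sup>2 / 2 + t ^ 4 / 24 * m4) - exp (- of_real (t\<^sup>2 / 2)))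
       = \<bar>(1 - t\<^sup>2 / 2 + t ^ 4 / 24 * m4) - exp (- (t\<^sup>2 / 2))\<bar>"
      unfolding of_real_minus[symmetric] exp_of_real of_real_diff[symmetric] norm_of_real ..
    also have "\<dots> \<le> t ^ 4 / 24 * m4 + t ^ 4 / 8"
    proof -
      have "\<bar>exp (- (t\<^sup>2 / 2)) - (1 - t\<^sup>2 / 2)\<bar> \<le> t ^ 4 / 8"
        using exp_minus_bound[of "t\<^sup>2 / 2"] by (simp add: power_divide)
      moreover have "0 \<le> t ^ 4 / 24 * m4" using m4 by simp
      ultimately show ?thesis unfolding abs_le_iff by linarith
    qed
    finally show ?thesis .
  qed
  have "cmod (char \<mu> t - exp (- of_real (t\<^sup>2 / 2))) \<le> t ^ 4 / 12 * m4 + (t ^ 4 / 24 * m4 + t ^ 4 / 8)"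
    using norm_triangle_mono[OF 1 2] by simp
  also have "\<dots> = (m4 / 8 + 1 / 8) * t ^ 4" by (simp add: field_simps)
  also have "\<dots> \<le> K4 * t ^ 4" using m4 by (intro mult_right_mono) (auto simp: K4_def m4_def[symmetric])
  finally show ?thesis .
qed

text \<open>Independence factorises the characteristic function. All factors have modulus at most 1,
  so two products differ by at most the sum of the differences of their factors.\<close>

lemma expectation_cos_sum:
  assumes J: "finite J" "J \<subseteq> I"
  shows "\<bar>expectation (\<lambda>\<omega>. cos (\<Sum>i\<in>J. \<theta> i * X i \<omega>)) - exp (- (\<Sum>i\<in>J. (\<theta> i)\<^sup>2) / 2)\<bar> \<le> K4 * (\<Sum>i\<in>J. \<theta> i ^ 4)"
proof -
  have ind: "indep_vars (\<lambda>_. borel) (\<lambda>i \<omega>. \<theta> i * X i \<omega>) J"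
    using indep_vars_compose2[OF indep_vars_subset[OF indep J(2)], of "\<lambda>i x. \<theta> i * x" "\<lambda>_. borel"] by simp
  have [measurable]: "X i \<in> borel_measurable M" if "i \<in> J" for i using that J by auto
  define L where "L \<omega> = (\<Sum>i\<in>J. \<theta> i * X i \<omega>)" for \<omega>
  have [measurable]: "L \<in> borel_measurable M" unfolding L_def by measurable
  interpret L: real_distribution "distr M borel L" by simp
  have chL: "char (distr M borel L) 1 = (\<Prod>i\<in>J. char \<mu> (\<theta> i))"
    unfolding L_def char_distr_sum[OF ind]
  proof (rule prod.cong[OF refl])
    fix i assume i: "i \<in> J"
    have "char (distr M borel (\<lambda>\<omega>. \<theta> i * X i \<omega>)) 1 = (CLINT \<omega>|M. iexp (\<theta> i * X i \<omega>))"
      unfolding char_def using i by (subst integral_distr) auto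
    also have "\<dots> = char (distr M borel (X i)) (\<theta> i)"
      unfolding char_def using i by (subst integral_distr) auto
    finally show "char (distr M borel (\<lambda>\<omega>. \<theta> i * X i \<omega>)) 1 = char \<mu> (\<theta> i)" using law J i by auto
  qed
  have "Re (char (distr M borel L) 1) = expectation (\<lambda>\<omega>. cos (L \<omega>))"
  proof -
    have int_iexp: "integrable (distr M borel L) (\<lambda>x. iexp (1 * x))" using L.integrable_iexp[of "\<lambda>x. 1 * x"] by simp
    have "Re (char (distr M borel L) 1) = (\<integral>x. cos x \<partial>distr M borel L)"
      unfolding char_def using integral_Re[OF int_iexp] by (simp add: Re_exp)
    then show ?thesis by (simp add: integral_distr)
  qed
  moreover have "Re (\<Prod>i\<in>J. exp (- complex_of_real ((\<theta> i)\<^sup>2 / 2))) = exp (- (\<Sum>i\<in>J. (\<theta> i)\<^sup>2) / 2)"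
  proof -
    have "(\<Prod>i\<in>J. exp (- complex_of_real ((\<theta> i)\<^sup>2 / 2))) = of_real (exp (\<Sum>i\<in>J. - ((\<theta> i)\<^sup>2 / 2)))"
      using J by (simp add: exp_sum exp_of_real[symmetric])
    also have "(\<Sum>i\<in>J. - ((\<theta> i)\<^sup>2 / 2)) = - (\<Sum>i\<in>J. (\<theta> i)\<^sup>2) / 2" by (simp add: sum_negf sum_divide_distrib)
    finally show ?thesis by simp
  qed
  ultimately have "\<bar>expectation (\<lambda>\<omega>. cos (L \<omega>)) - exp (- (\<Sum>i\<in>J. (\<theta> i)\<^sup>2) / 2)\<bar>
      = \<bar>Re ((\<Prod>i\<in>J. char \<mu> (\<theta> i)) - (\<Prod>i\<in>J. exp (- complex_of_real ((\<theta> i)\<^sup>2 / 2))))\<bar>"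
    unfolding chL by simp
  also have "\<dots> \<le> cmod ((\<Prod>i\<in>J. char \<mu> (\<theta> i)) - (\<Prod>i\<in>J. exp (- complex_of_real ((\<theta> i)\<^sup>2 / 2))))"
    by (rule abs_Re_le_cmod)
  also have "\<dots> \<le> (\<Sum>i\<in>J. cmod (char \<mu> (\<theta> i) - exp (- complex_of_real ((\<theta> i)\<^sup>2 / 2))))"
    by (rule norm_prod_diff) (auto simp: mu.cmod_char_le_1 norm_exp_eq_Re)
  also have "\<dots> \<le> (\<Sum>i\<in>J. K4 * \<theta> i ^ 4)" by (intro sum_mono char_bound)
  finally show ?thesis unfolding L_def by (simp add: sum_distrib_left)
qed

text \<open>Chebyshev's inequality for the centred squares, which are pairwise uncorrelated and have
  second moment at most \<open>K4\<close>. The bound is summable once the index sets grow like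
  \<open>j ^ 3\<close>.\<close>

lemma prob_sum_squares:
  assumes J: "finite J" "J \<subseteq> I" "J \<noteq> {}"
  shows "prob {\<omega> \<in> space M. 2 * real (card J) \<le> (\<Sum>i\<in>J. (X i \<omega>)\<^sup>2)} \<le> K4 / real (card J)"
proof -
  have [measurable]: "X i \<in> borel_measurable M" if "i \<in> J" for i using that J by auto
  define Y where "Y i \<omega> = (X i \<omega>)\<^sup>2 - 1" for i \<omega>
  have [measurable]: "Y i \<in> borel_measurable M" if "i \<in> J" for i unfolding Y_def using that by measurable
  have trans: "expectation (\<lambda>\<omega>. g (X i \<omega>)) = (\<integral>x. g x \<partial>\<mu>)" "integrable M (\<lambda>\<omega>. g (X i \<omega>)) \<longleftrightarrow> integrable \<mu> g"
    if [measurable]: "g \<in> borel_measurable borel" and "i \<in> J" for i and g :: "real \<Rightarrow> real"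
    using that J unfolding law[of i, symmetric, OF subsetD[OF J(2) that(2)]]
    by (auto simp: integral_distr integrable_distr_eq)
  have X2: "integrable M (\<lambda>\<omega>. (X i \<omega>)\<^sup>2)" "expectation (\<lambda>\<omega>. (X i \<omega>)\<^sup>2) = 1" if "i \<in> J" for i
    using trans[of "\<lambda>x. x\<^sup>2" i] that integrable_moment[of 2] var1 by auto
  have X4: "integrable M (\<lambda>\<omega>. (X i \<omega>) ^ 4)" "expectation (\<lambda>\<omega>. (X i \<omega>) ^ 4) \<le> K4" if "i \<in> J" for i
    using trans[of "\<lambda>x. x ^ 4" i] that integrable_moment[of 4] by (auto simp: K4_def)
  have Yint: "integrable M (Y i)" "expectation (Y i) = 0" if "i \<in> J" for i
    unfolding Y_def using X2[OF that] prob_space by auto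
  have ind: "indep_var borel (Y i) borel (Y j)" if "i \<in> J" "j \<in> J" "i \<noteq> j" for i j
  proof -
    have "indep_vars (\<lambda>_. borel) Y (insert i {j})"
      unfolding Y_def[abs_def]
      using indep_vars_compose2[OF indep_vars_subset[OF indep, of "{i,j}"], of "\<lambda>i x. x\<^sup>2 - 1" "\<lambda>_. borel"] that J by auto
    from indep_vars_sum[OF _ _ this] that(3) show ?thesis by simp
  qed
  have YY: "integrable M (\<lambda>\<omega>. Y i \<omega> * Y j \<omega>)" "expectation (\<lambda>\<omega>. Y i \<omega> * Y j \<omega>) \<le> (if i = j then K4 else 0)" if "i \<in> J" "j \<in> J" for i j
  proof -
    have eq: "Y i \<omega> * Y i \<omega> = (X i \<omega>) ^ 4 - 2 * (X i \<omega>)\<^sup>2 + 1" for \<omega>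
      by (simp add: Y_def algebra_simps power2_eq_square power4_eq_xxxx)
    have "integrable M (\<lambda>\<omega>. Y i \<omega> * Y i \<omega>)" unfolding eq using X2(1)[OF that(1)] X4(1)[OF that(1)] by auto
    moreover have "expectation (\<lambda>\<omega>. Y i \<omega> * Y i \<omega>) \<le> K4"
      unfolding eq using X2[OF that(1)] X4[OF that(1)] prob_space by auto
    moreover have "integrable M (\<lambda>\<omega>. Y i \<omega> * Y j \<omega>)" "expectation (\<lambda>\<omega>. Y i \<omega> * Y j \<omega>) = 0" if "i \<noteq> j"
      using indep_var_integrable[OF ind] indep_var_lebesgue_integral[OF ind] Yint that \<open>i \<in> J\<close> \<open>j \<in> J\<close> by auto
    ultimately show "integrable M (\<lambda>\<omega>. Y i \<omega> * Y j \<omega>)" "expectation (\<lambda>\<omega>. Y i \<omega> * Y j \<omega>) \<le> (if i = j then K4 else 0)"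
      by (cases "i = j"; auto)+
  qed
  define S where "S \<omega> = (\<Sum>i\<in>J. Y i \<omega>)" for \<omega>
  have S2: "(S \<omega>)\<^sup>2 = (\<Sum>i\<in>J. \<Sum>j\<in>J. Y i \<omega> * Y j \<omega>)" for \<omega>
    by (simp add: S_def power2_eq_square sum_product)
  have [measurable]: "S \<in> borel_measurable M" unfolding S_def by measurable
  have intS2: "integrable M (\<lambda>\<omega>. (S \<omega>)\<^sup>2)" unfolding S2 by (intro Bochner_Integration.integrable_sum YY)
  have "expectation S = 0" unfolding S_def using Yint by simp
  moreover have "expectation (\<lambda>\<omega>. (S \<omega>)\<^sup>2) \<le> (\<Sum>i\<in>J. \<Sum>j\<in>J. if i = j then K4 else 0)"
  proof -
    have "expectation (\<lambda>\<omega>. (S \<omega>)\<^sup>2) = (\<Sum>i\<in>J. \<Sum>j\<in>J. expectation (\<lambda>\<omega>. Y i \<omega> * Y j \<omega>))"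
      unfolding S2 by (subst Bochner_Integration.integral_sum, (intro Bochner_Integration.integrable_sum YY; assumption),
         intro sum.cong refl Bochner_Integration.integral_sum YY)
    also have "\<dots> \<le> (\<Sum>i\<in>J. \<Sum>j\<in>J. if i = j then K4 else 0)" by (intro sum_mono YY)
    finally show ?thesis .
  qed
  moreover have "(\<Sum>i\<in>J. \<Sum>j\<in>J. if i = j then K4 else 0) = real (card J) * K4" using J by simp
  moreover have c: "0 < real (card J)" using J by (simp add: card_gt_0_iff)
  ultimately have "prob {\<omega> \<in> space M. real (card J) \<le> \<bar>S \<omega> - expectation S\<bar>} \<le> (real (card J) * K4) / (real (card J))\<^sup>2"
    using Chebyshev_inequality[of S "real (card J)"] intS2
    by (smt (verit, best) Bochner_Integration.integral_cong divide_right_mono zero_le_power2 \<open>S \<in> borel_measurable M\<close>)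
  also have "\<dots> = K4 / real (card J)" using c by (simp add: power2_eq_square)
  finally have P: "prob {\<omega> \<in> space M. real (card J) \<le> \<bar>S \<omega>\<bar>} \<le> K4 / real (card J)" using \<open>expectation S = 0\<close> by simp
  have "prob {\<omega> \<in> space M. 2 * real (card J) \<le> (\<Sum>i\<in>J. (X i \<omega>)\<^sup>2)} \<le> prob {\<omega> \<in> space M. real (card J) \<le> \<bar>S \<omega>\<bar>}"
    by (intro finite_measure_mono) (auto simp: S_def Y_def sum_subtractf)
  then show ?thesis using P by linarith
qed

text \<open>With g = exp(-v/2), expand the expected squared modulus of the integral of exp(iL) minus
  its Gaussian value. The double integral involves L_s - L_t, a linear form of variance 2v -
  2c(s,t), so its cosine has expectation near exp(-(v - c)), which is within |c| of g^2. The main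
  terms cancel and leave the integrated absolute covariance plus errors from
  \<open>char_bound\<close>. The constant 18 is 16 + 2: weights of the difference are at most 2B,
  with fourth power 16 B^4, and the cross term adds at most 2.\<close>

lemma second_moment_char_integral:
  fixes U :: "'u measure" and \<theta> :: "'i \<Rightarrow> 'u \<Rightarrow> real"
  assumes U: "finite_measure U" and J: "finite J" "J \<subseteq> I"
    and \<theta>m [measurable]: "\<And>i. i \<in> J \<Longrightarrow> \<theta> i \<in> borel_measurable U"
    and B: "\<And>i s. i \<in> J \<Longrightarrow> \<bar>\<theta> i s\<bar> \<le> B"
    and v: "\<And>s. (\<Sum>i\<in>J. (\<theta> i s)\<^sup>2) = v"
  defines "L \<equiv> \<lambda>s \<omega>. \<Sum>i\<in>J. \<theta> i s * X i \<omega>"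
  shows "expectation (\<lambda>\<omega>. ((\<integral>s. cos (L s \<omega>) \<partial>U) - exp (- v / 2) * measure U (space U))\<^sup>2 + (\<integral>s. sin (L s \<omega>) \<partial>U)\<^sup>2)
     \<le> (\<integral>s. \<integral>t. \<bar>\<Sum>i\<in>J. \<theta> i s * \<theta> i t\<bar> \<partial>U \<partial>U) + 18 * K4 * real (card J) * B ^ 4 * (measure U (space U))\<^sup>2"
    and "integrable M (\<lambda>\<omega>. ((\<integral>s. cos (L s \<omega>) \<partial>U) - exp (- v / 2) * measure U (space U))\<^sup>2 + (\<integral>s. sin (L s \<omega>) \<partial>U)\<^sup>2)"
proof -
  interpret U: finite_measure U by fact
  interpret MU: pair_sigma_finite M U ..
  interpret MUf: finite_measure "M \<Otimes>\<^sub>M U"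
    by (rule finite_measure_pair_measure) (use U finite_measure_axioms in auto)
  interpret UU: finite_measure "U \<Otimes>\<^sub>M U"
    by (rule finite_measure_pair_measure) (use U in auto)
  interpret MUU: pair_sigma_finite M "U \<Otimes>\<^sub>M U" ..
  interpret MUUf: finite_measure "M \<Otimes>\<^sub>M (U \<Otimes>\<^sub>M U)"
    by (rule finite_measure_pair_measure) (use UU.finite_measure_axioms finite_measure_axioms in auto)
  interpret UUp: pair_sigma_finite U U ..
  define u where "u = measure U (space U)"
  define g where "g = exp (- v / 2)"
  define c where "c s t = (\<Sum>i\<in>J. \<theta> i s * \<theta> i t)" for s t
  define e where "e = K4 * real (card J) * B ^ 4"
  have u0: "0 \<le> u" by (simp add: u_def)
  have v0: "0 \<le> v" using v[of undefined] by (metis sum_nonneg zero_le_power2)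
  have g: "0 \<le> g" "g \<le> 1" "g * g = exp (- v)" using v0 by (auto simp: g_def mult_exp_exp)
  have e0: "0 \<le> e" using K4_pos by (simp add: e_def)
  have [measurable]: "X i \<in> borel_measurable M" if "i \<in> J" for i using that J by auto
  have Lm [measurable]: "(\<lambda>(\<omega>, s). L s \<omega>) \<in> borel_measurable (M \<Otimes>\<^sub>M U)"
    unfolding L_def by measurable
  have [measurable]: "L s \<in> borel_measurable M" if "s \<in> space U" for s
    unfolding L_def by measurable
  have [measurable]: "(\<lambda>s. L s \<omega>) \<in> borel_measurable U" for \<omega>
    unfolding L_def by measurable
  have [measurable]: "(\<lambda>(s, t). c s t) \<in> borel_measurable (U \<Otimes>\<^sub>M U)"
    unfolding c_def by measurable
  have Bsq: "\<theta> i s ^ 4 \<le> B ^ 4" if "i \<in> J" for i s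
  proof -
    have "\<bar>\<theta> i s\<bar> ^ 4 \<le> B ^ 4" using B[OF that, of s] by (intro power_mono) auto
    then show ?thesis by (simp add: power_abs[symmetric] abs_of_nonneg)
  qed
  have E1: "g - e \<le> expectation (\<lambda>\<omega>. cos (L s \<omega>))" for s
  proof -
    have "K4 * (\<Sum>i\<in>J. \<theta> i s ^ 4) \<le> K4 * (\<Sum>i\<in>J. B ^ 4)"
      using K4_pos Bsq by (intro mult_left_mono sum_mono) auto
    then have "K4 * (\<Sum>i\<in>J. \<theta> i s ^ 4) \<le> e" by (simp add: e_def mult.assoc)
    then show ?thesis using expectation_cos_sum[OF J, of "\<lambda>i. \<theta> i s"] v[of s] by (simp add: L_def g_def)
  qed
  have E2: "expectation (\<lambda>\<omega>. cos (L s \<omega> - L t \<omega>)) \<le> g * g + \<bar>c s t\<bar> + 16 * e" for s t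
  proof -
    have eq: "L s \<omega> - L t \<omega> = (\<Sum>i\<in>J. (\<theta> i s - \<theta> i t) * X i \<omega>)" for \<omega>
      by (simp add: L_def sum_subtractf left_diff_distrib)
    have sq: "(\<Sum>i\<in>J. (\<theta> i s - \<theta> i t)\<^sup>2) = 2 * v - 2 * c s t"
      using v[of s] v[of t] by (simp add: power2_diff sum.distrib sum_subtractf c_def sum_distrib_left mult.assoc)
    then have vc: "0 \<le> v - c s t" by (smt (verit) sum_nonneg zero_le_power2)
    have "(\<theta> i s - \<theta> i t) ^ 4 \<le> 16 * B ^ 4" if "i \<in> J" for i
    proof -
      have "\<bar>\<theta> i s - \<theta> i t\<bar> ^ 4 \<le> (2 * B) ^ 4" using B[OF that, of s] B[OF that, of t] by (intro power_mono) auto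
      then show ?thesis by (simp add: power_abs[symmetric] abs_of_nonneg power_mult_distrib)
    qed
    then have "K4 * (\<Sum>i\<in>J. (\<theta> i s - \<theta> i t) ^ 4) \<le> K4 * (\<Sum>i\<in>J. 16 * B ^ 4)"
      using K4_pos by (intro mult_left_mono sum_mono) auto
    then have "K4 * (\<Sum>i\<in>J. (\<theta> i s - \<theta> i t) ^ 4) \<le> 16 * e" by (simp add: e_def mult_ac)
    then have "expectation (\<lambda>\<omega>. cos (L s \<omega> - L t \<omega>)) \<le> exp (- (v - c s t)) + 16 * e"
    proof -
      have h: "- (2 * v - 2 * c s t) / 2 = - (v - c s t)" by simp
      have "\<bar>expectation (\<lambda>\<omega>. cos (L s \<omega> - L t \<omega>)) - exp (- (v - c s t))\<bar> \<le> K4 * (\<Sum>i\<in>J. (\<theta> i s - \<theta> i t) ^ 4)"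
        using expectation_cos_sum[OF J, of "\<lambda>i. \<theta> i s - \<theta> i t"] unfolding sq h eq .
      then show ?thesis using \<open>K4 * (\<Sum>i\<in>J. (\<theta> i s - \<theta> i t) ^ 4) \<le> 16 * e\<close> by linarith
    qed
    moreover have "exp (- (v - c s t)) \<le> exp (- v) + \<bar>c s t\<bar>"
      using exp_neg_lipschitz[OF vc v0] by simp
    ultimately show ?thesis by (simp add: g(3))
  qed
  define C where "C \<omega> = (\<integral>s. cos (L s \<omega>) \<partial>U)" for \<omega>
  define S where "S \<omega> = (\<integral>s. sin (L s \<omega>) \<partial>U)" for \<omega>
  have [measurable]: "C \<in> borel_measurable M" "S \<in> borel_measurable M"
    unfolding C_def S_def by measurable
  have intU: "integrable U (\<lambda>s. cos (L s \<omega>))" "integrable U (\<lambda>s. sin (L s \<omega>))" for \<omega>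
    by (rule U.integrable_const_bound[of _ 1]; simp)+
  have CSb: "\<bar>C \<omega>\<bar> \<le> u" "\<bar>S \<omega>\<bar> \<le> u" for \<omega>
  proof -
    have "\<bar>C \<omega>\<bar> \<le> (\<integral>s. \<bar>cos (L s \<omega>)\<bar> \<partial>U)" unfolding C_def by (rule integral_abs_bound)
    also have "\<dots> \<le> (\<integral>s. 1 \<partial>U)" using intU by (intro integral_mono) auto
    finally show "\<bar>C \<omega>\<bar> \<le> u" by (simp add: u_def)
    have "\<bar>S \<omega>\<bar> \<le> (\<integral>s. \<bar>sin (L s \<omega>)\<bar> \<partial>U)" unfolding S_def by (rule integral_abs_bound)
    also have "\<dots> \<le> (\<integral>s. 1 \<partial>U)" using intU by (intro integral_mono) auto
    finally show "\<bar>S \<omega>\<bar> \<le> u" by (simp add: u_def)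
  qed
  have intC: "integrable M C" by (rule integrable_const_bound[of _ u]) (use CSb in auto)
  have intC2: "integrable M (\<lambda>\<omega>. (C \<omega>)\<^sup>2)" "integrable M (\<lambda>\<omega>. (S \<omega>)\<^sup>2)"
    using CSb u0 by (auto intro!: integrable_const_bound[of _ "u\<^sup>2"] AE_I2 simp: abs_le_square_iff[symmetric])
  \<comment> \<open>The squared modulus of the integral of exp(iL) equals a double integral of
    exp(i(L_s - L_t)), written here in real parts.\<close>
  have CS: "(C \<omega>)\<^sup>2 + (S \<omega>)\<^sup>2 = (\<integral>p. cos (L (fst p) \<omega> - L (snd p) \<omega>) \<partial>(U \<Otimes>\<^sub>M U))" for \<omega>
  proof -
    have int: "integrable (U \<Otimes>\<^sub>M U) (\<lambda>p. cos (L (fst p) \<omega> - L (snd p) \<omega>))"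
      by (rule UU.integrable_const_bound[of _ 1]) (auto intro!: AE_I2)
    have "(\<integral>p. cos (L (fst p) \<omega> - L (snd p) \<omega>) \<partial>(U \<Otimes>\<^sub>M U)) = (\<integral>s. \<integral>t. cos (L s \<omega> - L t \<omega>) \<partial>U \<partial>U)"
      using UUp.integral_fst'[OF int] by simp
    also have "\<dots> = (\<integral>s. cos (L s \<omega>) * C \<omega> + sin (L s \<omega>) * S \<omega> \<partial>U)"
      unfolding cos_diff C_def S_def using intU by simp
    also have "\<dots> = (C \<omega>)\<^sup>2 + (S \<omega>)\<^sup>2"
      using intU by (simp add: C_def[symmetric] S_def[symmetric] power2_eq_square)
    finally show ?thesis by simp
  qed
  have cb: "\<bar>c s t\<bar> \<le> real (card J) * (B * B)" for s t
  proof -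
    have "\<bar>c s t\<bar> \<le> (\<Sum>i\<in>J. \<bar>\<theta> i s * \<theta> i t\<bar>)" unfolding c_def by (rule sum_abs)
    also have "\<dots> \<le> (\<Sum>i\<in>J. B * B)"
      unfolding abs_mult using B by (intro sum_mono mult_mono) (auto intro: order_trans[OF abs_ge_zero])
    finally show ?thesis by simp
  qed
  have intc: "integrable (U \<Otimes>\<^sub>M U) (\<lambda>p. \<bar>c (fst p) (snd p)\<bar>)"
    by (rule UU.integrable_const_bound[of _ "real (card J) * (B * B)"]) (use cb in auto)
  have uu: "measure (U \<Otimes>\<^sub>M U) (space (U \<Otimes>\<^sub>M U)) = u * u"
    by (simp add: measure_def u_def space_pair_measure U.emeasure_pair_measure_Times enn2real_mult)
  have ECS: "expectation (\<lambda>\<omega>. (C \<omega>)\<^sup>2 + (S \<omega>)\<^sup>2) \<le> (g * g + 16 * e) * (u * u) + (\<integral>s. \<integral>t. \<bar>c s t\<bar> \<partial>U \<partial>U)"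
  proof -
    have int: "integrable (M \<Otimes>\<^sub>M (U \<Otimes>\<^sub>M U)) (\<lambda>(\<omega>, p). cos (L (fst p) \<omega> - L (snd p) \<omega>))"
      by (rule MUUf.integrable_const_bound[of _ 1]) (auto intro!: AE_I2)
    have "expectation (\<lambda>\<omega>. (C \<omega>)\<^sup>2 + (S \<omega>)\<^sup>2) = (\<integral>p. expectation (\<lambda>\<omega>. cos (L (fst p) \<omega> - L (snd p) \<omega>)) \<partial>(U \<Otimes>\<^sub>M U))"
      unfolding CS using MUU.Fubini_integral[OF int] by simp
    also have "\<dots> \<le> (\<integral>p. (g * g + 16 * e) + \<bar>c (fst p) (snd p)\<bar> \<partial>(U \<Otimes>\<^sub>M U))"
    proof (rule integral_mono)
      show "integrable (U \<Otimes>\<^sub>M U) (\<lambda>p. expectation (\<lambda>\<omega>. cos (L (fst p) \<omega> - L (snd p) \<omega>)))"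
        using MUU.integrable_snd[OF int] by simp
      show "integrable (U \<Otimes>\<^sub>M U) (\<lambda>p. (g * g + 16 * e) + \<bar>c (fst p) (snd p)\<bar>)"
        using intc by simp
    qed (use E2 in \<open>auto simp: algebra_simps\<close>)
    also have "\<dots> = (g * g + 16 * e) * (u * u) + (\<integral>p. \<bar>c (fst p) (snd p)\<bar> \<partial>(U \<Otimes>\<^sub>M U))"
      using intc uu by simp
    also have "(\<integral>p. \<bar>c (fst p) (snd p)\<bar> \<partial>(U \<Otimes>\<^sub>M U)) = (\<integral>s. \<integral>t. \<bar>c s t\<bar> \<partial>U \<partial>U)"
      using UUp.integral_fst'[OF intc] by simp
    finally show ?thesis .
  qed
  have EC: "(g - e) * u \<le> expectation C"
  proof -
    have int: "integrable (M \<Otimes>\<^sub>M U) (\<lambda>(\<omega>, s). cos (L s \<omega>))"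
      by (rule MUf.integrable_const_bound[of _ 1]) (auto intro!: AE_I2)
    have "(g - e) * u = (\<integral>s. g - e \<partial>U)" by (simp add: u_def)
    also have "\<dots> \<le> (\<integral>s. expectation (\<lambda>\<omega>. cos (L s \<omega>)) \<partial>U)"
      using MU.integrable_snd[OF int] E1 by (intro integral_mono) auto
    also have "\<dots> = expectation C" unfolding C_def using MU.Fubini_integral[OF int] by simp
    finally show ?thesis .
  qed
  have expand: "(C \<omega> - g * u)\<^sup>2 + (S \<omega>)\<^sup>2 = ((C \<omega>)\<^sup>2 + (S \<omega>)\<^sup>2) - 2 * (g * u) * C \<omega> + (g * u)\<^sup>2" for \<omega>
    by (simp add: power2_eq_square algebra_simps)
  show "integrable M (\<lambda>\<omega>. ((\<integral>s. cos (L s \<omega>) \<partial>U) - exp (- v / 2) * measure U (space U))\<^sup>2 + (\<integral>s. sin (L s \<omega>) \<partial>U)\<^sup>2)"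
    unfolding C_def[symmetric] S_def[symmetric] g_def[symmetric] u_def[symmetric] expand
    using intC intC2 by auto
  have "expectation (\<lambda>\<omega>. (C \<omega> - g * u)\<^sup>2 + (S \<omega>)\<^sup>2)
      = expectation (\<lambda>\<omega>. (C \<omega>)\<^sup>2 + (S \<omega>)\<^sup>2) - 2 * (g * u) * expectation C + (g * u)\<^sup>2"
    unfolding expand using intC intC2 prob_space by simp
  also have "\<dots> \<le> ((g * g + 16 * e) * (u * u) + (\<integral>s. \<integral>t. \<bar>c s t\<bar> \<partial>U \<partial>U)) - 2 * (g * u) * ((g - e) * u) + (g * u)\<^sup>2"
    using ECS mult_left_mono[OF EC, of "2 * (g * u)"] g u0 by simp
  also have "\<dots> = (\<integral>s. \<integral>t. \<bar>c s t\<bar> \<partial>U \<partial>U) + (16 * e + 2 * g * e) * u\<^sup>2"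
    by (simp add: power2_eq_square algebra_simps)
  also have "\<dots> \<le> (\<integral>s. \<integral>t. \<bar>c s t\<bar> \<partial>U \<partial>U) + (16 * e + 2 * 1 * e) * u\<^sup>2"
    using g e0 by (intro add_left_mono mult_right_mono add_mono) auto
  finally show "expectation (\<lambda>\<omega>. ((\<integral>s. cos (L s \<omega>) \<partial>U) - exp (- v / 2) * measure U (space U))\<^sup>2 + (\<integral>s. sin (L s \<omega>) \<partial>U)\<^sup>2)
     \<le> (\<integral>s. \<integral>t. \<bar>\<Sum>i\<in>J. \<theta> i s * \<theta> i t\<bar> \<partial>U \<partial>U) + 18 * K4 * real (card J) * B ^ 4 * (measure U (space U))\<^sup>2"
    unfolding C_def[symmetric] S_def[symmetric] g_def[symmetric] u_def[symmetric] c_def[symmetric]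
    by (simp add: e_def mult_ac)
qed

end

section \<open>Ratio events for asymptotically Gaussian pairs\<close>

text \<open>Two-sided: the probability that a standard normal variable has modulus at most
  \<open>c\<close>, not its distribution function.\<close>

definition Phi :: "real \<Rightarrow> real" where
  "Phi c = measure std_normal_distribution {-c..c}"

lemma emeasure_std_normal_finite_set:
  assumes "finite A" shows "emeasure std_normal_distribution A = 0"
proof -
  have "A \<in> null_sets lborel" using assms by (rule finite_imp_null_set_lborel)
  moreover have "absolutely_continuous lborel std_normal_distribution"
    by (intro absolutely_continuousI_density) auto
  ultimately show ?thesis by (auto simp: absolutely_continuous_def)
qed

text \<open>Levy's continuity theorem on the line, applied to the law of \<open>Y n\<close> under
  the measure with density proportional to \<open>w n\<close>. Weights that encode a second variable
  turn this one-dimensional theorem into a tool for joint convergence.\<close>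

lemma weighted_levy:
  fixes U :: "'u measure" and w Y :: "nat \<Rightarrow> 'u \<Rightarrow> real"
  assumes "finite_measure U"
    and [measurable]: "\<And>n. w n \<in> borel_measurable U" "\<And>n. Y n \<in> borel_measurable U"
    and w: "\<And>n x. 0 \<le> w n x" "\<And>n x. w n x \<le> B"
    and m: "(\<lambda>n. \<integral>x. w n x \<partial>U) \<longlonglongrightarrow> m" "0 < m"
    and c: "\<And>t. (\<lambda>n. \<integral>x. w n x * cos (t * Y n x) \<partial>U) \<longlonglongrightarrow> m * exp (- t\<^sup>2 / 2)"
    and s: "\<And>t. (\<lambda>n. \<integral>x. w n x * sin (t * Y n x) \<partial>U) \<longlonglongrightarrow> 0"
  shows "(\<lambda>n. \<integral>x. w n x * indicator {-a..a} (Y n x) \<partial>U) \<longlonglongrightarrow> m * Phi a"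
proof -
  interpret finite_measure U by fact
  define W where "W n = (\<integral>x. w n x \<partial>U)" for n
  have int: "integrable U (\<lambda>x. w n x * g x)" if [measurable]: "g \<in> borel_measurable U" and "\<And>x. \<bar>g x\<bar> \<le> 1" for n and g :: "'u \<Rightarrow> real"
    by (rule integrable_const_bound[of _ B])
      (use w that(2) in \<open>auto simp: abs_mult intro!: AE_I2 order_trans[OF mult_mono[of "w _ _" B _ 1]] order_trans[OF w(1) w(2)]\<close>)
  have intw: "integrable U (w n)" for n using int[of "\<lambda>_. 1" n] by simp
  \<comment> \<open>The normal law is a dummy for the finitely many \<open>n\<close> whose total
    weight is not positive; the continuity theorem wants a distribution at every index.\<close>
  define \<mu> where "\<mu> n = (if W n > 0 then distr (density U (\<lambda>x. ennreal (w n x / W n))) borel (Y n) else std_normal_distribution)" for n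
  have ev: "eventually (\<lambda>n. W n > 0) sequentially"
    using order_tendstoD(1)[OF m] by (simp add: W_def)
  have rd: "real_distribution (\<mu> n)" for n
  proof (cases "W n > 0")
    case True
    have "emeasure (density U (\<lambda>x. ennreal (w n x / W n))) (space U) = (\<integral>\<^sup>+x. ennreal (w n x / W n) \<partial>U)"
      by (subst emeasure_density) (auto intro!: nn_integral_cong)
    also have "\<dots> = ennreal (\<integral>x. w n x / W n \<partial>U)"
      using True w intw[of n] by (intro nn_integral_eq_integral) auto
    also have "(\<integral>x. w n x / W n \<partial>U) = 1" using True by (simp add: W_def)
    finally have "prob_space (density U (\<lambda>x. ennreal (w n x / W n)))"
      by (intro prob_spaceI) auto
    then have "prob_space (\<mu> n)" unfolding \<mu>_def using True
      by (auto intro!: prob_space.prob_space_distr)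
    then show ?thesis using True by (auto simp: real_distribution_def real_distribution_axioms_def \<mu>_def)
  qed (auto simp: \<mu>_def real_dist_normal_dist)
  have dens: "(\<integral>x. g (Y n x) \<partial>density U (\<lambda>x. ennreal (w n x / W n))) = (\<integral>x. w n x * g (Y n x) \<partial>U) / W n"
    if "W n > 0" and [measurable]: "g \<in> borel_measurable borel" for g :: "real \<Rightarrow> real" and n
    using that w by (subst integral_density) (auto simp flip: integral_divide_zero)
  have chr: "char (\<mu> n) t = Complex ((\<integral>x. w n x * cos (t * Y n x) \<partial>U) / W n) ((\<integral>x. w n x * sin (t * Y n x) \<partial>U) / W n)"
    if "W n > 0" for n t
  proof -
    interpret rdn: real_distribution "\<mu> n" by (rule rd)
    have int_iexp: "integrable (\<mu> n) (\<lambda>x. iexp (t * x))" using rdn.integrable_iexp[of "\<lambda>x. t * x"] by simp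
    have "Re (char (\<mu> n) t) = (\<integral>x. cos (t * x) \<partial>\<mu> n)"
      unfolding char_def using integral_Re[OF int_iexp] by (simp add: Re_exp)
    also have "\<dots> = (\<integral>x. cos (t * Y n x) \<partial>density U (\<lambda>x. ennreal (w n x / W n)))"
      using that by (simp add: \<mu>_def integral_distr)
    also have "\<dots> = (\<integral>x. w n x * cos (t * Y n x) \<partial>U) / W n" using that by (intro dens) auto
    finally have re: "Re (char (\<mu> n) t) = (\<integral>x. w n x * cos (t * Y n x) \<partial>U) / W n" .
    have "Im (char (\<mu> n) t) = (\<integral>x. sin (t * x) \<partial>\<mu> n)"
      unfolding char_def using integral_Im[OF int_iexp] by (simp add: Im_exp)
    also have "\<dots> = (\<integral>x. sin (t * Y n x) \<partial>density U (\<lambda>x. ennreal (w n x / W n)))"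
      using that by (simp add: \<mu>_def integral_distr)
    also have "\<dots> = (\<integral>x. w n x * sin (t * Y n x) \<partial>U) / W n" using that by (intro dens) auto
    finally show ?thesis using re by (simp add: complex_eq_iff)
  qed
  have "(\<lambda>n. char (\<mu> n) t) \<longlonglongrightarrow> char std_normal_distribution t" for t
  proof -
    have "(\<lambda>n. Complex ((\<integral>x. w n x * cos (t * Y n x) \<partial>U) / W n) ((\<integral>x. w n x * sin (t * Y n x) \<partial>U) / W n))
      \<longlonglongrightarrow> Complex (m * exp (- t\<^sup>2 / 2) / m) (0 / m)"
      unfolding W_def using m(2) by (intro tendsto_Complex tendsto_divide c s m) auto
    also have "Complex (m * exp (- t\<^sup>2 / 2) / m) (0 / m) = char std_normal_distribution t"
      using m(2) by (simp add: char_std_normal_distribution complex_eq_iff Re_exp Im_exp flip: exp_of_real)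
    finally show ?thesis
      by (rule Lim_transform_eventually) (use ev chr in \<open>auto elim!: eventually_mono\<close>)
  qed
  then have wc: "weak_conv_m \<mu> std_normal_distribution"
    by (intro levy_continuity rd real_dist_normal_dist)
  have "(\<lambda>n. measure (\<mu> n) {-a..a}) \<longlonglongrightarrow> measure std_normal_distribution {-a..a}"
    by (rule weak_conv_imp_continuity_set_conv[OF rd real_dist_normal_dist wc])
      (auto simp: frontier_def intro!: emeasure_std_normal_finite_set intro: finite_subset[of _ "{-a, a}"])
  then have lim: "(\<lambda>n. W n * measure (\<mu> n) {-a..a}) \<longlonglongrightarrow> m * Phi a"
    unfolding Phi_def W_def by (intro tendsto_mult m)
  have eqn: "W n * measure (\<mu> n) {-a..a} = (\<integral>x. w n x * indicator {-a..a} (Y n x) \<partial>U)" if "W n > 0" for n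
  proof -
    interpret rdn: real_distribution "\<mu> n" by (rule rd)
    have "measure (\<mu> n) {-a..a} = (\<integral>x. indicator {-a..a} x \<partial>\<mu> n)" by simp
    also have "\<dots> = (\<integral>x. indicator {-a..a} (Y n x) \<partial>density U (\<lambda>x. ennreal (w n x / W n)))"
      using that by (simp add: \<mu>_def integral_distr del: Bochner_Integration.integral_indicator)
    also have "\<dots> = (\<integral>x. w n x * indicator {-a..a} (Y n x) \<partial>U) / W n" using that by (intro dens) auto
    finally show ?thesis using that by simp
  qed
  show ?thesis
    by (rule Lim_transform_eventually[OF lim]) (use ev eqn in \<open>auto elim!: eventually_mono\<close>)
qed

text \<open>Joint convergence by two passes of \<open>weighted_levy\<close>. Weights 1 + cos(beta D)
  and 1 + sin(beta D), where the 1 keeps them nonnegative, turn the condition on \<open>S\<close>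
  into an indicator; subtracting the weight 1 case leaves the characteristic function of
  \<open>D\<close> restricted to |S| <= a. In the second pass that indicator itself is the
  weight.\<close>

lemma joint_levy:
  fixes U :: "'u measure" and S D :: "nat \<Rightarrow> 'u \<Rightarrow> real"
  assumes "finite_measure U" and m: "measure U (space U) = m" "0 < m"
    and [measurable]: "\<And>n. S n \<in> borel_measurable U" "\<And>n. D n \<in> borel_measurable U"
    and c: "\<And>\<alpha> \<beta>. (\<lambda>n. \<integral>x. cos (\<alpha> * S n x + \<beta> * D n x) \<partial>U) \<longlonglongrightarrow> m * exp (- (\<alpha>\<^sup>2 + \<beta>\<^sup>2) / 2)"
    and s: "\<And>\<alpha> \<beta>. (\<lambda>n. \<integral>x. sin (\<alpha> * S n x + \<beta> * D n x) \<partial>U) \<longlonglongrightarrow> 0"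
    and ab: "0 \<le> a" "0 \<le> b"
  shows "(\<lambda>n. measure U {x \<in> space U. \<bar>S n x\<bar> \<le> a \<and> \<bar>D n x\<bar> \<le> b}) \<longlonglongrightarrow> m * Phi a * Phi b"
proof -
  interpret finite_measure U by fact
  have int: "integrable U g" if [measurable]: "g \<in> borel_measurable U" and "\<And>x. \<bar>g x\<bar> \<le> 1" for g :: "'u \<Rightarrow> real"
    by (rule integrable_const_bound[of _ 1]) (use that in auto)
  have ic: "integrable U (\<lambda>x. cos (\<alpha> * S n x + \<beta> * D n x))" "integrable U (\<lambda>x. sin (\<alpha> * S n x + \<beta> * D n x))"
      "integrable U (\<lambda>x. cos (\<alpha> * S n x))" "integrable U (\<lambda>x. sin (\<alpha> * S n x))"
      "integrable U (\<lambda>x. cos (\<beta> * D n x))" "integrable U (\<lambda>x. sin (\<beta> * D n x))"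
      "integrable U (\<lambda>x. cos (\<alpha> * S n x - \<beta> * D n x))" "integrable U (\<lambda>x. sin (\<alpha> * S n x - \<beta> * D n x))" for \<alpha> \<beta> n
    by (auto intro!: int)
  have cS: "(\<lambda>n. \<integral>x. cos (t * S n x) \<partial>U) \<longlonglongrightarrow> m * exp (- t\<^sup>2 / 2)"
    and sS: "(\<lambda>n. \<integral>x. sin (t * S n x) \<partial>U) \<longlonglongrightarrow> 0"
    and cD: "(\<lambda>n. \<integral>x. cos (t * D n x) \<partial>U) \<longlonglongrightarrow> m * exp (- t\<^sup>2 / 2)"
    and sD: "(\<lambda>n. \<integral>x. sin (t * D n x) \<partial>U) \<longlonglongrightarrow> 0" for t
    using c[of t 0] s[of t 0] c[of 0 t] s[of 0 t] by simp_all
  have cm: "(\<lambda>n. \<integral>x. cos (\<alpha> * S n x - \<beta> * D n x) \<partial>U) \<longlonglongrightarrow> m * exp (- (\<alpha>\<^sup>2 + \<beta>\<^sup>2) / 2)"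
    and sm: "(\<lambda>n. \<integral>x. sin (\<alpha> * S n x - \<beta> * D n x) \<partial>U) \<longlonglongrightarrow> 0" for \<alpha> \<beta>
    using c[of \<alpha> "-\<beta>"] s[of \<alpha> "-\<beta>"] by auto
  have L1: "(\<lambda>n. \<integral>x. (1 + cos (\<beta> * D n x)) * indicator {-a..a} (S n x) \<partial>U) \<longlonglongrightarrow> (m * (1 + exp (- \<beta>\<^sup>2 / 2))) * Phi a" for \<beta>
  proof (rule weighted_levy[where B=2])
    show "0 \<le> 1 + cos (\<beta> * D n x)" "1 + cos (\<beta> * D n x) \<le> 2" for n x
      using cos_ge_minus_one[of "\<beta> * D n x"] cos_le_one[of "\<beta> * D n x"] by linarith+
    have "(\<lambda>n. m + (\<integral>x. cos (\<beta> * D n x) \<partial>U)) \<longlonglongrightarrow> m + m * exp (- \<beta>\<^sup>2 / 2)"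
      by (intro tendsto_intros cD)
    then show "(\<lambda>n. \<integral>x. 1 + cos (\<beta> * D n x) \<partial>U) \<longlonglongrightarrow> m * (1 + exp (- \<beta>\<^sup>2 / 2))"
      using ic m by (simp add: distrib_left)
    show "0 < m * (1 + exp (- \<beta>\<^sup>2 / 2))" using m(2) by (simp add: add_pos_pos)
    fix t
    have eqc: "(1 + cos (\<beta> * D n x)) * cos (t * S n x) =
        cos (t * S n x) + (cos (t * S n x + \<beta> * D n x) / 2 + cos (t * S n x - \<beta> * D n x) / 2)" for n x
      by (simp add: cos_add cos_diff field_simps)
    have "(\<lambda>n. (\<integral>x. cos (t * S n x) \<partial>U) + ((\<integral>x. cos (t * S n x + \<beta> * D n x) \<partial>U) / 2 + (\<integral>x. cos (t * S n x - \<beta> * D n x) \<partial>U) / 2))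
      \<longlonglongrightarrow> m * exp (- t\<^sup>2 / 2) + (m * exp (- (t\<^sup>2 + \<beta>\<^sup>2) / 2) / 2 + m * exp (- (t\<^sup>2 + \<beta>\<^sup>2) / 2) / 2)"
      by (intro tendsto_intros c cS cm) auto
    also have "m * exp (- t\<^sup>2 / 2) + (m * exp (- (t\<^sup>2 + \<beta>\<^sup>2) / 2) / 2 + m * exp (- (t\<^sup>2 + \<beta>\<^sup>2) / 2) / 2)
        = m * (1 + exp (- \<beta>\<^sup>2 / 2)) * exp (- t\<^sup>2 / 2)"
    proof -
      have "exp (- (t\<^sup>2 + \<beta>\<^sup>2) / 2) = exp (- t\<^sup>2 / 2) * exp (- \<beta>\<^sup>2 / 2)"
        unfolding mult_exp_exp by (simp add: field_simps)
      then show ?thesis by (simp only:) (simp add: field_simps)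
    qed
    finally show "(\<lambda>n. \<integral>x. (1 + cos (\<beta> * D n x)) * cos (t * S n x) \<partial>U) \<longlonglongrightarrow> m * (1 + exp (- \<beta>\<^sup>2 / 2)) * exp (- t\<^sup>2 / 2)"
      unfolding eqc using ic by simp
    have eqs: "(1 + cos (\<beta> * D n x)) * sin (t * S n x) =
        sin (t * S n x) + (sin (t * S n x + \<beta> * D n x) / 2 + sin (t * S n x - \<beta> * D n x) / 2)" for n x
      by (simp add: sin_add sin_diff field_simps)
    have "(\<lambda>n. (\<integral>x. sin (t * S n x) \<partial>U) + ((\<integral>x. sin (t * S n x + \<beta> * D n x) \<partial>U) / 2 + (\<integral>x. sin (t * S n x - \<beta> * D n x) \<partial>U) / 2))
      \<longlonglongrightarrow> 0 + (0 / 2 + 0 / 2)"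
      by (intro tendsto_intros s sS sm) auto
    then show "(\<lambda>n. \<integral>x. (1 + cos (\<beta> * D n x)) * sin (t * S n x) \<partial>U) \<longlonglongrightarrow> 0"
      unfolding eqs using ic by simp
  qed (use \<open>finite_measure U\<close> in auto)
  have L2: "(\<lambda>n. \<integral>x. (1 + sin (\<beta> * D n x)) * indicator {-a..a} (S n x) \<partial>U) \<longlonglongrightarrow> m * Phi a" for \<beta>
  proof (rule weighted_levy[where B=2])
    show "0 \<le> 1 + sin (\<beta> * D n x)" "1 + sin (\<beta> * D n x) \<le> 2" for n x
      using sin_ge_minus_one[of "\<beta> * D n x"] sin_le_one[of "\<beta> * D n x"] by linarith+
    have "(\<lambda>n. m + (\<integral>x. sin (\<beta> * D n x) \<partial>U)) \<longlonglongrightarrow> m + 0"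
      by (intro tendsto_intros sD)
    then show "(\<lambda>n. \<integral>x. 1 + sin (\<beta> * D n x) \<partial>U) \<longlonglongrightarrow> m"
      using ic m by simp
    show "0 < m" by fact
    fix t
    have eqc: "(1 + sin (\<beta> * D n x)) * cos (t * S n x) =
        cos (t * S n x) + (sin (t * S n x + \<beta> * D n x) / 2 - sin (t * S n x - \<beta> * D n x) / 2)" for n x
      by (simp add: sin_add sin_diff field_simps)
    have "(\<lambda>n. (\<integral>x. cos (t * S n x) \<partial>U) + ((\<integral>x. sin (t * S n x + \<beta> * D n x) \<partial>U) / 2 - (\<integral>x. sin (t * S n x - \<beta> * D n x) \<partial>U) / 2))
      \<longlonglongrightarrow> m * exp (- t\<^sup>2 / 2) + (0 / 2 - 0 / 2)"
      by (intro tendsto_intros s cS sm) auto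
    then show "(\<lambda>n. \<integral>x. (1 + sin (\<beta> * D n x)) * cos (t * S n x) \<partial>U) \<longlonglongrightarrow> m * exp (- t\<^sup>2 / 2)"
      unfolding eqc using ic by simp
    have eqs: "(1 + sin (\<beta> * D n x)) * sin (t * S n x) =
        sin (t * S n x) + (cos (t * S n x - \<beta> * D n x) / 2 - cos (t * S n x + \<beta> * D n x) / 2)" for n x
      by (simp add: cos_add cos_diff field_simps)
    have "(\<lambda>n. (\<integral>x. sin (t * S n x) \<partial>U) + ((\<integral>x. cos (t * S n x - \<beta> * D n x) \<partial>U) / 2 - (\<integral>x. cos (t * S n x + \<beta> * D n x) \<partial>U) / 2))
      \<longlonglongrightarrow> 0 + (m * exp (- (t\<^sup>2 + \<beta>\<^sup>2) / 2) / 2 - m * exp (- (t\<^sup>2 + \<beta>\<^sup>2) / 2) / 2)"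
      by (intro tendsto_intros c sS cm) auto
    then show "(\<lambda>n. \<integral>x. (1 + sin (\<beta> * D n x)) * sin (t * S n x) \<partial>U) \<longlonglongrightarrow> 0"
      unfolding eqs using ic by simp
  qed (use \<open>finite_measure U\<close> in auto)
  have inti: "integrable U (\<lambda>x. indicat_real {-a..a} (S n x))"
    "integrable U (\<lambda>x. indicat_real {-a..a} (S n x) * cos (t * D n x))"
    "integrable U (\<lambda>x. indicat_real {-a..a} (S n x) * sin (t * D n x))" for n t
    by (auto intro!: int split: split_indicator)
  have M0: "(\<lambda>n. \<integral>x. indicat_real {-a..a} (S n x) \<partial>U) \<longlonglongrightarrow> m * Phi a"
    using L2[of 0] by simp
  have M1: "(\<lambda>n. \<integral>x. indicat_real {-a..a} (S n x) * cos (t * D n x) \<partial>U) \<longlonglongrightarrow> (m * Phi a) * exp (- t\<^sup>2 / 2)" for t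
    using tendsto_diff[OF L1[of t] M0] inti by (simp add: algebra_simps)
  have M2: "(\<lambda>n. \<integral>x. indicat_real {-a..a} (S n x) * sin (t * D n x) \<partial>U) \<longlonglongrightarrow> 0" for t
    using tendsto_diff[OF L2[of t] M0] inti by (simp add: algebra_simps)
  have meas: "(\<integral>x. indicat_real {-a..a} (S n x) * indicator {-b..b} (D n x) \<partial>U)
      = measure U {x \<in> space U. \<bar>S n x\<bar> \<le> a \<and> \<bar>D n x\<bar> \<le> b}" for n
  proof -
    have "(\<integral>x. indicat_real {-a..a} (S n x) * indicator {-b..b} (D n x) \<partial>U)
      = (\<integral>x. indicator {x \<in> space U. \<bar>S n x\<bar> \<le> a \<and> \<bar>D n x\<bar> \<le> b} x \<partial>U)"
      by (intro Bochner_Integration.integral_cong) (auto simp: indicator_def abs_le_iff)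
    also have "\<dots> = measure U ({x \<in> space U. \<bar>S n x\<bar> \<le> a \<and> \<bar>D n x\<bar> \<le> b} \<inter> space U)" by simp
    finally show ?thesis by (simp add: Int_def conj_commute conj_left_commute)
  qed
  show ?thesis
  \<comment> \<open>\<open>weighted_levy\<close> needs a positive limiting mass, so the degenerate
    case is squeezed directly.\<close>
  proof (cases "Phi a = 0")
    case True
    have "(\<lambda>n. measure U {x \<in> space U. \<bar>S n x\<bar> \<le> a \<and> \<bar>D n x\<bar> \<le> b}) \<longlonglongrightarrow> 0"
    proof (rule tendsto_sandwich[OF _ _ tendsto_const])
      show "\<forall>\<^sub>F n in sequentially. measure U {x \<in> space U. \<bar>S n x\<bar> \<le> a \<and> \<bar>D n x\<bar> \<le> b} \<le> (\<integral>x. indicat_real {-a..a} (S n x) \<partial>U)"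
        unfolding meas[symmetric]
        by (intro always_eventually allI integral_mono inti int) (auto simp: indicator_def)
      show "(\<lambda>n. \<integral>x. indicat_real {-a..a} (S n x) \<partial>U) \<longlonglongrightarrow> 0" using M0 True by simp
    qed auto
    then show ?thesis using True by simp
  next
    case False
    then have "0 < m * Phi a" using m(2) by (simp add: Phi_def less_le)
    then show ?thesis unfolding meas[symmetric]
      using \<open>finite_measure U\<close> M0 M1 M2
      by (intro weighted_levy[where B=1 and w="\<lambda>n x. indicat_real {-a..a} (S n x)"]) (auto simp: indicator_def)
  qed
qed

section \<open>Absolute moments of the normal law and the ratio of two independent normal
  variables\<close>

lemma integral_std_normal_distribution:
  fixes g :: "real \<Rightarrow> real"
  assumes [measurable]: "g \<in> borel_measurable borel"
  shows "(\<integral>x. g x \<partial>std_normal_distribution) = (\<integral>x. std_normal_density x * g x \<partial>lborel)"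
    and "integrable std_normal_distribution g \<longleftrightarrow> integrable lborel (\<lambda>x. std_normal_density x * g x)"
  by (simp_all add: integral_density integrable_density)

lemma std_normal_abs:
  "integrable std_normal_distribution (\<lambda>x. \<bar>x\<bar>)"
  "(\<integral>x. \<bar>x\<bar> \<partial>std_normal_distribution) = sqrt (2 / pi)"
  using std_normal_moment_abs_odd[of 0]
  by (simp_all add: integral_std_normal_distribution has_bochner_integral_iff)

lemma std_normal_sq:
  "integrable std_normal_distribution (\<lambda>x. x\<^sup>2)"
  "(\<integral>x. x\<^sup>2 \<partial>std_normal_distribution) = 1"
  using std_normal_moment_even[of 1]
  by (simp_all add: integral_std_normal_distribution has_bochner_integral_iff)

lemma Phi_integral: "Phi c = (\<integral>x. std_normal_density x * indicator {-c..c} x \<partial>lborel)"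
proof -
  interpret real_distribution std_normal_distribution by (rule real_dist_normal_dist)
  have "Phi c = (\<integral>x. indicator {-c..c} x \<partial>std_normal_distribution)" by (simp add: Phi_def)
  then show ?thesis by (simp add: integral_std_normal_distribution del: Bochner_Integration.integral_indicator)
qed

lemma two_over_sqrt_2pi: "2 * (1 / sqrt (2 * pi)) = sqrt (2 / pi)"
  by (simp add: real_sqrt_mult real_sqrt_divide field_simps)

lemma Phi_bounds:
  assumes "0 \<le> c"
  shows "Phi c \<le> sqrt (2 / pi) * c" "sqrt (2 / pi) * c * (1 - c\<^sup>2 / 2) \<le> Phi c"
proof -
  have i1: "integrable lborel (\<lambda>x. K * indicat_real {-c..c} x)" for K using assms by simp
  have i2: "integrable lborel (\<lambda>x. std_normal_density x * indicat_real {-c..c} x)"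
    by (intro integrable_real_mult_indicator integrable_normal_density) auto
  have "Phi c \<le> (\<integral>x. 1 / sqrt (2 * pi) * indicator {-c..c} x \<partial>lborel)"
    unfolding Phi_integral
    by (rule integral_mono[OF i2 i1]) (auto simp: indicator_def std_normal_density_def divide_right_mono)
  also have "\<dots> = sqrt (2 / pi) * c" using assms unfolding two_over_sqrt_2pi[symmetric] by simp
  finally show "Phi c \<le> sqrt (2 / pi) * c" .
  have "(\<integral>x. 1 / sqrt (2 * pi) * (1 - c\<^sup>2 / 2) * indicator {-c..c} x \<partial>lborel) \<le> Phi c"
    unfolding Phi_integral
  proof (rule integral_mono[OF i1 i2])
    fix x show "1 / sqrt (2 * pi) * (1 - c\<^sup>2 / 2) * indicator {-c..c} x \<le> std_normal_density x * indicator {-c..c} x"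
    proof (cases "x \<in> {-c..c}")
      case True
      then have "x\<^sup>2 \<le> c\<^sup>2" by (intro abs_le_square_iff[THEN iffD1]) auto
      then have "1 - c\<^sup>2 / 2 \<le> 1 + - x\<^sup>2 / 2" by simp
      also have "\<dots> \<le> exp (- x\<^sup>2 / 2)" by (rule exp_ge_add_one_self)
      finally show ?thesis using True by (simp add: std_normal_density_def divide_right_mono)
    qed simp
  qed
  also have "(\<integral>x. 1 / sqrt (2 * pi) * (1 - c\<^sup>2 / 2) * indicator {-c..c} x \<partial>lborel) = sqrt (2 / pi) * c * (1 - c\<^sup>2 / 2)"
    using assms unfolding two_over_sqrt_2pi[symmetric] by simp
  finally show "sqrt (2 / pi) * c * (1 - c\<^sup>2 / 2) \<le> Phi c" .
qed

lemma Phi_nonneg: "0 \<le> Phi c" by (simp add: Phi_def)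

lemma Phi_mono: "a \<le> b \<Longrightarrow> Phi a \<le> Phi b"
proof -
  interpret real_distribution std_normal_distribution by (rule real_dist_normal_dist)
  show "a \<le> b \<Longrightarrow> Phi a \<le> Phi b" unfolding Phi_def by (intro finite_measure_mono) auto
qed

lemma Phi_le_1: "Phi c \<le> 1"
proof -
  interpret real_distribution std_normal_distribution by (rule real_dist_normal_dist)
  show ?thesis unfolding Phi_def by simp
qed

text \<open>It increases to E|Z| = sqrt(2/pi), which is one of the two factors of 2/pi in the
  probability of |S| <= r |D|; the other is the slope of \<open>Phi\<close> at 0.\<close>

definition abs_moment :: "real \<Rightarrow> real" where
  "abs_moment c = (\<integral>x. \<bar>x\<bar> * indicator {-c..c} x \<partial>std_normal_distribution)"

lemma
  shows abs_moment_0: "abs_moment 0 = 0"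
    and abs_moment_le: "abs_moment c \<le> sqrt (2 / pi)"
    and abs_moment_ge: "0 < c \<Longrightarrow> sqrt (2 / pi) - 1 / c \<le> abs_moment c"
    and abs_moment_diff: "0 \<le> a \<Longrightarrow> a \<le> b \<Longrightarrow>
      a * (Phi b - Phi a) \<le> abs_moment b - abs_moment a \<and> abs_moment b - abs_moment a \<le> b * (Phi b - Phi a)"
    and Phi_tail: "0 < c \<Longrightarrow> 1 - Phi c \<le> sqrt (2 / pi) / c"
proof -
  interpret real_distribution std_normal_distribution by (rule real_dist_normal_dist)
  have int: "integrable std_normal_distribution (\<lambda>x. \<bar>x\<bar> * indicator {-c..c} x)" for c :: real
    by (rule Bochner_Integration.integrable_bound[OF std_normal_abs(1)]) (auto simp: indicator_def)
  have inti: "integrable std_normal_distribution (indicat_real {-c..c})" for c :: real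
    by (rule integrable_const_bound[of _ 1]) (auto simp: indicator_def)
  have Phi: "Phi c = (\<integral>x. indicator {-c..c} x \<partial>std_normal_distribution)" for c by (simp add: Phi_def)
  have "(\<lambda>x. \<bar>x\<bar> * indicator {-0..0::real} x) = (\<lambda>x. 0)" by (auto simp: indicator_def)
  then show "abs_moment 0 = 0" unfolding abs_moment_def by simp
  show "abs_moment c \<le> sqrt (2 / pi)"
    unfolding abs_moment_def std_normal_abs(2)[symmetric]
    by (intro integral_mono int std_normal_abs(1)) (auto simp: indicator_def)
  show "sqrt (2 / pi) - 1 / c \<le> abs_moment c" if "0 < c"
  proof -
    have "(\<integral>x. \<bar>x\<bar> \<partial>std_normal_distribution) \<le> (\<integral>x. x\<^sup>2 / c + \<bar>x\<bar> * indicator {-c..c} x \<partial>std_normal_distribution)"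
    proof (rule integral_mono[OF std_normal_abs(1)])
      show "integrable std_normal_distribution (\<lambda>x. x\<^sup>2 / c + \<bar>x\<bar> * indicator {-c..c} x)"
        using std_normal_sq(1) int[of c] by (intro Bochner_Integration.integrable_add integrable_divide_zero) auto
      fix x show "\<bar>x\<bar> \<le> x\<^sup>2 / c + \<bar>x\<bar> * indicator {-c..c} x"
      proof (cases "x \<in> {-c..c}")
        case False
        then have "c * \<bar>x\<bar> \<le> \<bar>x\<bar> * \<bar>x\<bar>" by (intro mult_right_mono) auto
        then show ?thesis using that False by (simp add: field_simps power2_eq_square abs_mult_self_eq)
      qed (use that in auto)
    qed
    also have "\<dots> = 1 / c + abs_moment c"
      using std_normal_sq int[of c] by (simp add: abs_moment_def)
    finally show ?thesis by (simp add: std_normal_abs)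
  qed
  show "a * (Phi b - Phi a) \<le> abs_moment b - abs_moment a \<and> abs_moment b - abs_moment a \<le> b * (Phi b - Phi a)"
    if "0 \<le> a" "a \<le> b"
  proof
    have d: "Phi b - Phi a = (\<integral>x. indicator {-b..b} x - indicator {-a..a} x \<partial>std_normal_distribution)"
      unfolding Phi by (simp add: inti del: Bochner_Integration.integral_indicator)
    have e: "abs_moment b - abs_moment a = (\<integral>x. \<bar>x\<bar> * indicator {-b..b} x - \<bar>x\<bar> * indicator {-a..a} x \<partial>std_normal_distribution)"
      unfolding abs_moment_def by (simp add: int)
    have i1: "integrable std_normal_distribution (\<lambda>x. K * (indicat_real {-b..b} x - indicator {-a..a} x))" for K
      by (intro integrable_mult_right Bochner_Integration.integrable_diff inti)
    have i2: "integrable std_normal_distribution (\<lambda>x. \<bar>x\<bar> * indicator {-b..b} x - \<bar>x\<bar> * indicator {-a..a} x)"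
      by (intro Bochner_Integration.integrable_diff int)
    show "a * (Phi b - Phi a) \<le> abs_moment b - abs_moment a"
      unfolding d e integral_mult_right_zero[symmetric]
      by (rule integral_mono[OF i1 i2]) (use that in \<open>auto simp: indicator_def\<close>)
    show "abs_moment b - abs_moment a \<le> b * (Phi b - Phi a)"
      unfolding d e integral_mult_right_zero[symmetric]
      by (rule integral_mono[OF i2 i1]) (use that in \<open>auto simp: indicator_def\<close>)
  qed
  show "1 - Phi c \<le> sqrt (2 / pi) / c" if "0 < c"
  proof -
    have "1 - Phi c = (\<integral>x. 1 - indicator {-c..c} x \<partial>std_normal_distribution)"
      unfolding Phi using prob_space by (simp add: inti del: Bochner_Integration.integral_indicator)
    also have "\<dots> \<le> (\<integral>x. \<bar>x\<bar> / c \<partial>std_normal_distribution)"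
    proof (rule integral_mono)
      show "integrable std_normal_distribution (\<lambda>x. 1 - indicat_real {-c..c} x)"
        by (intro Bochner_Integration.integrable_diff inti) simp
      show "integrable std_normal_distribution (\<lambda>x. \<bar>x\<bar> / c)"
        using std_normal_abs(1) by simp
    qed (use that in \<open>auto simp: indicator_def field_simps\<close>)
    also have "\<dots> = sqrt (2 / pi) / c" by (simp add: std_normal_abs)
    finally show ?thesis .
  qed
qed

text \<open>Upper and lower Riemann-Stieltjes sums, on the grid of step 1/N over [0, N], for the
  integral of y against \<open>Phi\<close>, that is, for E|Z|. The two sums differ by at most 1/N,
  and truncation at N costs another 1/N, hence the 2/N below.\<close>

lemma Phi_grid_sums:
  fixes N :: nat
  assumes N: "1 \<le> N"
  defines "d \<equiv> \<lambda>i::nat. real i / real N"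
  shows "(\<Sum>i<N*N. d (Suc i) * (Phi (d (Suc i)) - Phi (d i))) \<le> sqrt (2 / pi) + 1 / real N"
    and "sqrt (2 / pi) - 2 / real N \<le> (\<Sum>i<N*N. d i * (Phi (d (Suc i)) - Phi (d i)))"
proof -
  have d: "0 \<le> d i" "d i \<le> d (Suc i)" "d (Suc i) = d i + 1 / real N" for i
    by (auto simp: d_def divide_right_mono add_divide_distrib)
  have dM: "d (N * N) = real N" using N by (simp add: d_def)
  have tel: "(\<Sum>i<N*N. Phi (d (Suc i)) - Phi (d i)) \<le> 1"
    using sum_lessThan_telescope[of "\<lambda>i. Phi (d i)" "N*N"] Phi_le_1[of "d (N*N)"] Phi_nonneg[of "d 0"] by simp
  have tela: "(\<Sum>i<N*N. abs_moment (d (Suc i)) - abs_moment (d i)) = abs_moment (real N)"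
    using sum_lessThan_telescope[of "\<lambda>i. abs_moment (d i)" "N*N"] dM by (simp add: d_def abs_moment_0)
  have split: "(\<Sum>i<N*N. d (Suc i) * (Phi (d (Suc i)) - Phi (d i))) =
     (\<Sum>i<N*N. d i * (Phi (d (Suc i)) - Phi (d i))) + 1 / real N * (\<Sum>i<N*N. Phi (d (Suc i)) - Phi (d i))"
    by (simp add: d(3) distrib_right sum.distrib sum_distrib_left)
  have small: "1 / real N * (\<Sum>i<N*N. Phi (d (Suc i)) - Phi (d i)) \<le> 1 / real N"
    using tel by (intro mult_left_le) auto
  have "(\<Sum>i<N*N. d i * (Phi (d (Suc i)) - Phi (d i))) \<le> abs_moment (real N)"
    unfolding tela[symmetric] using abs_moment_diff d by (intro sum_mono) blast
  then show "(\<Sum>i<N*N. d (Suc i) * (Phi (d (Suc i)) - Phi (d i))) \<le> sqrt (2 / pi) + 1 / real N"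
    using split small abs_moment_le[of "real N"] by linarith
  have "abs_moment (real N) \<le> (\<Sum>i<N*N. d (Suc i) * (Phi (d (Suc i)) - Phi (d i)))"
    unfolding tela[symmetric] using abs_moment_diff d by (intro sum_mono) blast
  moreover have "sqrt (2 / pi) - 1 / real N \<le> abs_moment (real N)"
    using N by (intro abs_moment_ge) auto
  moreover have "2 / real N = 1 / real N + 1 / real N" by simp
  ultimately show "sqrt (2 / pi) - 2 / real N \<le> (\<Sum>i<N*N. d i * (Phi (d (Suc i)) - Phi (d i)))"
    using split small by linarith
qed

text \<open>For independent standard normals the probability is (2/pi) arctan r; only its leading
  term for small \<open>r\<close> is needed. Slicing by the value of |D| reduces the event to
  rectangles. Above, \<open>Phi (r * y) <= sqrt (2/pi) * r * y\<close> and E|D| = sqrt(2/pi) give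
  2r/pi. Below, \<open>Phi\<close> is nearly linear only while r y is small, and y ranges up to
  \<open>N\<close>; this is the source of the factor with \<open>r * real N\<close>, so
  \<open>N\<close> must be large while \<open>r * real N\<close> is small.\<close>

lemma
  fixes U :: "'u measure" and S D :: "nat \<Rightarrow> 'u \<Rightarrow> real"
  assumes "finite_measure U" and m: "measure U (space U) = m" "0 < m"
    and [measurable]: "\<And>n. S n \<in> borel_measurable U" "\<And>n. D n \<in> borel_measurable U"
    and G: "\<And>a b. 0 \<le> a \<Longrightarrow> 0 \<le> b \<Longrightarrow>
       (\<lambda>n. measure U {x \<in> space U. \<bar>S n x\<bar> \<le> a \<and> \<bar>D n x\<bar> \<le> b}) \<longlonglongrightarrow> m * Phi a * Phi b"
    and H: "\<And>b. 0 \<le> b \<Longrightarrow> (\<lambda>n. measure U {x \<in> space U. \<bar>D n x\<bar> \<le> b}) \<longlonglongrightarrow> m * Phi b"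
    and r: "0 < r"
  shows ratio_event_upper: "0 < e \<Longrightarrow> \<forall>\<^sub>F n in sequentially.
      measure U {x \<in> space U. \<bar>S n x\<bar> \<le> r * \<bar>D n x\<bar>} \<le> m * (2 / pi * r) + e"
    and ratio_event_lower: "0 < e \<Longrightarrow> 1 \<le> N \<Longrightarrow> r * real N \<le> 1 \<Longrightarrow> \<forall>\<^sub>F n in sequentially.
      m * (sqrt (2 / pi) * r * (1 - (r * real N)\<^sup>2 / 2) * (sqrt (2 / pi) - 2 / real N)) - e
      \<le> measure U {x \<in> space U. \<bar>S n x\<bar> \<le> r * \<bar>D n x\<bar>}"
proof -
  interpret finite_measure U by fact
  define E where "E n = {x \<in> space U. \<bar>S n x\<bar> \<le> r * \<bar>D n x\<bar>}" for n
  define g where "g n a b = measure U {x \<in> space U. \<bar>S n x\<bar> \<le> a \<and> \<bar>D n x\<bar> \<le> b}" for n a b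
  define cell where "cell n a b c = {x \<in> space U. \<bar>S n x\<bar> \<le> a \<and> b < \<bar>D n x\<bar> \<and> \<bar>D n x\<bar> \<le> c}" for n a b c
  have [measurable]: "E n \<in> sets U" "cell n a b c \<in> sets U" for n a b c
    unfolding E_def cell_def by measurable
  have cell: "measure U (cell n a b c) = g n a c - g n a b" if "b \<le> c" for n a b c
  proof -
    have "cell n a b c = {x \<in> space U. \<bar>S n x\<bar> \<le> a \<and> \<bar>D n x\<bar> \<le> c} - {x \<in> space U. \<bar>S n x\<bar> \<le> a \<and> \<bar>D n x\<bar> \<le> b}"
      by (auto simp: cell_def)
    also have "measure U \<dots> = g n a c - g n a b"
      unfolding g_def using that by (intro finite_measure_Diff) auto
    finally show ?thesis .
  qed
  have glim: "(\<lambda>n. g n a b) \<longlonglongrightarrow> m * Phi a * Phi b" if "0 \<le> a" "0 \<le> b" for a b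
    unfolding g_def using that by (rule G)
  have pp: "sqrt (2 / pi) * sqrt (2 / pi) = 2 / pi" by simp
  {
    fix N :: nat assume N: "1 \<le> N"
    define d where "d i = real i / real N" for i :: nat
    have d: "0 \<le> d i" "d i \<le> d (Suc i)" for i
      by (auto simp: d_def divide_right_mono)
    have dM: "d (N * N) = real N" using N by (simp add: d_def)
    have find: "\<exists>i<N*N. d i < y \<and> y \<le> d (Suc i)" if "0 < y" "y \<le> real N" for y
    proof -
      define i where "i = nat (\<lceil>y * real N\<rceil> - 1)"
      have y: "0 < y * real N" using that N by auto
      then have ri: "real i = of_int \<lceil>y * real N\<rceil> - 1" by (simp add: i_def)
      have "real i < y * real N" "y * real N \<le> real i + 1" using ri by linarith+
      moreover have "y * real N \<le> real N * real N" using that by (intro mult_right_mono) auto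
      moreover have "real i < real (N * N)" using calculation by simp
      ultimately show ?thesis using N by (intro exI[of _ i]) (auto simp: d_def field_simps simp del: of_nat_mult)
    qed
    \<comment> \<open>The slices are half-open in |D|, so each is a difference of two nested
      rectangles. They miss |D| = 0 and |D| > N, which are added in full; the limiting mass of the
      former vanishes and that of the latter is O(1/N).\<close>
    define up where "up n = measure U {x \<in> space U. \<bar>D n x\<bar> \<le> 0} +
       ((\<Sum>i<N*N. g n (r * d (Suc i)) (d (Suc i)) - g n (r * d (Suc i)) (d i)) +
        (m - measure U {x \<in> space U. \<bar>D n x\<bar> \<le> real N}))" for n
    have le_up: "measure U (E n) \<le> up n" for n
    proof -
      define C where "C = (\<Union>i<N*N. cell n (r * d (Suc i)) (d i) (d (Suc i)))"
      have [measurable]: "C \<in> sets U" unfolding C_def by measurable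
      have "E n \<subseteq> {x \<in> space U. \<bar>D n x\<bar> \<le> 0} \<union> (C \<union> (space U - {x \<in> space U. \<bar>D n x\<bar> \<le> real N}))"
      proof
        fix x assume x: "x \<in> E n"
        show "x \<in> {x \<in> space U. \<bar>D n x\<bar> \<le> 0} \<union> (C \<union> (space U - {x \<in> space U. \<bar>D n x\<bar> \<le> real N}))"
        proof (cases "0 < \<bar>D n x\<bar> \<and> \<bar>D n x\<bar> \<le> real N")
          case True
          then obtain i where i: "i < N*N" "d i < \<bar>D n x\<bar>" "\<bar>D n x\<bar> \<le> d (Suc i)" using find by blast
          have "\<bar>S n x\<bar> \<le> r * \<bar>D n x\<bar>" using x by (simp add: E_def)
          also have "\<dots> \<le> r * d (Suc i)" using i r by (intro mult_left_mono) auto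
          finally have "x \<in> cell n (r * d (Suc i)) (d i) (d (Suc i))" using i x by (auto simp: cell_def E_def)
          then show ?thesis using i by (auto simp: C_def)
        qed (use x in \<open>auto simp: E_def\<close>)
      qed
      then have "measure U (E n) \<le> measure U ({x \<in> space U. \<bar>D n x\<bar> \<le> 0} \<union> (C \<union> (space U - {x \<in> space U. \<bar>D n x\<bar> \<le> real N})))"
        by (intro finite_measure_mono) auto
      also have "\<dots> \<le> measure U {x \<in> space U. \<bar>D n x\<bar> \<le> 0} + (measure U C + measure U (space U - {x \<in> space U. \<bar>D n x\<bar> \<le> real N}))"
        by (intro order_trans[OF measure_Un_le] add_left_mono measure_Un_le) auto
      also have "measure U (space U - {x \<in> space U. \<bar>D n x\<bar> \<le> real N}) = m - measure U {x \<in> space U. \<bar>D n x\<bar> \<le> real N}"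
        unfolding m(1)[symmetric] by (intro finite_measure_compl) auto
      also have "measure U C \<le> (\<Sum>i<N*N. measure U (cell n (r * d (Suc i)) (d i) (d (Suc i))))"
        unfolding C_def by (intro finite_measure_subadditive_finite) auto
      also have "\<dots> = (\<Sum>i<N*N. g n (r * d (Suc i)) (d (Suc i)) - g n (r * d (Suc i)) (d i))"
        using d by (intro sum.cong refl cell) auto
      finally show ?thesis by (simp add: up_def)
    qed
    have "up \<longlonglongrightarrow> m * Phi 0 + ((\<Sum>i<N*N. m * Phi (r * d (Suc i)) * Phi (d (Suc i)) - m * Phi (r * d (Suc i)) * Phi (d i)) + (m - m * Phi (real N)))"
      unfolding up_def[abs_def] using d r by (intro tendsto_intros H glim) auto
    also have "m * Phi 0 + ((\<Sum>i<N*N. m * Phi (r * d (Suc i)) * Phi (d (Suc i)) - m * Phi (r * d (Suc i)) * Phi (d i)) + (m - m * Phi (real N)))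
       = m * (Phi 0 + (\<Sum>i<N*N. Phi (r * d (Suc i)) * (Phi (d (Suc i)) - Phi (d i))) + (1 - Phi (real N)))" (is "_ = m * ?L")
      by (simp add: algebra_simps sum_distrib_left sum_subtractf)
    finally have uplim: "up \<longlonglongrightarrow> m * ?L" .
    have "(\<Sum>i<N*N. Phi (r * d (Suc i)) * (Phi (d (Suc i)) - Phi (d i)))
        \<le> (\<Sum>i<N*N. (sqrt (2 / pi) * (r * d (Suc i))) * (Phi (d (Suc i)) - Phi (d i)))"
      using d r by (intro sum_mono mult_right_mono Phi_bounds) (auto simp: Phi_mono)
    also have "\<dots> = sqrt (2 / pi) * r * (\<Sum>i<N*N. d (Suc i) * (Phi (d (Suc i)) - Phi (d i)))"
      by (simp add: sum_distrib_left mult_ac)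
    also have "\<dots> \<le> sqrt (2 / pi) * r * (sqrt (2 / pi) + 1 / real N)"
      using Phi_grid_sums(1)[OF N] r by (intro mult_left_mono) (auto simp: d_def)
    finally have "?L \<le> sqrt (2 / pi) * r * (sqrt (2 / pi) + 1 / real N) + sqrt (2 / pi) / real N"
      using Phi_bounds(1)[of 0] Phi_tail[of "real N"] N by simp
    also have "\<dots> = 2 / pi * r + sqrt (2 / pi) * (r + 1) / real N"
    proof -
      have "k * r * (k + 1 / real N) + k / real N = (k * k) * r + k * (r + 1) / real N" for k :: real
        by (simp add: algebra_simps add_divide_distrib)
      then show ?thesis using pp by metis
    qed
    finally have L: "m * ?L \<le> m * (2 / pi * r + sqrt (2 / pi) * (r + 1) / real N)" using m by simp
    have "\<forall>\<^sub>F n in sequentially. measure U (E n) \<le> m * (2 / pi * r + sqrt (2 / pi) * (r + 1) / real N) + e" if "0 < e" for e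
    proof -
      have "\<forall>\<^sub>F n in sequentially. up n < m * ?L + e" using order_tendstoD(2)[OF uplim] that by simp
      then show ?thesis
      proof (rule eventually_mono)
        fix n assume "up n < m * ?L + e"
        then show "measure U (E n) \<le> m * (2 / pi * r + sqrt (2 / pi) * (r + 1) / real N) + e"
          using le_up[of n] L by linarith
      qed
    qed
    note upper = this
    define lo where "lo n = (\<Sum>i<N*N. g n (r * d i) (d (Suc i)) - g n (r * d i) (d i))" for n
    have lo_le: "lo n \<le> measure U (E n)" for n
    proof -
      have "lo n = (\<Sum>i<N*N. measure U (cell n (r * d i) (d i) (d (Suc i))))"
        unfolding lo_def using d by (intro sum.cong refl cell[symmetric]) auto
      also have "\<dots> = measure U (\<Union>i<N*N. cell n (r * d i) (d i) (d (Suc i)))"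
      proof (rule finite_measure_finite_Union[symmetric])
        have mono: "d (Suc i) \<le> d j" if "i < j" for i j
          using that by (auto simp: d_def intro!: divide_right_mono)
        have "cell n (r * d i) (d i) (d (Suc i)) \<inter> cell n (r * d j) (d j) (d (Suc j)) = {}" if "i \<noteq> j" for i j
          using that mono[of i j] mono[of j i] by (cases "i < j") (force simp: cell_def)+
        then show "disjoint_family_on (\<lambda>i. cell n (r * d i) (d i) (d (Suc i))) {..<N * N}"
          by (auto simp: disjoint_family_on_def)
      qed auto
      also have "\<dots> \<le> measure U (E n)"
      proof (intro finite_measure_mono UN_least subsetI)
        fix i x assume "x \<in> cell n (r * d i) (d i) (d (Suc i))"
        then have x: "x \<in> space U" "\<bar>S n x\<bar> \<le> r * d i" "d i < \<bar>D n x\<bar>" by (auto simp: cell_def)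
        have "r * d i \<le> r * \<bar>D n x\<bar>" using x r by (intro mult_left_mono) auto
        then show "x \<in> E n" using x by (auto simp: E_def)
      qed auto
      finally show ?thesis .
    qed
    have "lo \<longlonglongrightarrow> (\<Sum>i<N*N. m * Phi (r * d i) * Phi (d (Suc i)) - m * Phi (r * d i) * Phi (d i))"
      unfolding lo_def[abs_def] using d r by (intro tendsto_intros H glim) auto
    also have "(\<Sum>i<N*N. m * Phi (r * d i) * Phi (d (Suc i)) - m * Phi (r * d i) * Phi (d i))
      = m * (\<Sum>i<N*N. Phi (r * d i) * (Phi (d (Suc i)) - Phi (d i)))" (is "_ = m * ?K")
      by (simp add: algebra_simps sum_distrib_left sum_subtractf)
    finally have lolim: "lo \<longlonglongrightarrow> m * ?K" .
    have lower: "\<forall>\<^sub>F n in sequentially. m * (sqrt (2 / pi) * r * (1 - (r * real N)\<^sup>2 / 2) * (sqrt (2 / pi) - 2 / real N)) - e \<le> measure U (E n)"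
      if e: "0 < e" and rN: "r * real N \<le> 1" for e
    proof -
      have q: "0 \<le> 1 - (r * real N)\<^sup>2 / 2"
        using rN r power_mono[of "r * real N" 1 2] by simp
      have "sqrt (2 / pi) * r * (1 - (r * real N)\<^sup>2 / 2) * (sqrt (2 / pi) - 2 / real N)
         \<le> sqrt (2 / pi) * r * (1 - (r * real N)\<^sup>2 / 2) * (\<Sum>i<N*N. d i * (Phi (d (Suc i)) - Phi (d i)))"
        using Phi_grid_sums(2)[OF N] r q by (intro mult_left_mono) (auto simp: d_def)
      also have "\<dots> = (\<Sum>i<N*N. (sqrt (2 / pi) * (r * d i) * (1 - (r * real N)\<^sup>2 / 2)) * (Phi (d (Suc i)) - Phi (d i)))"
        by (simp add: sum_distrib_left mult_ac)
      also have "\<dots> \<le> ?K"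
      proof (intro sum_mono mult_right_mono)
        fix i assume i: "i \<in> {..<N*N}"
        have "d i \<le> d (N*N)" using i unfolding d_def by (intro divide_right_mono) (auto simp del: of_nat_mult)
        then have "r * d i \<le> r * real N" using dM r by simp
        then have "(r * d i)\<^sup>2 \<le> (r * real N)\<^sup>2" using r d by (intro power_mono) auto
        then have "sqrt (2 / pi) * (r * d i) * (1 - (r * real N)\<^sup>2 / 2) \<le> sqrt (2 / pi) * (r * d i) * (1 - (r * d i)\<^sup>2 / 2)"
          using r d by (intro mult_left_mono) auto
        also have "\<dots> \<le> Phi (r * d i)" using r d by (intro Phi_bounds) auto
        finally show "sqrt (2 / pi) * (r * d i) * (1 - (r * real N)\<^sup>2 / 2) \<le> Phi (r * d i)" .
      qed (use d Phi_mono in auto)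
      finally have K: "m * (sqrt (2 / pi) * r * (1 - (r * real N)\<^sup>2 / 2) * (sqrt (2 / pi) - 2 / real N)) \<le> m * ?K"
        using m by (intro mult_left_mono) auto
      have "\<forall>\<^sub>F n in sequentially. m * ?K - e < lo n" using order_tendstoD(1)[OF lolim] e by simp
      then show ?thesis
      proof (rule eventually_mono)
        fix n assume "m * ?K - e < lo n"
        then show "m * (sqrt (2 / pi) * r * (1 - (r * real N)\<^sup>2 / 2) * (sqrt (2 / pi) - 2 / real N)) - e \<le> measure U (E n)"
          using lo_le[of n] K by linarith
      qed
    qed
    note upper lower
  }
  note both = this
  show "\<forall>\<^sub>F n in sequentially. measure U {x \<in> space U. \<bar>S n x\<bar> \<le> r * \<bar>D n x\<bar>} \<le> m * (2 / pi * r) + e" if e: "0 < e"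
  proof -
    have "(\<lambda>N. m * (sqrt (2 / pi) * (r + 1)) / real N) \<longlonglongrightarrow> 0" by (rule lim_const_over_n)
    then have "\<forall>\<^sub>F N in sequentially. m * (sqrt (2 / pi) * (r + 1)) / real N < e / 2 \<and> 1 \<le> N"
      using e by (intro eventually_conj order_tendstoD eventually_ge_at_top) auto
    then obtain N :: nat where N: "m * (sqrt (2 / pi) * (r + 1)) / real N < e / 2" "1 \<le> N"
      using eventually_happens sequentially_bot by blast
    have "m * (2 / pi * r + sqrt (2 / pi) * (r + 1) / real N) + e / 2 \<le> m * (2 / pi * r) + e"
    proof -
      have "m * (2 / pi * r + sqrt (2 / pi) * (r + 1) / real N) = m * (2 / pi * r) + m * (sqrt (2 / pi) * (r + 1)) / real N"
        unfolding distrib_left times_divide_eq_right ..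
      then show ?thesis using N(1) by linarith
    qed
    moreover have "\<forall>\<^sub>F n in sequentially. measure U (E n) \<le> m * (2 / pi * r + sqrt (2 / pi) * (r + 1) / real N) + e / 2"
      using both(1)[OF N(2), of "e/2"] e by simp
    ultimately show ?thesis unfolding E_def by (auto elim!: eventually_mono)
  qed
  show "\<forall>\<^sub>F n in sequentially.
      m * (sqrt (2 / pi) * r * (1 - (r * real N)\<^sup>2 / 2) * (sqrt (2 / pi) - 2 / real N)) - e
      \<le> measure U {x \<in> space U. \<bar>S n x\<bar> \<le> r * \<bar>D n x\<bar>}" if "0 < e" "1 \<le> N" "r * real N \<le> 1"
    using both(2)[OF that(2,1,3)] unfolding E_def .
qed

section \<open>Anticoncentration on short windows\<close>

context iid_family
begin

text \<open>Symmetry gives both half-lines beyond 1/2 and -1/2 the same mass p, and p = 0 would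
  bound the variance by 1/4. An interval of length 1/4 misses one of the two half-lines, wherever it
  lies.\<close>

lemma anticoncentration: "\<exists>q. 0 < q \<and> q < 1 \<and> (\<forall>z. measure \<mu> {x. \<bar>x + z\<bar> \<le> 1 / 8} \<le> q)"
proof -
  define p where "p = measure \<mu> {1/2..}"
  have neg: "measure \<mu> {..-1/2} = p"
  proof -
    have "measure \<mu> {..-1/2} = measure (distr \<mu> borel uminus) {..-1/2}" by (simp add: symm)
    also have "\<dots> = measure \<mu> (uminus -` {..-1/2} \<inter> space \<mu>)" by (rule measure_distr) auto
    also have "uminus -` {..-1/2::real} \<inter> space \<mu> = {1/2..}" by auto
    finally show ?thesis by (simp add: p_def)
  qed
  have p0: "0 < p"
  proof (rule ccontr)
    assume "\<not> 0 < p"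
    then have "p = 0" using measure_nonneg[of \<mu> "{1/2..}"] unfolding p_def by linarith
    then have "{1/2..} \<in> null_sets \<mu>" "{..-1/2} \<in> null_sets \<mu>" using neg
      by (auto simp: p_def mu.emeasure_eq_measure)
    then have "AE x in \<mu>. x \<notin> {1/2..} \<and> x \<notin> {..-1/2}"
      by (intro AE_conjI AE_not_in)
    then have "AE x in \<mu>. x\<^sup>2 \<le> 1/4"
    proof (rule AE_mp, intro AE_I2 impI)
      fix x :: real assume "x \<notin> {1/2..} \<and> x \<notin> {..-1/2}"
      then have "\<bar>x\<bar> \<le> \<bar>1/2\<bar>" by auto
      then have "x\<^sup>2 \<le> (1/2)\<^sup>2" by (subst abs_le_square_iff[symmetric])
      then show "x\<^sup>2 \<le> 1/4" by (simp add: power_divide)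
    qed
    then have "(\<integral>x. x\<^sup>2 \<partial>\<mu>) \<le> 1/4"
      using integrable_moment[of 2] by (intro mu.integral_le_const) auto
    then show False using var1 by simp
  qed
  have bd: "measure \<mu> {x. \<bar>x + z\<bar> \<le> 1 / 8} \<le> 1 - p" for z
  proof -
    have "\<exists>A. A \<in> sets borel \<and> measure \<mu> A = p \<and> {x. \<bar>x + z\<bar> \<le> 1 / 8} \<subseteq> - A"
    proof (cases "z \<le> 0")
      case True
      have "- (1/2) < x" if "\<bar>x + z\<bar> \<le> 1 / 8" for x using that True by linarith
      then have "{x. \<bar>x + z\<bar> \<le> 1 / 8} \<subseteq> - {..-1/2}" by fastforce
      then show ?thesis using neg by (intro exI[of _ "{..-1/2}"]) auto
    next
      case False
      have "x < 1/2" if "\<bar>x + z\<bar> \<le> 1 / 8" for x using that False by linarith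
      then have "{x. \<bar>x + z\<bar> \<le> 1 / 8} \<subseteq> - {1/2..}" by fastforce
      then show ?thesis by (intro exI[of _ "{1/2..}"]) (auto simp: p_def)
    qed
    then obtain A where A: "A \<in> sets borel" "measure \<mu> A = p" "{x. \<bar>x + z\<bar> \<le> 1 / 8} \<subseteq> - A" by auto
    have "measure \<mu> {x. \<bar>x + z\<bar> \<le> 1 / 8} \<le> measure \<mu> (space \<mu> - A)"
      using A by (intro mu.finite_measure_mono) auto
    also have "\<dots> = 1 - p" using A by (subst mu.prob_compl) auto
    finally show ?thesis .
  qed
  show ?thesis
    \<comment> \<open>The maximum with 1/2 secures positivity of \<open>q\<close>.\<close>
    by (rule exI[of _ "max (1 - p) (1/2)"]) (use bd p0 in \<open>auto simp: le_max_iff_disj less_max_iff_disj\<close>)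
qed

text \<open>Conditioning on everything except X_j, the sum over \<open>R\<close> is a fixed shift
  and the fibre has mass at most \<open>q\<close>; peeling off one index at a time multiplies these
  factors. Disjointness of \<open>J\<close> and \<open>R\<close> ensures that the shift of one
  chosen coefficient involves none of the chosen ones.\<close>

lemma prob_all_close:
  assumes q: "\<And>z. measure \<mu> {x. \<bar>x + z\<bar> \<le> 1 / 8} \<le> q" "0 \<le> q"
    and J: "finite J" "J \<subseteq> I" and R: "finite R" "R \<subseteq> I" "J \<inter> R = {}"
  shows "prob {\<omega> \<in> space M. \<forall>j\<in>J. \<bar>X j \<omega> + (\<Sum>i\<in>R. \<gamma> j i * X i \<omega>)\<bar> \<le> 1 / 8} \<le> q ^ card J"
  using J R(3)
proof (induction J rule: finite_induct)
  case empty
  then show ?case by (simp add: prob_space)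
next
  case (insert j F)
  let ?K = "R \<union> F"
  define Y where "Y = (\<lambda>\<omega>. \<lambda>i\<in>?K. X i \<omega>)"
  define P where "P = PiM ?K (\<lambda>_. borel :: real measure)"
  define Q where "Q = PiM {j} (\<lambda>_. borel :: real measure)"
  define X' where "X' = (\<lambda>\<omega>. \<lambda>i\<in>{j}. X i \<omega>)"
  have iv: "indep_var Q X' P Y"
    unfolding P_def Y_def Q_def X'_def
    using insert R by (intro indep_var_restrict[OF indep]) auto
  have Xm [measurable]: "X' \<in> M \<rightarrow>\<^sub>M Q" and Ym [measurable]: "Y \<in> M \<rightarrow>\<^sub>M P"
    using indep_var_rv1[OF iv] indep_var_rv2[OF iv] by auto
  have dist: "distr M Q X' \<Otimes>\<^sub>M distr M P Y = distr M (Q \<Otimes>\<^sub>M P) (\<lambda>\<omega>. (X' \<omega>, Y \<omega>))"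
    using iv by (simp add: indep_var_distribution_eq)
  have lawj: "distr M borel (X j) = \<mu>" using insert law by auto
  have [measurable]: "X j \<in> borel_measurable M" using insert by auto
  have compQ [measurable]: "(\<lambda>f. f j) \<in> borel_measurable Q" unfolding Q_def by measurable
  have fibre: "emeasure (distr M Q X') {f \<in> space Q. \<bar>f j + z\<bar> \<le> 1 / 8} \<le> ennreal q" for z
  proof -
    have "emeasure (distr M Q X') {f \<in> space Q. \<bar>f j + z\<bar> \<le> 1 / 8} = emeasure M (X' -` {f \<in> space Q. \<bar>f j + z\<bar> \<le> 1 / 8} \<inter> space M)"
      by (intro emeasure_distr) auto
    also have "X' -` {f \<in> space Q. \<bar>f j + z\<bar> \<le> 1 / 8} \<inter> space M = X j -` {x. \<bar>x + z\<bar> \<le> 1 / 8} \<inter> space M"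
      using measurable_space[OF Xm] by (auto simp: X'_def)
    also have "emeasure M \<dots> = emeasure (distr M borel (X j)) {x. \<bar>x + z\<bar> \<le> 1 / 8}"
      by (intro emeasure_distr[symmetric]) auto
    also have "\<dots> \<le> ennreal q" unfolding lawj mu.emeasure_eq_measure by (intro ennreal_leI q)
    finally show ?thesis .
  qed
  interpret Xd: prob_space "distr M Q X'" by (rule prob_space_distr) simp
  interpret Yd: prob_space "distr M P Y" by (rule prob_space_distr) simp
  interpret pr: pair_sigma_finite "distr M Q X'" "distr M P Y" ..
  define A where "A = {y \<in> space P. \<forall>k\<in>F. \<bar>y k + (\<Sum>i\<in>R. \<gamma> k i * y i)\<bar> \<le> 1 / 8}"
  define T where "T = {p \<in> space (Q \<Otimes>\<^sub>M P). \<bar>fst p j + (\<Sum>i\<in>R. \<gamma> j i * snd p i)\<bar> \<le> 1 / 8 \<and> snd p \<in> A}"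
  have comp [measurable]: "(\<lambda>y. y i) \<in> borel_measurable P" if "i \<in> R \<union> F" for i
    unfolding P_def using that by measurable
  have finF: "finite F" by fact
  have [measurable]: "A \<in> sets P" unfolding A_def using finF by measurable
  have [measurable]: "T \<in> sets (Q \<Otimes>\<^sub>M P)" unfolding T_def by measurable
  have evA: "{\<omega> \<in> space M. \<forall>k\<in>F. \<bar>X k \<omega> + (\<Sum>i\<in>R. \<gamma> k i * X i \<omega>)\<bar> \<le> 1 / 8} = Y -` A \<inter> space M"
    using measurable_space[OF Ym] by (auto simp: A_def Y_def cong: sum.cong)
  have evT: "{\<omega> \<in> space M. \<forall>k\<in>insert j F. \<bar>X k \<omega> + (\<Sum>i\<in>R. \<gamma> k i * X i \<omega>)\<bar> \<le> 1 / 8}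
      = (\<lambda>\<omega>. (X' \<omega>, Y \<omega>)) -` T \<inter> space M"
    using measurable_space[OF Ym] measurable_space[OF Xm]
    by (auto simp: A_def T_def Y_def X'_def space_pair_measure cong: sum.cong)
  have "emeasure M ((\<lambda>\<omega>. (X' \<omega>, Y \<omega>)) -` T \<inter> space M) = emeasure (distr M Q X' \<Otimes>\<^sub>M distr M P Y) T"
    unfolding dist by (subst emeasure_distr) auto
  also have "\<dots> = (\<integral>\<^sup>+y. emeasure (distr M Q X') ((\<lambda>x. (x, y)) -` T) \<partial>distr M P Y)"
    by (rule pr.emeasure_pair_measure_alt2) simp
  also have "\<dots> \<le> (\<integral>\<^sup>+y. ennreal q * indicator A y \<partial>distr M P Y)"
  proof (rule nn_integral_mono)
    fix y
    show "emeasure (distr M Q X') ((\<lambda>x. (x, y)) -` T) \<le> ennreal q * indicator A y"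
    proof (cases "y \<in> A")
      case True
      have "emeasure (distr M Q X') ((\<lambda>x. (x, y)) -` T) \<le> emeasure (distr M Q X') {f \<in> space Q. \<bar>f j + (\<Sum>i\<in>R. \<gamma> j i * y i)\<bar> \<le> 1 / 8}"
        by (intro emeasure_mono) (auto simp: T_def space_pair_measure)
      also have "\<dots> \<le> ennreal q" by (rule fibre)
      finally show ?thesis using True by simp
    next
      case False
      then have "(\<lambda>x. (x, y)) -` T = {}" by (auto simp: T_def)
      then show ?thesis by simp
    qed
  qed
  also have "\<dots> = ennreal q * emeasure M (Y -` A \<inter> space M)"
    by (simp add: nn_integral_cmult_indicator emeasure_distr)
  finally have "prob ((\<lambda>\<omega>. (X' \<omega>, Y \<omega>)) -` T \<inter> space M) \<le> q * prob (Y -` A \<inter> space M)"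
    using q(2) by (simp add: emeasure_eq_measure ennreal_mult[symmetric])
  also have "\<dots> \<le> q * q ^ card F"
    unfolding evA[symmetric] using insert q(2) by (intro mult_left_mono insert.IH) auto
  finally show ?case unfolding evT using insert by simp
qed

end

section \<open>Fourier coefficients over short windows\<close>

lemma has_integral_cos_window:
  fixes m i :: nat
  assumes "p \<noteq> 0" "m \<ge> 1"
  shows "((\<lambda>t. cos (real_of_int p * real m * t + c)) has_integral 0) {2*pi*real i/real m..2*pi*real (Suc i)/real m}"
proof -
  have "((\<lambda>t. cos (real_of_int p * real m * t + c)) has_integral
     sin (real_of_int p * real m * (2*pi*real (Suc i)/real m) + c) / (real_of_int p * real m)
     - sin (real_of_int p * real m * (2*pi*real i/real m) + c) / (real_of_int p * real m)) {2*pi*real i/real m..2*pi*real (Suc i)/real m}"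
    using assms by (intro fundamental_theorem_of_calculus)
      (auto simp: has_real_derivative_iff_has_vector_derivative[symmetric] divide_right_mono intro!: derivative_eq_intros)
  moreover have S: "sin (real_of_int p * real m * (2*pi*real i/real m) + c) = sin c" for i :: nat
  proof -
    have "real_of_int p * real m * (2*pi*real i/real m) = 2 * pi * of_int (p * int i)"
      using assms by simp
    then show ?thesis
      using sin_integer_2pi[of "of_int (p * int i)"] cos_integer_2pi[of "of_int (p * int i)"] by (simp add: sin_add)
  qed
  ultimately show ?thesis unfolding S by (simp only: diff_self)
qed

text \<open>Frequencies that are multiples of \<open>m\<close> have the window length 2 pi / m as a
  period, so they are orthogonal on each single window just as integer frequencies are on the full
  circle.\<close>

lemma integral_window_products:
  fixes m i j l :: nat
  assumes "m \<ge> 1" "l \<ge> 1" "j \<ge> 1"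
  defines "W \<equiv> {2*pi*real i/real m..2*pi*real (Suc i)/real m}"
  shows "integral W (\<lambda>t. cos (real (l*m) * t) * cos (real (j*m) * t)) = (if l = j then pi / real m else 0)"
    and "integral W (\<lambda>t. sin (real (l*m) * t) * cos (real (j*m) * t)) = 0"
proof -
  have len: "2*pi*real (Suc i)/real m - 2*pi*real i/real m = 2*pi/real m"
    unfolding diff_divide_distrib[symmetric] by (simp add: algebra_simps)
  have le: "2*pi*real i/real m \<le> 2*pi*real (Suc i)/real m" by (intro divide_right_mono) auto
  note hi = has_integral_cos_window[where m=m and i=i, folded W_def, OF _ assms(1)]
  have ne: "int l + int j \<noteq> 0" using assms by linarith
  have eqc: "cos (real (l*m) * t) * cos (real (j*m) * t) =
     cos (real_of_int (int l - int j) * real m * t + 0) / 2 + cos (real_of_int (int l + int j) * real m * t + 0) / 2" for t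
  proof -
    have a: "real_of_int (int l - int j) * real m * t + 0 = real (l*m) * t - real (j*m) * t"
      "real_of_int (int l + int j) * real m * t + 0 = real (l*m) * t + real (j*m) * t"
      by (simp_all add: algebra_simps)
    show ?thesis unfolding a cos_times_cos add_divide_distrib ..
  qed
  have eqs: "sin (real (l*m) * t) * cos (real (j*m) * t) =
     cos (real_of_int (int l - int j) * real m * t + - pi/2) / 2 + cos (real_of_int (int l + int j) * real m * t + - pi/2) / 2" for t
  proof -
    have s: "cos (x + - pi/2) = sin x" for x :: real by (simp add: cos_diff)
    have a: "real_of_int (int l - int j) * real m * t = real (l*m) * t - real (j*m) * t"
      "real_of_int (int l + int j) * real m * t = real (l*m) * t + real (j*m) * t"
      by (simp_all add: algebra_simps)
    show ?thesis unfolding s a sin_times_cos add_divide_distrib by (rule add.commute)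
  qed
  show "integral W (\<lambda>t. cos (real (l*m) * t) * cos (real (j*m) * t)) = (if l = j then pi / real m else 0)"
  proof (cases "l = j")
    case True
    have "((\<lambda>t. cos (real_of_int (int l - int j) * real m * t + 0) / 2) has_integral (2*pi/real m) / 2) W"
      using True has_integral_const_real[of "1/2::real" "2*pi*real i/real m" "2*pi*real (Suc i)/real m"] len le
      by (simp add: W_def)
    from has_integral_add[OF this has_integral_divide[OF hi[OF ne, of 0], of 2]]
    show ?thesis unfolding eqc using True by (simp add: integral_unique)
  next
    case False
    then have "int l - int j \<noteq> 0" by simp
    from has_integral_add[OF has_integral_divide[OF hi[OF this, of 0], of 2] has_integral_divide[OF hi[OF ne, of 0], of 2]]
    show ?thesis unfolding eqc using False by (simp add: integral_unique)
  qed
  show "integral W (\<lambda>t. sin (real (l*m) * t) * cos (real (j*m) * t)) = 0"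
  proof (cases "l = j")
    case True
    have "((\<lambda>t. cos (real_of_int (int l - int j) * real m * t + - pi/2) / 2) has_integral 0) W"
      using True by simp
    from has_integral_add[OF this has_integral_divide[OF hi[OF ne, of "- pi/2"], of 2]]
    show ?thesis unfolding eqs by (simp add: integral_unique)
  next
    case False
    then have "int l - int j \<noteq> 0" by simp
    from has_integral_add[OF has_integral_divide[OF hi[OF this, of "- pi/2"], of 2] has_integral_divide[OF hi[OF ne, of "- pi/2"], of 2]]
    show ?thesis unfolding eqs by (simp add: integral_unique)
  qed
qed

definition window :: "nat \<Rightarrow> nat \<Rightarrow> real set" where
  "window m i = {2*pi*real i/real m..2*pi*real (Suc i)/real m}"

text \<open>Fourier coefficients over a window see only the frequency \<open>j\<close> itself among the multiples of \<open>m\<close>;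
  the coefficients of the other frequencies are mixed in with these weights.\<close>

definition window_coeff :: "nat \<Rightarrow> nat \<Rightarrow> nat \<Rightarrow> nat + nat \<Rightarrow> real" where
  "window_coeff m w j i = real m / pi * (case i of
       Inl k \<Rightarrow> integral (window m w) (\<lambda>t. cos (real k * t) * cos (real j * t))
     | Inr k \<Rightarrow> integral (window m w) (\<lambda>t. sin (real k * t) * cos (real j * t)))"

lemma sum_Plus_image:
  fixes g :: "'a + 'b \<Rightarrow> 'c::comm_monoid_add"
  assumes "finite A" "finite B"
  shows "(\<Sum>i\<in>Inl ` A \<union> Inr ` B. g i) = (\<Sum>k\<in>A. g (Inl k)) + (\<Sum>k\<in>B. g (Inr k))"
  using assms by (subst sum.union_disjoint) (auto simp: sum.reindex inj_on_def)

lemma trig_poly_sum: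
  "trig_poly (\<lambda>k. x (Inl k)) (\<lambda>k. x (Inr k)) n t =
    (\<Sum>i\<in>Inl ` {1..n} \<union> Inr ` {1..n}. (case i of Inl k \<Rightarrow> cos (real k * t) | Inr k \<Rightarrow> sin (real k * t)) / sqrt (real n) * x i)"
  by (simp add: sum_Plus_image trig_poly_def sum_distrib_left sum.distrib distrib_left mult_ac)

text \<open>Integrate sqrt(n) times the polynomial against cos(j m t) over the window and rescale by
  m / pi. Among the multiples of \<open>m\<close> only the coefficient of \<open>j * m\<close>
  survives, with weight 1; the remaining frequencies, collected in \<open>K\<close>, add a linear
  combination with deterministic weights.\<close>

lemma coeff_small_if_small_on_window:
  fixes x :: "nat + nat \<Rightarrow> real"
  assumes m: "m \<ge> 1" and j: "j \<ge> 1" "j * m \<le> n"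
    and small: "\<And>t. t \<in> window m w \<Longrightarrow> \<bar>trig_poly (\<lambda>k. x (Inl k)) (\<lambda>k. x (Inr k)) n t\<bar> \<le> e"
  defines "K \<equiv> {k \<in> {1..n}. \<not> m dvd k}"
  shows "\<bar>x (Inl (j * m)) + (\<Sum>i\<in>Inl ` K \<union> Inr ` K. window_coeff m w (j * m) i * x i)\<bar> \<le> 2 * e * sqrt (real n)"
proof -
  define W where "W = window m w"
  define f where "f t = trig_poly (\<lambda>k. x (Inl k)) (\<lambda>k. x (Inr k)) n t" for t
  define A where "A k = integral W (\<lambda>t. cos (real k * t) * cos (real (j*m) * t))" for k
  define B where "B k = integral W (\<lambda>t. sin (real k * t) * cos (real (j*m) * t))" for k
  have n: "1 \<le> n" using m j by (metis le_trans mult_le_mono nat_mult_1)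
  have sn: "0 < sqrt (real n)" using n by simp
  have int: "(\<lambda>t. cos (real k * t) * cos (real (j*m) * t)) integrable_on W"
     "(\<lambda>t. sin (real k * t) * cos (real (j*m) * t)) integrable_on W" for k
    unfolding W_def window_def by (intro integrable_continuous_real continuous_intros)+
  have "((\<lambda>t. \<Sum>k=1..n. x (Inl k) * (cos (real k * t) * cos (real (j*m) * t)) + x (Inr k) * (sin (real k * t) * cos (real (j*m) * t)))
      has_integral (\<Sum>k=1..n. x (Inl k) * A k + x (Inr k) * B k)) W"
    unfolding A_def B_def
    by (intro has_integral_sum has_integral_add has_integral_mult_right integrable_integral int) auto
  then have hi: "((\<lambda>t. sqrt (real n) * f t * cos (real (j*m) * t)) has_integral (\<Sum>k=1..n. x (Inl k) * A k + x (Inr k) * B k)) W"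
    using sn by (simp add: f_def trig_poly_def sum_distrib_right distrib_right mult.assoc)
  have len: "2*pi*real (Suc w)/real m - 2*pi*real w/real m = 2*pi/real m"
    unfolding diff_divide_distrib[symmetric] by (simp add: algebra_simps)
  have e0: "0 \<le> e" using small[of "2*pi*real w/real m"] abs_ge_zero order_trans
    by (fastforce simp: window_def divide_right_mono)
  have "norm (\<Sum>k=1..n. x (Inl k) * A k + x (Inr k) * B k) \<le> (sqrt (real n) * e) * measure lborel (cbox (2*pi*real w/real m) (2*pi*real (Suc w)/real m))"
  proof (rule has_integral_bound)
    fix t assume "t \<in> cbox (2*pi*real w/real m) (2*pi*real (Suc w)/real m)"
    then have "\<bar>f t\<bar> \<le> e" using small by (simp add: f_def window_def)
    then have "\<bar>f t\<bar> * \<bar>cos (real (j*m) * t)\<bar> \<le> e * 1" by (intro mult_mono) auto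
    then show "norm (sqrt (real n) * f t * cos (real (j*m) * t)) \<le> sqrt (real n) * e"
      using sn by (simp add: abs_mult mult.assoc)
  qed (use hi e0 sn in \<open>auto simp: W_def window_def\<close>)
  also have "measure lborel (cbox (2*pi*real w/real m) (2*pi*real (Suc w)/real m)) = 2*pi/real m"
    using len by (simp add: divide_right_mono)
  finally have bound: "\<bar>\<Sum>k=1..n. x (Inl k) * A k + x (Inr k) * B k\<bar> \<le> sqrt (real n) * e * (2*pi/real m)" by simp
  have split: "(\<Sum>k=1..n. x (Inl k) * A k + x (Inr k) * B k) =
     x (Inl (j*m)) * (pi / real m) + (\<Sum>k\<in>K. x (Inl k) * A k + x (Inr k) * B k)"
  proof -
    have "(\<Sum>k=1..n. x (Inl k) * A k + x (Inr k) * B k) = (\<Sum>k\<in>K \<union> {k \<in> {1..n}. m dvd k}. x (Inl k) * A k + x (Inr k) * B k)"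
      by (rule sum.cong) (auto simp: K_def)
    also have "\<dots> = (\<Sum>k\<in>K. x (Inl k) * A k + x (Inr k) * B k) + (\<Sum>k\<in>{k \<in> {1..n}. m dvd k}. x (Inl k) * A k + x (Inr k) * B k)"
      by (rule sum.union_disjoint) (auto simp: K_def)
    also have "(\<Sum>k\<in>{k \<in> {1..n}. m dvd k}. x (Inl k) * A k + x (Inr k) * B k)
       = (\<Sum>k\<in>{k \<in> {1..n}. m dvd k}. if k = j * m then x (Inl (j*m)) * (pi / real m) else 0)"
    proof (rule sum.cong[OF refl])
      fix k assume "k \<in> {k \<in> {1..n}. m dvd k}"
      then obtain l where "k = m * l" "1 \<le> k" by (auto elim: dvdE)
      then have l: "k = l * m" "l \<ge> 1" by (cases l; simp)+
      have "A k = (if l = j then pi / real m else 0)" "B k = 0"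
        unfolding A_def B_def W_def window_def l(1) using integral_window_products[OF m l(2) j(1), of w] by blast+
      then show "x (Inl k) * A k + x (Inr k) * B k = (if k = j * m then x (Inl (j*m)) * (pi / real m) else 0)"
        using l m by auto
    qed
    also have "\<dots> = x (Inl (j*m)) * (pi / real m)" using m j by simp
    finally show ?thesis by simp
  qed
  have "(\<Sum>i\<in>Inl ` K \<union> Inr ` K. window_coeff m w (j * m) i * x i) = real m / pi * (\<Sum>k\<in>K. x (Inl k) * A k + x (Inr k) * B k)"
    by (subst sum_Plus_image)
      (auto simp: K_def window_coeff_def A_def B_def W_def sum.distrib sum_distrib_left distrib_left mult_ac)
  then have "x (Inl (j * m)) + (\<Sum>i\<in>Inl ` K \<union> Inr ` K. window_coeff m w (j * m) i * x i)
     = real m / pi * (\<Sum>k=1..n. x (Inl k) * A k + x (Inr k) * B k)"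
    unfolding split using m by (simp add: distrib_left)
  also have "\<bar>\<dots>\<bar> \<le> real m / pi * (sqrt (real n) * e * (2*pi/real m))"
    unfolding abs_mult using bound by (intro mult_mono) auto
  also have "\<dots> = 2 * e * sqrt (real n)" using m by simp
  finally show ?thesis .
qed

text \<open>The square of the logarithm makes \<open>q ^ logsq n\<close> smaller than every power of
  n, enough to beat a union over up to n windows.\<close>

definition logsq :: "nat \<Rightarrow> nat" where
  "logsq n = nat \<lceil>(ln (real n))\<^sup>2\<rceil>"

lemma eventually_logsq: "\<forall>\<^sub>F n in sequentially. 1 \<le> logsq n \<and> logsq n \<le> n"
proof -
  have "\<forall>\<^sub>F n::nat in sequentially. (ln (real n))\<^sup>2 \<le> real n - 1" by real_asymp
  moreover have "\<forall>\<^sub>F n::nat in sequentially. 1 \<le> (ln (real n))\<^sup>2" by real_asymp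
  ultimately show ?thesis
  proof eventually_elim
    case (elim n)
    have "real_of_int \<lceil>(ln (real n))\<^sup>2\<rceil> \<le> real n" "1 \<le> real_of_int \<lceil>(ln (real n))\<^sup>2\<rceil>" using elim by linarith+
    then show ?case unfolding logsq_def by linarith
  qed
qed

locale trig_iid = iid_family M X "Inl ` {1..} \<union> Inr ` {1..}" \<mu>
  for M :: "'w measure" and X :: "nat + nat \<Rightarrow> 'w \<Rightarrow> real" and \<mu> :: "real measure"
begin

definition f :: "nat \<Rightarrow> 'w \<Rightarrow> real \<Rightarrow> real" where
  "f n \<omega> = trig_poly (\<lambda>k. X (Inl k) \<omega>) (\<lambda>k. X (Inr k) \<omega>) n"

text \<open>Use windows of length 2 pi / m with m about n / \<open>logsq n\<close>: then
  \<open>logsq n\<close> multiples of m are available as frequencies. If the polynomial were at most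
  1/(16 sqrt n) on a window, all those coefficients would be within 2 sqrt(n) / (16 sqrt n) = 1/8 of
  combinations of the others, which has probability at most \<open>q ^ logsq n\<close>. A union
  bound over the windows and Borel-Cantelli finish. The radius 4 pi \<open>logsq n\<close> / n
  exceeds the window length because m is at least n / (2 \<open>logsq n\<close>).\<close>

lemma AE_not_small_on_windows:
  "AE \<omega> in M. \<forall>\<^sub>F n in sequentially. \<forall>t\<in>{0..2*pi}.
     \<exists>u. \<bar>u - t\<bar> \<le> 4 * pi * real (logsq n) / real n \<and> 1 / (16 * sqrt (real n)) < \<bar>f n \<omega> u\<bar>"
proof -
  obtain q where q: "0 < q" "q < 1" "\<And>z. measure \<mu> {x. \<bar>x + z\<bar> \<le> 1 / 8} \<le> q" using anticoncentration by blast
  define m where "m n = n div logsq n" for n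
  \<comment> \<open>Keeping only non-multiples makes these indices disjoint from the chosen
    frequencies, as \<open>prob_all_close\<close> demands.\<close>
  define K where "K n = {k \<in> {1..n}. \<not> m n dvd k}" for n
  define ev where "ev n w = {\<omega> \<in> space M. \<forall>i\<in>Inl ` (\<lambda>j. j * m n) ` {1..logsq n}.
     \<bar>X i \<omega> + (\<Sum>i'\<in>Inl ` K n \<union> Inr ` K n. window_coeff (m n) w (case i of Inl k \<Rightarrow> k | Inr k \<Rightarrow> k) i' * X i' \<omega>)\<bar> \<le> 1 / 8}" for n w
  define E where "E n = (if 1 \<le> logsq n \<and> logsq n \<le> n then (\<Union>w<m n. ev n w) else {})" for n
  have m1: "1 \<le> m n" "logsq n * m n \<le> n" "real n / (2 * real (logsq n)) \<le> real (m n)"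
    if "1 \<le> logsq n" "logsq n \<le> n" for n
  proof -
    show "1 \<le> m n" using that by (simp add: m_def div_greater_zero_iff Suc_le_eq)
    show "logsq n * m n \<le> n" by (simp add: m_def)
    have "n < logsq n * (m n + 1)" unfolding m_def using dividend_less_times_div[of "logsq n" n] that by (simp add: distrib_left)
    also have "\<dots> \<le> logsq n * (2 * m n)" using \<open>1 \<le> m n\<close> by (intro mult_left_mono) auto
    finally have "real n < real (logsq n) * (2 * real (m n))" by (metis of_nat_less_iff of_nat_mult of_nat_numeral)
    then show "real n / (2 * real (logsq n)) \<le> real (m n)" using that by (simp add: field_simps)
  qed
  have JI: "Inl ` (\<lambda>j. j * m n) ` {1..logsq n} \<subseteq> Inl ` {1..} \<union> Inr ` {1..}" if "1 \<le> m n" for n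
    using that by (auto simp: Suc_le_eq)
  have RI: "Inl ` K n \<union> Inr ` K n \<subseteq> Inl ` {1..} \<union> Inr ` {1..}" for n by (auto simp: K_def)
  have ev_meas: "ev n w \<in> sets M" if "1 \<le> m n" for n w
  proof -
    have [measurable]: "X i \<in> borel_measurable M" if "i \<in> Inl ` (\<lambda>j. j * m n) ` {1..logsq n}" for i
      using that JI[OF \<open>1 \<le> m n\<close>] by (intro X_measurable) auto
    have [measurable]: "X i \<in> borel_measurable M" if "i \<in> Inl ` K n \<union> Inr ` K n" for i
      using that RI by (intro X_measurable) blast
    have "(\<lambda>\<omega>. \<Sum>i'\<in>Inl ` K n \<union> Inr ` K n. window_coeff (m n) w (case i of Inl k \<Rightarrow> k | Inr k \<Rightarrow> k) i' * X i' \<omega>) \<in> borel_measurable M" for i :: "nat + nat"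
      by measurable
    note [measurable] = this
    show ?thesis unfolding ev_def
      by (intro sets.sets_Collect_finite_All) (auto intro!: borel_measurable_le borel_measurable_abs borel_measurable_add X_measurable JI[OF that, THEN subsetD])
  qed
  have E_meas: "E n \<in> sets M" for n unfolding E_def using ev_meas m1 by auto
  have pev: "prob (ev n w) \<le> q ^ logsq n" if "1 \<le> logsq n" "logsq n \<le> n" for n w
  proof -
    have "prob (ev n w) \<le> q ^ card (Inl ` (\<lambda>j. j * m n) ` {1..logsq n} :: (nat + nat) set)"
      unfolding ev_def
    proof (rule prob_all_close)
      show "Inl ` (\<lambda>j. j * m n) ` {1..logsq n} \<inter> (Inl ` K n \<union> Inr ` K n) = {}" by (auto simp: K_def)
    qed (use q JI RI m1 that in \<open>auto simp: K_def\<close>)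
    also have "card (Inl ` (\<lambda>j. j * m n) ` {1..logsq n} :: (nat + nat) set) = logsq n"
      using m1(1)[OF that] by (subst card_image; (subst card_image)?) (auto simp: inj_on_def)
    finally show ?thesis .
  qed
  have PE: "prob (E n) \<le> real n * q powr ((ln (real n))\<^sup>2)" for n
  proof (cases "1 \<le> logsq n \<and> logsq n \<le> n")
    case True
    then have c: "1 \<le> logsq n" "logsq n \<le> n" by auto
    have "prob (E n) \<le> (\<Sum>w<m n. prob (ev n w))"
      unfolding E_def using True ev_meas m1(1)[OF c] by (auto intro!: finite_measure_subadditive_finite)
    also have "\<dots> \<le> (\<Sum>w<m n. q ^ logsq n)" by (intro sum_mono pev c)
    also have "\<dots> = real (m n) * q ^ logsq n" by simp
    also have "\<dots> \<le> real n * q powr ((ln (real n))\<^sup>2)"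
    proof (intro mult_mono)
      show "real (m n) \<le> real n" by (simp add: m_def)
      have "q ^ logsq n = q powr real (logsq n)" using q by (simp add: powr_realpow)
      also have "\<dots> \<le> q powr ((ln (real n))\<^sup>2)"
        using q by (intro powr_mono') (auto simp: logsq_def)
      finally show "q ^ logsq n \<le> q powr ((ln (real n))\<^sup>2)" .
    qed (use q in auto)
    finally show ?thesis .
  qed (auto simp: E_def)
  have "summable (\<lambda>n. prob (E n))"
  proof (rule summable_comparison_test_ev)
    define c where "c = - ln q"
    have c: "0 < c" using q by (simp add: c_def)
    have "((\<lambda>n::nat. real n ^ 3 * exp (- c * (ln (real n))\<^sup>2)) \<longlongrightarrow> 0) sequentially" using c by real_asymp
    then have "\<forall>\<^sub>F n::nat in sequentially. real n ^ 3 * exp (- c * (ln (real n))\<^sup>2) < 1"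
      by (rule order_tendstoD) simp
    then show "\<forall>\<^sub>F n in sequentially. norm (prob (E n)) \<le> 1 / real n ^ 2"
      using eventually_gt_at_top[of 0]
    proof eventually_elim
      case (elim n)
      have "real n * q powr ((ln (real n))\<^sup>2) = real n * exp (- c * (ln (real n))\<^sup>2)"
        using q by (simp add: powr_def c_def mult.commute)
      also have "\<dots> \<le> 1 / real n ^ 2" using elim by (simp add: field_simps power2_eq_square power3_eq_cube)
      finally show ?case using PE[of n] by simp
    qed
    show "summable (\<lambda>n. 1 / real n ^ 2)" using inverse_power_summable[of 2] by (simp add: inverse_eq_divide)
  qed
  then have "AE \<omega> in M. \<forall>\<^sub>F n in sequentially. \<omega> \<in> space M - E n"
    using E_meas by (intro borel_cantelli_AE1) (auto simp: emeasure_eq_measure)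
  then show ?thesis
  proof (rule AE_mp, intro AE_I2 impI)
    fix \<omega> assume "\<forall>\<^sub>F n in sequentially. \<omega> \<in> space M - E n"
    then show "\<forall>\<^sub>F n in sequentially. \<forall>t\<in>{0..2*pi}.
       \<exists>u. \<bar>u - t\<bar> \<le> 4 * pi * real (logsq n) / real n \<and> 1 / (16 * sqrt (real n)) < \<bar>f n \<omega> u\<bar>"
      using eventually_logsq
    proof eventually_elim
      case (elim n)
      then have c: "1 \<le> logsq n" "logsq n \<le> n" by auto
      note mm = m1[OF c]
      have n0: "0 < real n" using c by simp
      have step: "2 * pi / real (m n) \<le> 4 * pi * real (logsq n) / real n"
        using mm(1,3) n0 c by (simp add: field_simps)
      show ?case
      proof
        fix t assume t: "t \<in> {0..2*pi}"
        have "\<exists>w<m n. t \<in> window (m n) w"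
        proof (cases "t = 2 * pi")
          case True
          then show ?thesis using mm(1) by (intro exI[of _ "m n - 1"]) (auto simp: window_def field_simps of_nat_diff)
        next
          case False
          define y where "y = t * real (m n) / (2 * pi)"
          have y: "0 \<le> y" "y < real (m n)" using t False mm(1) by (auto simp: y_def field_simps)
          define w where "w = nat \<lfloor>y\<rfloor>"
          have w: "real w \<le> y" "y \<le> real (Suc w)" using y by (auto simp: w_def) linarith
          have "w < m n" using w y by linarith
          moreover have "t \<in> window (m n) w" using w mm(1) by (auto simp: window_def y_def field_simps)
          ultimately show ?thesis by blast
        qed
        then obtain w where w: "w < m n" "t \<in> window (m n) w" by auto
        have "\<exists>u\<in>window (m n) w. 1 / (16 * sqrt (real n)) < \<bar>f n \<omega> u\<bar>"
        proof (rule ccontr)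
          assume "\<not> ?thesis"
          then have small: "\<bar>trig_poly (\<lambda>k. X (Inl k) \<omega>) (\<lambda>k. X (Inr k) \<omega>) n u\<bar> \<le> 1 / (16 * sqrt (real n))"
            if "u \<in> window (m n) w" for u using that by (auto simp: f_def not_less)
          have "\<omega> \<in> ev n w" unfolding ev_def
          proof (safe)
            show "\<omega> \<in> space M" using elim by simp
            fix j assume j: "j \<in> {1..logsq n}"
            have "j * m n \<le> n" using j mm(2) by (meson atLeastAtMost_iff le_trans mult_le_mono1)
            then show "\<bar>X (Inl (j * m n)) \<omega> + (\<Sum>i'\<in>Inl ` K n \<union> Inr ` K n. window_coeff (m n) w
                (case Inl (j * m n) of Inl k \<Rightarrow> k | Inr k \<Rightarrow> k) i' * X i' \<omega>)\<bar> \<le> 1 / 8"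
              using coeff_small_if_small_on_window[of "m n" j n w "\<lambda>i. X i \<omega>" "1 / (16 * sqrt (real n))"] j mm(1) small n0
              by (simp add: K_def)
          qed
          then have "\<omega> \<in> E n" using w c by (auto simp: E_def)
          then show False using elim by simp
        qed
        then obtain u where u: "u \<in> window (m n) w" "1 / (16 * sqrt (real n)) < \<bar>f n \<omega> u\<bar>" by auto
        have "\<bar>u - t\<bar> \<le> 2*pi*real (Suc w)/real (m n) - 2*pi*real w/real (m n)"
          using u(1) w(2) by (auto simp: window_def)
        also have "\<dots> = 2 * pi / real (m n)"
          unfolding diff_divide_distrib[symmetric] by (simp add: algebra_simps)
        finally show "\<exists>u. \<bar>u - t\<bar> \<le> 4 * pi * real (logsq n) / real n \<and> 1 / (16 * sqrt (real n)) < \<bar>f n \<omega> u\<bar>"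
          using step u(2) by (intro exI[of _ u]) auto
      qed
    qed
  qed
qed

end

section \<open>The almost sure central limit theorem at a random point\<close>

abbreviation lb :: "real \<Rightarrow> real measure" where
  "lb q \<equiv> restrict_space lborel {0..q}"

lemma space_lb: "space (lb q) = {0..q}" by (simp add: space_restrict_space)

lemma finite_measure_lb: "finite_measure (lb q)"
proof (rule finite_measureI)
  have "emeasure (lb q) (space (lb q)) = emeasure lborel {0..q}"
    by (simp add: emeasure_restrict_space space_lb)
  also have "\<dots> \<noteq> \<infinity>" by (cases "0 \<le> q") auto
  finally show "emeasure (lb q) (space (lb q)) \<noteq> \<infinity>" .
qed

lemma measure_lb: "0 \<le> q \<Longrightarrow> measure (lb q) (space (lb q)) = q"
  by (simp add: measure_restrict_space space_lb)

lemma borel_lb: "continuous_on UNIV g \<Longrightarrow> g \<in> borel_measurable (lb q)" for g :: "real \<Rightarrow> real"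
  by (intro measurable_restrict_space1) (simp add: borel_measurable_continuous_onI)

lemma integral_lb:
  fixes g :: "real \<Rightarrow> real"
  assumes "continuous_on UNIV g"
  shows "integral\<^sup>L (lb q) g = integral {0..q} g" "integrable (lb q) g"
proof -
  have si: "set_integrable lborel {0..q} g"
    unfolding set_integrable_def using assms by (intro borel_integrable_compact) (auto intro: continuous_on_subset)
  show "integral\<^sup>L (lb q) g = integral {0..q} g"
    using set_borel_integral_eq_integral(2)[OF si]
    by (simp add: integral_restrict_space set_lebesgue_integral_def)
  show "integrable (lb q) g"
    using si by (simp add: integrable_restrict_space set_integrable_def)
qed

text \<open>Polar form of each frequency, Parseval, and Cauchy-Schwarz over an interval of length 2
  pi. The shift \<open>s\<close> disappears into the phases, so the bound is uniform in it.\<close>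

lemma L1_le_coeffs:
  fixes c d :: "nat \<Rightarrow> real"
  shows "integral {0..2*pi} (\<lambda>t. \<bar>\<Sum>k=1..n. c k * cos (real k * (t + s)) + d k * sin (real k * (t + s))\<bar>)
    \<le> sqrt (2 * pi\<^sup>2 * (\<Sum>k=1..n. (c k)\<^sup>2 + (d k)\<^sup>2))"
proof -
  have "\<forall>k. \<exists>r p. \<forall>x. c k * cos x + d k * sin x = r * cos (x + p) \<and> r\<^sup>2 = (c k)\<^sup>2 + (d k)\<^sup>2"
    using phase_exists by blast
  then obtain r p where rp: "\<And>k x. c k * cos x + d k * sin x = r k * cos (x + p k)" "\<And>k. (r k)\<^sup>2 = (c k)\<^sup>2 + (d k)\<^sup>2"
    by metis
  define g where "g t = (\<Sum>k=1..n. r k * cos (real k * t + (real k * s + p k)))" for t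
  have g: "(\<Sum>k=1..n. c k * cos (real k * (t + s)) + d k * sin (real k * (t + s))) = g t" for t
    unfolding g_def rp by (simp add: distrib_left add.assoc)
  have cont: "continuous_on S g" for S unfolding g_def by (intro continuous_intros)
  have "integral {0..2*pi} (\<lambda>t. (g t)\<^sup>2) = pi * (\<Sum>k=1..n. (r k)\<^sup>2)"
    unfolding g_def by (rule integral_unique[OF parseval_phase])
  then have "(integral {0..2*pi} (\<lambda>t. \<bar>g t\<bar>))\<^sup>2 \<le> 2 * pi * (pi * (\<Sum>k=1..n. (r k)\<^sup>2))"
    using integral_abs_square_le[of 0 "2*pi" g] cont by simp
  then have "(integral {0..2*pi} (\<lambda>t. \<bar>g t\<bar>))\<^sup>2 \<le> 2 * pi\<^sup>2 * (\<Sum>k=1..n. (c k)\<^sup>2 + (d k)\<^sup>2)"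
    unfolding rp(2) by (simp add: power2_eq_square[of pi] mult.assoc)
  then show ?thesis unfolding g by (rule real_le_rsqrt)
qed

text \<open>The bound 36 is chosen as a perfect square, so that a factor 6 leaves the square
  roots.\<close>

lemma two_pi_sq_le: "2 * pi\<^sup>2 \<le> (36::real)"
proof -
  have "pi\<^sup>2 \<le> 4\<^sup>2" using pi_less_4 by (intro power_mono) auto
  then show ?thesis using pi_less_4 by simp
qed

text \<open>Variance of \<open>pair\<close> at any point \<open>t\<close>. By stationarity it does
  not depend on \<open>t\<close>, which is the constancy of \<open>v\<close> required by
  \<open>second_moment_char_integral\<close>.\<close>

definition pair_var :: "real \<Rightarrow> real \<Rightarrow> real \<Rightarrow> nat \<Rightarrow> real" where
  "pair_var \<alpha> \<beta> h n = (\<Sum>k=1..n. \<alpha>\<^sup>2 + \<beta>\<^sup>2 + 2 * \<alpha> * \<beta> * cos (real k * h)) / real n"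

context trig_iid
begin

definition pair :: "real \<Rightarrow> real \<Rightarrow> real \<Rightarrow> nat \<Rightarrow> 'w \<Rightarrow> real \<Rightarrow> real" where
  "pair \<alpha> \<beta> h n \<omega> t = \<alpha> * f n \<omega> t + \<beta> * f n \<omega> (t + h)"

text \<open>Squared modulus of the difference between the integrated characteristic function of
  \<open>pair\<close> at a point of [0, q] and its Gaussian prediction, split into real and
  imaginary part.\<close>

definition dev :: "real \<Rightarrow> real \<Rightarrow> real \<Rightarrow> real \<Rightarrow> nat \<Rightarrow> 'w \<Rightarrow> real" where
  "dev q \<alpha> \<beta> h n \<omega> = ((\<integral>t. cos (pair \<alpha> \<beta> h n \<omega> t) \<partial>lb q) - exp (- pair_var \<alpha> \<beta> h n / 2) * q)\<^sup>2
     + (\<integral>t. sin (pair \<alpha> \<beta> h n \<omega> t) \<partial>lb q)\<^sup>2"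

text \<open>The covariance between the points s and t is a cosine polynomial in t - s with
  coefficients at most A^2 / n, where A = |alpha| + |beta|; by \<open>L1_le_coeffs\<close> its
  absolute integral is O(n^(-1/2)). The fourth-power term is only O(1/n), since the 2n weights are
  at most A / sqrt n. The constant 2304 is 36 * 8^2, with 8 bounding \<open>q\<close>.\<close>

lemma second_moment_pair:
  assumes q: "0 \<le> q" "q \<le> 2*pi" and n: "1 \<le> n"
  shows "expectation (dev q \<alpha> \<beta> h n) \<le> 2304 * K4 * ((\<bar>\<alpha>\<bar> + \<bar>\<beta>\<bar>)\<^sup>2 + (\<bar>\<alpha>\<bar> + \<bar>\<beta>\<bar>) ^ 4) / sqrt (real n)"
    and "integrable M (dev q \<alpha> \<beta> h n)"
proof -
  define A where "A = \<bar>\<alpha>\<bar> + \<bar>\<beta>\<bar>"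
  define wt :: "nat + nat \<Rightarrow> real \<Rightarrow> real" where
    "wt i s = (case i of Inl k \<Rightarrow> cos (real k * s) | Inr k \<Rightarrow> sin (real k * s))" for i s
  define J :: "(nat + nat) set" where "J = Inl ` {1..n} \<union> Inr ` {1..n}"
  define \<theta> where "\<theta> i s = (\<alpha> * wt i s + \<beta> * wt i (s + h)) / sqrt (real n)" for i s
  define \<rho> where "\<rho> k = \<alpha>\<^sup>2 + \<beta>\<^sup>2 + 2 * \<alpha> * \<beta> * cos (real k * h)" for k :: nat
  have sn: "0 < sqrt (real n)" "sqrt (real n) * sqrt (real n) = real n" using n by auto
  have A0: "0 \<le> A" by (simp add: A_def)
  have J: "finite J" "J \<subseteq> Inl ` {1..} \<union> Inr ` {1..}" by (auto simp: J_def)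
  have cardJ: "card J = 2 * n" unfolding J_def
    by (subst card_Un_disjoint) (auto simp: card_image)
  have Leq: "pair \<alpha> \<beta> h n \<omega> s = (\<Sum>i\<in>J. \<theta> i s * X i \<omega>)" for \<omega> s
  proof -
    have tp: "f n \<omega> t = (\<Sum>i\<in>J. wt i t / sqrt (real n) * X i \<omega>)" for t
      using trig_poly_sum[of "\<lambda>i. X i \<omega>" n t] by (simp add: f_def J_def wt_def)
    show ?thesis unfolding pair_def tp \<theta>_def
      by (simp add: sum_distrib_left sum.distrib[symmetric] add_divide_distrib distrib_left mult_ac)
  qed
  have wtb: "\<bar>wt i s\<bar> \<le> 1" for i s by (cases i) (auto simp: wt_def)
  have wtc: "continuous_on UNIV (wt i)" for i by (cases i) (auto simp: wt_def[abs_def] intro!: continuous_intros)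
  have \<theta>c: "continuous_on UNIV (\<theta> i)" for i unfolding \<theta>_def
    by (intro continuous_intros wtc continuous_on_compose2[OF wtc]) (use sn in auto)
  have \<theta>b: "\<bar>\<theta> i s\<bar> \<le> A / sqrt (real n)" for i s
  proof -
    have "\<bar>\<alpha> * wt i s + \<beta> * wt i (s + h)\<bar> \<le> \<bar>\<alpha>\<bar> * \<bar>wt i s\<bar> + \<bar>\<beta>\<bar> * \<bar>wt i (s + h)\<bar>"
      unfolding abs_mult[symmetric] by (rule abs_triangle_ineq)
    also have "\<dots> \<le> \<bar>\<alpha>\<bar> * 1 + \<bar>\<beta>\<bar> * 1" by (intro add_mono mult_left_mono wtb) auto
    finally show ?thesis unfolding \<theta>_def using sn by (simp add: A_def divide_right_mono)
  qed
  have cov: "(\<Sum>i\<in>J. \<theta> i s * \<theta> i t) = (\<Sum>k=1..n. (\<rho> k / real n) * cos (real k * (t + - s)) + 0 * sin (real k * (t + - s)))" for s t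
  proof -
    have one: "\<theta> (Inl k) s * \<theta> (Inl k) t + \<theta> (Inr k) s * \<theta> (Inr k) t = (\<rho> k / real n) * cos (real k * (t + - s))" for k
    proof -
      have "(\<alpha> * cos a + \<beta> * cos (a + c)) * (\<alpha> * cos b + \<beta> * cos (b + c)) + (\<alpha> * sin a + \<beta> * sin (a + c)) * (\<alpha> * sin b + \<beta> * sin (b + c))
         = (\<alpha>\<^sup>2 + \<beta>\<^sup>2 + 2 * \<alpha> * \<beta> * cos c) * cos (b - a)" for a b c :: real
      proof -
        have 1: "cos a * cos b + sin a * sin b = cos (b - a)" by (simp add: cos_diff mult.commute)
        have 2: "cos (a + c) * cos (b + c) + sin (a + c) * sin (b + c) = cos (b - a)"
          using cos_diff[of "b + c" "a + c"] by (simp add: mult.commute)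
        have 3: "cos a * cos (b + c) + sin a * sin (b + c) = cos (b - a + c)"
          using cos_diff[of "b + c" a] by (simp add: mult.commute algebra_simps)
        have 4: "cos (a + c) * cos b + sin (a + c) * sin b = cos (b - a - c)"
          using cos_diff[of b "a + c"] by (simp add: mult.commute algebra_simps)
        have "(\<alpha> * cos a + \<beta> * cos (a + c)) * (\<alpha> * cos b + \<beta> * cos (b + c)) + (\<alpha> * sin a + \<beta> * sin (a + c)) * (\<alpha> * sin b + \<beta> * sin (b + c))
          = \<alpha>\<^sup>2 * (cos a * cos b + sin a * sin b) + \<beta>\<^sup>2 * (cos (a + c) * cos (b + c) + sin (a + c) * sin (b + c))
            + \<alpha> * \<beta> * (cos a * cos (b + c) + sin a * sin (b + c)) + \<alpha> * \<beta> * (cos (a + c) * cos b + sin (a + c) * sin b)"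
          by (simp add: algebra_simps power2_eq_square)
        also have "\<dots> = (\<alpha>\<^sup>2 + \<beta>\<^sup>2 + 2 * \<alpha> * \<beta> * cos c) * cos (b - a)"
          unfolding 1 2 3 4 cos_add[of "b-a"] cos_diff[of "b-a" c] by (simp add: algebra_simps)
        finally show ?thesis .
      qed
      note trig = this[of "real k * s" "real k * h" "real k * t"]
      have fr: "a / y * (b / y) + c / y * (d / y) = (a * b + c * d) / (y * y)" for a b c d y :: real
        by (simp add: add_divide_distrib)
      have ang: "real k * (x + h) = real k * x + real k * h" "real k * (t + - s) = real k * t - real k * s" for x
        by (simp_all add: algebra_simps)
      have "\<theta> (Inl k) s * \<theta> (Inl k) t + \<theta> (Inr k) s * \<theta> (Inr k) t = \<rho> k * cos (real k * (t + - s)) / real n"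
        unfolding \<theta>_def wt_def sum.case fr sn(2) ang trig \<rho>_def ..
      then show ?thesis by simp
    qed
    have "(\<Sum>i\<in>J. \<theta> i s * \<theta> i t) = (\<Sum>k=1..n. \<theta> (Inl k) s * \<theta> (Inl k) t + \<theta> (Inr k) s * \<theta> (Inr k) t)"
      unfolding J_def by (simp add: sum_Plus_image sum.distrib)
    then show ?thesis unfolding one by simp
  qed
  have v: "(\<Sum>i\<in>J. (\<theta> i s)\<^sup>2) = pair_var \<alpha> \<beta> h n" for s
    using cov[of s s] by (simp add: power2_eq_square pair_var_def \<rho>_def sum_divide_distrib)
  have \<theta>m: "\<theta> i \<in> borel_measurable (lb q)" for i by (intro borel_lb \<theta>c)
  show "integrable M (dev q \<alpha> \<beta> h n)"
    unfolding dev_def[abs_def]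
    using second_moment_char_integral(2)[OF finite_measure_lb J \<theta>m \<theta>b v] unfolding measure_lb[OF q(1)] Leq[symmetric] .
  have c1: "(\<integral>s. \<integral>t. \<bar>\<Sum>i\<in>J. \<theta> i s * \<theta> i t\<bar> \<partial>lb q \<partial>lb q) \<le> 48 * A\<^sup>2 / sqrt (real n)"
  proof -
    have contc: "continuous_on UNIV (\<lambda>t. \<bar>\<Sum>i\<in>J. \<theta> i s * \<theta> i t\<bar>)" for s
      by (intro continuous_intros \<theta>c)
    have \<rho>b: "\<bar>\<rho> k\<bar> \<le> A\<^sup>2" for k
    proof -
      have "\<bar>\<rho> k\<bar> \<le> \<bar>\<alpha>\<^sup>2\<bar> + \<bar>\<beta>\<^sup>2\<bar> + \<bar>2 * \<alpha> * \<beta> * cos (real k * h)\<bar>"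
        unfolding \<rho>_def by linarith
      also have "\<bar>2 * \<alpha> * \<beta> * cos (real k * h)\<bar> \<le> 2 * \<bar>\<alpha>\<bar> * \<bar>\<beta>\<bar> * 1"
        unfolding abs_mult by (intro mult_mono) auto
      finally show ?thesis by (simp add: A_def power2_sum)
    qed
    have "(\<integral>t. \<bar>\<Sum>i\<in>J. \<theta> i s * \<theta> i t\<bar> \<partial>lb q) \<le> 6 * A\<^sup>2 / sqrt (real n)" for s
    proof -
      have "(\<integral>t. \<bar>\<Sum>i\<in>J. \<theta> i s * \<theta> i t\<bar> \<partial>lb q) = integral {0..q} (\<lambda>t. \<bar>\<Sum>i\<in>J. \<theta> i s * \<theta> i t\<bar>)"
        by (rule integral_lb(1)[OF contc])
      also have "\<dots> \<le> integral {0..2*pi} (\<lambda>t. \<bar>\<Sum>i\<in>J. \<theta> i s * \<theta> i t\<bar>)"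
        using q by (intro integral_subset_le integrable_continuous_real continuous_on_subset[OF contc]) auto
      also have "\<dots> \<le> sqrt (2 * pi\<^sup>2 * (\<Sum>k=1..n. (\<rho> k / real n)\<^sup>2 + 0\<^sup>2))"
        unfolding cov by (rule L1_le_coeffs)
      also have "\<dots> \<le> sqrt (36 * (A\<^sup>2)\<^sup>2 / real n)"
      proof (rule real_sqrt_le_mono)
        have "(\<Sum>k=1..n. (\<rho> k / real n)\<^sup>2 + 0\<^sup>2) \<le> (\<Sum>k=1..n. (A\<^sup>2 / real n)\<^sup>2)"
        proof (rule sum_mono)
          fix k
          have "\<bar>\<rho> k / real n\<bar>\<^sup>2 \<le> (A\<^sup>2 / real n)\<^sup>2" using \<rho>b[of k] by (intro power_mono) (auto simp: divide_right_mono)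
          then show "(\<rho> k / real n)\<^sup>2 + 0\<^sup>2 \<le> (A\<^sup>2 / real n)\<^sup>2"
            by (simp only: power2_abs power_zero_numeral add_0_right)
        qed
        also have "\<dots> = (A\<^sup>2)\<^sup>2 / real n" using n by (simp add: power2_eq_square)
        finally have "2 * pi\<^sup>2 * (\<Sum>k=1..n. (\<rho> k / real n)\<^sup>2 + 0\<^sup>2) \<le> 36 * ((A\<^sup>2)\<^sup>2 / real n)"
          by (intro mult_mono two_pi_sq_le) (auto intro: sum_nonneg)
        then show "2 * pi\<^sup>2 * (\<Sum>k=1..n. (\<rho> k / real n)\<^sup>2 + 0\<^sup>2) \<le> 36 * (A\<^sup>2)\<^sup>2 / real n" by simp
      qed
      also have "\<dots> = 6 * A\<^sup>2 / sqrt (real n)"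
      proof -
        have "sqrt 36 = (6::real)" by (rule real_sqrt_unique) auto
        then show ?thesis unfolding real_sqrt_divide real_sqrt_mult real_sqrt_abs by simp
      qed
      finally show ?thesis .
    qed
    note inner = this
    interpret fm: finite_measure "lb q" by (rule finite_measure_lb)
    have "(\<integral>s. \<integral>t. \<bar>\<Sum>i\<in>J. \<theta> i s * \<theta> i t\<bar> \<partial>lb q \<partial>lb q) \<le> (\<integral>s. 6 * A\<^sup>2 / sqrt (real n) \<partial>lb q)"
      by (rule integral_mono') (use inner sn in auto)
    also have "\<dots> = q * (6 * A\<^sup>2 / sqrt (real n))" using measure_lb[OF q(1)] by simp
    also have "\<dots> \<le> 8 * (6 * A\<^sup>2 / sqrt (real n))" using q pi_less_4 sn by (intro mult_right_mono) auto
    finally show ?thesis by simp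
  qed
  have c2: "18 * K4 * real (card J) * (A / sqrt (real n)) ^ 4 * q\<^sup>2 \<le> 2304 * K4 * A ^ 4 / sqrt (real n)"
  proof -
    have "sqrt (real n) ^ 4 = real n ^ 2" using sn by (simp add: power4_eq_xxxx power2_eq_square)
    then have "18 * K4 * real (card J) * (A / sqrt (real n)) ^ 4 * q\<^sup>2 = (36 * K4 * A ^ 4 / real n) * q\<^sup>2"
      using n by (simp add: cardJ power_divide power2_eq_square)
    also have "\<dots> \<le> (36 * K4 * A ^ 4 / real n) * 8\<^sup>2"
      using q pi_less_4 K4_pos A0 by (intro mult_left_mono power_mono) auto
    also have "\<dots> = 2304 * K4 * A ^ 4 / real n" by simp
    also have "\<dots> \<le> 2304 * K4 * A ^ 4 / sqrt (real n)"
    proof (rule divide_left_mono)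
      show "sqrt (real n) \<le> real n" using mult_left_mono[of 1 "sqrt (real n)" "sqrt (real n)"] sn n by simp
    qed (use K4_pos A0 n in auto)
    finally show ?thesis .
  qed
  have "expectation (dev q \<alpha> \<beta> h n) \<le> (\<integral>s. \<integral>t. \<bar>\<Sum>i\<in>J. \<theta> i s * \<theta> i t\<bar> \<partial>lb q \<partial>lb q) + 18 * K4 * real (card J) * (A / sqrt (real n)) ^ 4 * q\<^sup>2"
    unfolding dev_def[abs_def]
    using second_moment_char_integral(1)[OF finite_measure_lb J \<theta>m \<theta>b v] unfolding measure_lb[OF q(1)] Leq[symmetric] .
  also have "\<dots> \<le> 48 * A\<^sup>2 / sqrt (real n) + 2304 * K4 * A ^ 4 / sqrt (real n)" by (intro add_mono c1 c2)
  also have "\<dots> \<le> 2304 * K4 * A\<^sup>2 / sqrt (real n) + 2304 * K4 * A ^ 4 / sqrt (real n)"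
    using K4_pos sn by (intro add_mono divide_right_mono mult_right_mono) auto
  finally show "expectation (dev q \<alpha> \<beta> h n) \<le> 2304 * K4 * ((\<bar>\<alpha>\<bar> + \<bar>\<beta>\<bar>)\<^sup>2 + (\<bar>\<alpha>\<bar> + \<bar>\<beta>\<bar>) ^ 4) / sqrt (real n)"
    by (simp add: A_def distrib_left add_divide_distrib)
qed

end

section \<open>Comparison with fourth powers\<close>

text \<open>Almost sure statements are proved along fourth powers; \<open>n\<close> is compared with \<open>fr n ^ 4\<close>.\<close>

definition fr :: "nat \<Rightarrow> nat" where
  "fr n = (LEAST j. n \<le> j ^ 4)"

lemma fr_ge: "n \<le> fr n ^ 4"
  unfolding fr_def by (rule LeastI[of _ n]) (cases "n = 0"; simp add: self_le_power)

lemma fr_gt: "1 \<le> fr n \<Longrightarrow> (fr n - 1) ^ 4 < n"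
  using not_less_Least[of "fr n - 1" "\<lambda>j. n \<le> j ^ 4"] by (simp add: fr_def[symmetric] not_le)

lemma filterlim_fr: "filterlim fr at_top sequentially"
  unfolding filterlim_at_top
proof
  fix Z
  show "\<forall>\<^sub>F n in sequentially. Z \<le> fr n"
    using eventually_gt_at_top[of "Z ^ 4"]
  proof eventually_elim
    case (elim n)
    then have "Z ^ 4 < fr n ^ 4" using fr_ge[of n] by simp
    then show ?case by (meson less_imp_le power_less_imp_less_base zero_le)
  qed
qed

text \<open>Markov's inequality bounds the exceedance probabilities by the summable
  \<open>e n\<close>, and Borel-Cantelli applies. Indices with nonpositive threshold get the empty
  event.\<close>

lemma (in prob_space) AE_eventually_less:
  assumes int: "\<And>n. integrable M (Y n)" and pos: "\<And>n x. 0 \<le> Y n x"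
    and c: "\<forall>\<^sub>F n in sequentially. 0 < c n \<and> expectation (Y n) \<le> e n * c n" and e: "summable e"
  shows "AE x in M. \<forall>\<^sub>F n in sequentially. Y n x < (c n :: real)"
proof -
  define A where "A n = (if 0 < c n then {x \<in> space M. c n \<le> Y n x} else {})" for n
  have [measurable]: "Y n \<in> borel_measurable M" for n using int by auto
  have [measurable]: "A n \<in> sets M" for n unfolding A_def by simp
  have "\<forall>\<^sub>F n in sequentially. norm (prob (A n)) \<le> e n"
    using c
  proof eventually_elim
    case (elim n)
    have "prob (A n) \<le> expectation (Y n) / c n"
      unfolding A_def using elim int pos by (auto intro!: integral_Markov_inequality_measure[where A="{}"])
    also have "\<dots> \<le> e n" using elim by (simp add: field_simps)
    finally show ?case by simp
  qed
  then have "summable (\<lambda>n. prob (A n))" using e by (rule summable_comparison_test_ev)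
  then have "AE x in M. \<forall>\<^sub>F n in sequentially. x \<in> space M - A n"
    by (intro borel_cantelli_AE1) (auto simp: emeasure_eq_measure)
  then show ?thesis
  proof (rule AE_mp, intro AE_I2 impI)
    fix x assume "\<forall>\<^sub>F n in sequentially. x \<in> space M - A n"
    then show "\<forall>\<^sub>F n in sequentially. Y n x < c n"
      using c by eventually_elim (auto simp: A_def)
  qed
qed

lemma summable_inverse_cube: "summable (\<lambda>j. c / real j ^ 3)"
proof -
  have "summable (\<lambda>j. c * inverse (real j ^ 3))"
    by (intro summable_mult inverse_power_summable) simp
  then show ?thesis by (simp add: divide_inverse)
qed

text \<open>The characteristic function is controlled simultaneously at all integer frequencies up to this bound.\<close>

definition freq_bound :: "nat \<Rightarrow> nat" where
  "freq_bound j = nat \<lfloor>real j powr (1 / 16)\<rfloor>"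

lemma freq_bound_power: "1 \<le> j \<Longrightarrow> real (freq_bound j) ^ 16 \<le> real j"
proof -
  assume j: "1 \<le> j"
  have "real (freq_bound j) \<le> real j powr (1 / 16)" by (simp add: freq_bound_def)
  then have "real (freq_bound j) ^ 16 \<le> (real j powr (1 / 16)) ^ 16" by (intro power_mono) auto
  also have "\<dots> = real j" using j by (simp add: powr_realpow[symmetric] powr_powr)
  finally show ?thesis .
qed

lemma filterlim_freq_bound: "filterlim freq_bound at_top sequentially"
  unfolding filterlim_at_top
proof
  fix Z :: nat
  have "filterlim (\<lambda>j::nat. real j powr (1 / 16)) at_top sequentially" by real_asymp
  then have "\<forall>\<^sub>F j in sequentially. real Z \<le> real j powr (1 / 16)" by (simp add: filterlim_at_top)
  then show "\<forall>\<^sub>F j in sequentially. Z \<le> freq_bound j"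
    by eventually_elim (simp add: freq_bound_def le_nat_floor)
qed

context trig_iid
begin

definition sq :: "'w \<Rightarrow> nat \<Rightarrow> real" where
  "sq \<omega> k = (X (Inl k) \<omega>)\<^sup>2 + (X (Inr k) \<omega>)\<^sup>2"

lemma sq_nonneg: "0 \<le> sq \<omega> k" by (simp add: sq_def)

lemma dev_nonneg: "0 \<le> dev q \<alpha> \<beta> h n \<omega>" by (simp add: dev_def)

text \<open>The exceptional probabilities are at most a constant over the block size, so blocks with
  at least \<open>j ^ 3\<close> members suffice for Borel-Cantelli. The factor 4 is 2 for the two
  coefficients per frequency times 2 from \<open>prob_sum_squares\<close>.\<close>

lemma AE_blocks:
  assumes B: "\<And>j. finite (B j)" "\<And>j. B j \<subseteq> {1..}" "\<forall>\<^sub>F j in sequentially. j ^ 3 \<le> card (B j)"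
  shows "AE \<omega> in M. \<forall>\<^sub>F j in sequentially. (\<Sum>k\<in>B j. sq \<omega> k) < 4 * real (card (B j))"
proof -
  define A where "A j = {\<omega> \<in> space M. 4 * real (card (B j)) \<le> (\<Sum>k\<in>B j. sq \<omega> k)}" for j
  have meas [measurable]: "X (Inl k) \<in> borel_measurable M" "X (Inr k) \<in> borel_measurable M" if "k \<in> B j" for k j
    using that B(2)[of j] by (auto intro!: X_measurable)
  have [measurable]: "A j \<in> sets M" for j unfolding A_def sq_def by measurable
  have "\<forall>\<^sub>F j in sequentially. norm (prob (A j)) \<le> K4 / real j ^ 3"
    using B(3) eventually_gt_at_top[of 0]
  proof eventually_elim
    case (elim j)
    define J :: "(nat + nat) set" where "J = Inl ` B j \<union> Inr ` B j"
    have cJ: "card J = 2 * card (B j)" unfolding J_def using B(1)[of j]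
      by (subst card_Un_disjoint) (auto simp: card_image)
    have c: "0 < j ^ 3" "j ^ 3 \<le> card (B j)" using elim by auto
    have "A j = {\<omega> \<in> space M. 2 * real (card J) \<le> (\<Sum>i\<in>J. (X i \<omega>)\<^sup>2)}"
      unfolding A_def cJ unfolding J_def sum_Plus_image[OF B(1) B(1)] by (simp add: sq_def sum.distrib)
    also have "prob \<dots> \<le> K4 / real (card J)"
      using B(1)[of j] B(2)[of j] c by (intro prob_sum_squares) (auto simp: J_def)
    also have "\<dots> \<le> K4 / real j ^ 3"
    proof (rule divide_left_mono)
      have "j ^ 3 \<le> card J" using c cJ by simp
      then show "real j ^ 3 \<le> real (card J)" by (metis of_nat_le_iff of_nat_power)
      have "0 < card J" using c cJ by linarith
      then show "0 < real (card J) * real j ^ 3" using elim by simp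
    qed (use K4_pos in auto)
    finally show ?case by simp
  qed
  then have "summable (\<lambda>j. prob (A j))" by (rule summable_comparison_test_ev[OF _ summable_inverse_cube])
  then have "AE x in M. \<forall>\<^sub>F n in sequentially. x \<in> space M - A n"
    by (intro borel_cantelli_AE1) (auto simp: emeasure_eq_measure)
  then show ?thesis
    by (rule AE_mp) (auto intro!: AE_I2 elim!: eventually_mono simp: A_def not_le)
qed

text \<open>Energy control on all frequencies up to \<open>j ^ 4\<close> and, separately, on the
  last block alone. The total bounds the size of the polynomials; the block bound makes the change
  between consecutive fourth powers small.\<close>

definition regular :: "'w \<Rightarrow> nat \<Rightarrow> bool" where
  "regular \<omega> j \<longleftrightarrow> 2 \<le> j \<and> (\<Sum>k=1..j^4. sq \<omega> k) < 4 * real (j^4) \<and>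
     (\<Sum>k\<in>{(j-1)^4<..j^4}. sq \<omega> k) < 4 * (real (j^4) - real ((j-1)^4))"

lemma AE_regular: "AE \<omega> in M. \<forall>\<^sub>F j in sequentially. regular \<omega> j"
proof -
  have "j ^ 3 \<le> j ^ 4 - (j - 1) ^ 4" for j :: nat
  proof (cases j)
    case (Suc i)
    have p: "x ^ 4 = x * x ^ 3" for x :: nat by (simp add: power4_eq_xxxx power3_eq_cube)
    have "i ^ 4 + (Suc i) ^ 3 \<le> i * (Suc i) ^ 3 + (Suc i) ^ 3"
      unfolding p by (intro add_right_mono mult_left_mono power_mono) auto
    also have "\<dots> = Suc i ^ 4" unfolding p[of "Suc i"] by simp
    finally show ?thesis using Suc by simp
  qed simp
  then have 1: "AE \<omega> in M. \<forall>\<^sub>F j in sequentially. (\<Sum>k\<in>{(j-1)^4<..j^4}. sq \<omega> k) < 4 * real (card {(j-1)^4<..j^4})"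
    by (intro AE_blocks) (auto intro!: always_eventually)
  have "j ^ 3 \<le> j ^ 4" for j :: nat by (cases j) (auto intro: power_increasing)
  then have 2: "AE \<omega> in M. \<forall>\<^sub>F j in sequentially. (\<Sum>k\<in>{1..j^4}. sq \<omega> k) < 4 * real (card {1..j^4})"
    by (intro AE_blocks) (auto intro!: always_eventually)
  from 1 2 show ?thesis
  proof eventually_elim
    case (elim \<omega>)
    from elim(1) elim(2) eventually_ge_at_top[of 2] show ?case
    proof eventually_elim
      case (elim j)
      have "(j - 1) ^ 4 \<le> j ^ 4" by (intro power_mono) auto
      then show ?case using elim by (simp add: regular_def of_nat_diff)
    qed
  qed
qed

lemma sum_sq_le:
  assumes "regular \<omega> (fr n)"
  shows "(\<Sum>k=1..n. sq \<omega> k) \<le> 64 * real n" "real (fr n ^ 4) \<le> 16 * real n" "1 \<le> n"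
proof -
  define j where "j = fr n"
  have j: "2 \<le> j" using assms by (simp add: regular_def j_def)
  have gt: "(j - 1) ^ 4 < n" using fr_gt[of n] j by (simp add: j_def)
  \<comment> \<open>From \<open>2 <= j\<close> one has j <= 2(j - 1), so N is at most 16 times n;
    the 64 is this 16 times the 4 in \<open>regular\<close>.\<close>
  have "j ^ 4 \<le> (2 * (j - 1)) ^ 4" using j by (intro power_mono) auto
  also have "\<dots> = 16 * (j - 1) ^ 4" by (simp only: power_mult_distrib) simp
  also have "\<dots> \<le> 16 * n" using gt by simp
  finally have "j ^ 4 \<le> 16 * n" .
  then show le: "real (fr n ^ 4) \<le> 16 * real n" unfolding j_def by linarith
  show "1 \<le> n" using gt by simp
  have "(\<Sum>k=1..n. sq \<omega> k) \<le> (\<Sum>k=1..j^4. sq \<omega> k)"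
    using fr_ge[of n] by (intro sum_mono2) (auto simp: j_def sq_nonneg)
  also have "\<dots> \<le> 4 * real (j ^ 4)" using assms unfolding regular_def j_def by linarith
  finally show "(\<Sum>k=1..n. sq \<omega> k) \<le> 64 * real n" using le by (simp add: j_def)
qed

lemma f_continuous: "continuous_on S (f n \<omega>)"
  unfolding f_def trig_poly_def by (intro continuous_intros)

text \<open>The coefficients of the difference are those of frequencies up to \<open>n\<close> times
  n^(-1/2) - N^(-1/2), and those of the new frequencies times N^(-1/2). Since (x - y)^2 <= x^2 -
  y^2, both energies are controlled by the block length divided by N, and a block has at most 4 j^3
  of the j^4 frequencies. Thus the energy is O(1/j).\<close>

lemma L1_interpolation:
  assumes "regular \<omega> (fr n)"
  shows "integral {0..2*pi} (\<lambda>t. \<bar>f n \<omega> (t + s) - f (fr n ^ 4) \<omega> (t + s)\<bar>) \<le> 100 / sqrt (real (fr n))"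
proof -
  define j where "j = fr n"
  define N where "N = j ^ 4"
  have j: "2 \<le> j" using assms by (simp add: regular_def j_def)
  have nN: "n \<le> N" using fr_ge by (simp add: N_def j_def)
  have n1: "1 \<le> n" "real N \<le> 16 * real n" using sum_sq_le[OF assms] by (auto simp: N_def j_def)
  have gt: "(j - 1) ^ 4 < n" using fr_gt[of n] j by (simp add: j_def)
  define e where "e k = (if k \<le> n then 1 / sqrt (real n) - 1 / sqrt (real N) else - (1 / sqrt (real N)))" for k
  define d where "d = 1 / sqrt (real n) - 1 / sqrt (real N)"
  have sq: "0 < sqrt (real n)" "sqrt (real n) \<le> sqrt (real N)" using n1 nN by auto
  have d0: "0 \<le> d" using sq by (simp add: d_def divide_left_mono frac_le)
  have eq: "f n \<omega> (t + s) - f N \<omega> (t + s) =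
     (\<Sum>k=1..N. (e k * X (Inl k) \<omega>) * cos (real k * (t + s)) + (e k * X (Inr k) \<omega>) * sin (real k * (t + s)))" for t
  proof -
    define g where "g k = X (Inl k) \<omega> * cos (real k * (t + s)) + X (Inr k) \<omega> * sin (real k * (t + s))" for k
    have "(\<Sum>k=1..n. g k) = (\<Sum>k=1..N. if k \<le> n then g k else 0)"
      using nN by (intro sum.mono_neutral_cong_left) auto
    then have "f n \<omega> (t + s) - f N \<omega> (t + s) = (\<Sum>k=1..N. 1 / sqrt (real n) * (if k \<le> n then g k else 0)) - (\<Sum>k=1..N. 1 / sqrt (real N) * g k)"
      unfolding f_def trig_poly_def g_def[symmetric] sum_distrib_left[symmetric] by simp
    also have "\<dots> = (\<Sum>k=1..N. e k * g k)"
      unfolding sum_subtractf[symmetric] by (intro sum.cong) (auto simp: e_def left_diff_distrib)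
    finally show ?thesis by (simp add: g_def distrib_left mult.assoc)
  qed
  have "(\<Sum>k=1..N. (e k * X (Inl k) \<omega>)\<^sup>2 + (e k * X (Inr k) \<omega>)\<^sup>2) = (\<Sum>k=1..N. (e k)\<^sup>2 * sq \<omega> k)"
    by (simp add: sq_def power_mult_distrib distrib_left)
  also have "(\<Sum>k=1..N. (e k)\<^sup>2 * sq \<omega> k) = (\<Sum>k\<in>{1..n}. (e k)\<^sup>2 * sq \<omega> k) + (\<Sum>k\<in>{n<..N}. (e k)\<^sup>2 * sq \<omega> k)"
  proof -
    have "{1..N} = {1..n} \<union> {n<..N}" using nN by auto
    then show ?thesis by (simp only:) (rule sum.union_disjoint; auto)
  qed
  also have "(\<Sum>k\<in>{1..n}. (e k)\<^sup>2 * sq \<omega> k) = d\<^sup>2 * (\<Sum>k\<in>{1..n}. sq \<omega> k)"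
    by (simp add: e_def d_def sum_distrib_left)
  also have "(\<Sum>k\<in>{n<..N}. (e k)\<^sup>2 * sq \<omega> k) = (\<Sum>k\<in>{n<..N}. sq \<omega> k) / real N"
    by (simp add: e_def power_divide sum_divide_distrib)
  finally have total: "(\<Sum>k=1..N. (e k * X (Inl k) \<omega>)\<^sup>2 + (e k * X (Inr k) \<omega>)\<^sup>2)
      = d\<^sup>2 * (\<Sum>k\<in>{1..n}. sq \<omega> k) + (\<Sum>k\<in>{n<..N}. sq \<omega> k) / real N" .
  define g where "g = real N - real ((j - 1) ^ 4)"
  have g4: "g \<le> 4 * real j ^ 3"
  proof -
    define x where "x = real j - 1"
    have x: "0 \<le> x" "real j = x + 1" "real (j - 1) = x" using j by (auto simp: x_def of_nat_diff)
    have "(x + 1) ^ 4 - x ^ 4 \<le> 4 * (x + 1) ^ 3" using x(1)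
      by (simp add: power4_eq_xxxx power3_eq_cube algebra_simps)
    then show ?thesis unfolding g_def N_def of_nat_power x .
  qed
  have gN: "g / real N \<le> 4 / real j"
  proof -
    have "g / real N \<le> 4 * real j ^ 3 / real N" using g4 by (intro divide_right_mono) auto
    also have "\<dots> = 4 / real j" using j by (simp add: N_def power4_eq_xxxx power3_eq_cube)
    finally show ?thesis .
  qed
  have p1: "(\<Sum>k\<in>{n<..N}. sq \<omega> k) / real N \<le> 16 / real j"
  proof -
    have "(\<Sum>k\<in>{n<..N}. sq \<omega> k) \<le> (\<Sum>k\<in>{(j-1)^4<..N}. sq \<omega> k)"
      using gt by (intro sum_mono2) (auto simp: sq_nonneg)
    also have "\<dots> \<le> 4 * g" using assms unfolding regular_def g_def N_def j_def by linarith
    finally have "(\<Sum>k\<in>{n<..N}. sq \<omega> k) / real N \<le> 4 * g / real N" by (intro divide_right_mono) auto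
    then show ?thesis using gN by simp
  qed
  have p2: "d\<^sup>2 * (\<Sum>k\<in>{1..n}. sq \<omega> k) \<le> 256 / real j"
  proof -
    have "(x - y)\<^sup>2 \<le> x\<^sup>2 - y\<^sup>2" if "0 \<le> y" "y \<le> x" for x y :: real
    proof -
      have "(x - y) * (x - y) \<le> (x - y) * (x + y)" using that by (intro mult_left_mono) auto
      then show ?thesis by (simp add: power2_eq_square algebra_simps)
    qed
    from this[of "1 / sqrt (real N)" "1 / sqrt (real n)"]
    have "d\<^sup>2 \<le> 1 / real n - 1 / real N" using d0 by (simp add: d_def power_divide)
    also have "\<dots> = (real N - real n) / (real n * real N)" using n1 nN by (simp add: field_simps)
    also have "\<dots> \<le> g / (real n * real N)" using gt by (intro divide_right_mono) (auto simp: g_def)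
    finally have "d\<^sup>2 \<le> g / (real n * real N)" .
    then have "d\<^sup>2 * (\<Sum>k\<in>{1..n}. sq \<omega> k) \<le> g / (real n * real N) * (64 * real n)"
      using sum_sq_le(1)[OF assms] by (intro mult_mono) (auto intro: sum_nonneg sq_nonneg order_trans[OF zero_le_power2])
    also have "\<dots> = 64 * (g / real N)" using n1 by simp
    also have "\<dots> \<le> 64 * (4 / real j)" using gN by (intro mult_left_mono) auto
    finally show ?thesis by simp
  qed
  have "integral {0..2*pi} (\<lambda>t. \<bar>f n \<omega> (t + s) - f N \<omega> (t + s)\<bar>) \<le>
     sqrt (2 * pi\<^sup>2 * (\<Sum>k=1..N. (e k * X (Inl k) \<omega>)\<^sup>2 + (e k * X (Inr k) \<omega>)\<^sup>2))"
    unfolding eq by (rule L1_le_coeffs)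
  \<comment> \<open>272 = 16 + 256 from \<open>p1\<close> and \<open>p2\<close>; 36 * 272 = 9792 is
    rounded up to 100^2 next.\<close>
  also have "\<dots> \<le> sqrt (36 * (272 / real j))"
  proof (rule real_sqrt_le_mono, rule mult_mono[OF two_pi_sq_le])
    show "(\<Sum>k=1..N. (e k * X (Inl k) \<omega>)\<^sup>2 + (e k * X (Inr k) \<omega>)\<^sup>2) \<le> 272 / real j"
      unfolding total using p1 p2 by simp
  qed (auto intro: sum_nonneg)
  also have "\<dots> \<le> sqrt (100\<^sup>2 / real j)" using j by (intro real_sqrt_le_mono) (simp add: divide_right_mono)
  also have "\<dots> = 100 / sqrt (real j)" by (simp only: real_sqrt_divide real_sqrt_abs abs_numeral)
  finally show ?thesis by (simp add: N_def j_def)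
qed

lemma L1_f:
  assumes "regular \<omega> (fr n)"
  shows "integral {0..2*pi} (\<lambda>t. \<bar>f n \<omega> (t + s)\<bar>) \<le> 48"
proof -
  have n: "1 \<le> n" using sum_sq_le[OF assms] by simp
  have eq: "f n \<omega> (t + s) = (\<Sum>k=1..n. (X (Inl k) \<omega> / sqrt (real n)) * cos (real k * (t + s)) + (X (Inr k) \<omega> / sqrt (real n)) * sin (real k * (t + s)))" for t
    by (simp add: f_def trig_poly_def sum_divide_distrib add_divide_distrib)
  have "integral {0..2*pi} (\<lambda>t. \<bar>f n \<omega> (t + s)\<bar>) \<le> sqrt (2 * pi\<^sup>2 * (\<Sum>k=1..n. (X (Inl k) \<omega> / sqrt (real n))\<^sup>2 + (X (Inr k) \<omega> / sqrt (real n))\<^sup>2))"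
    unfolding eq by (rule L1_le_coeffs)
  also have "(\<Sum>k=1..n. (X (Inl k) \<omega> / sqrt (real n))\<^sup>2 + (X (Inr k) \<omega> / sqrt (real n))\<^sup>2) = (\<Sum>k=1..n. sq \<omega> k) / real n"
    by (simp add: power_divide sq_def sum_divide_distrib add_divide_distrib)
  also have "sqrt (2 * pi\<^sup>2 * ((\<Sum>k=1..n. sq \<omega> k) / real n)) \<le> sqrt (36 * 64)"
  proof (rule real_sqrt_le_mono, rule mult_mono[OF two_pi_sq_le])
    show "(\<Sum>k=1..n. sq \<omega> k) / real n \<le> 64" using sum_sq_le(1)[OF assms] n by (simp add: field_simps)
  qed (auto intro!: divide_nonneg_nonneg sum_nonneg sq_nonneg)
  also have "sqrt (36 * 64) = (48::real)" by (rule real_sqrt_unique) auto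
  finally show ?thesis .
qed

end

section \<open>Small balls from characteristic functions at integer frequencies\<close>

text \<open>The distance of two natural numbers; it avoids truncated subtraction.\<close>

definition ndist :: "nat \<Rightarrow> nat \<Rightarrow> nat" where
  "ndist r s = (if s \<le> r then r - s else s - r)"

lemma ndist_le: "r < m \<Longrightarrow> s < m \<Longrightarrow> ndist r s \<le> m"
  by (auto simp: ndist_def)

text \<open>This is the squared modulus of a geometric exponential sum in real parts. The cosine
  form is what characteristic functions control, and the form as a sum of squares shows
  nonnegativity.\<close>

lemma kernel_eq:
  "(\<Sum>r<m. \<Sum>s<m. cos (real (ndist r s) * x)) = (\<Sum>r<m. cos (real r * x))\<^sup>2 + (\<Sum>r<m. sin (real r * x))\<^sup>2"
proof -
  have "cos (real (ndist r s) * x) = cos (real r * x) * cos (real s * x) + sin (real r * x) * sin (real s * x)" for r s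
  proof -
    have "cos (real (ndist r s) * x) = cos (real r * x - real s * x)"
    proof (cases "s \<le> r")
      case True
      then show ?thesis by (simp add: ndist_def of_nat_diff left_diff_distrib)
    next
      case False
      then have "real (ndist r s) * x = - (real r * x - real s * x)" by (simp add: ndist_def of_nat_diff left_diff_distrib)
      then show ?thesis by (simp only: cos_minus)
    qed
    then show ?thesis by (simp add: cos_diff)
  qed
  then show ?thesis by (simp add: power2_eq_square sum_product sum.distrib)
qed

text \<open>The Fejer kernel, which has nonnegative Fourier coefficients, dominates the indicator of a small ball.\<close>

lemma kernel_ge:
  assumes "1 \<le> m" "\<bar>x\<bar> \<le> 1 / real m"
  shows "(real m)\<^sup>2 / 4 \<le> (\<Sum>r<m. \<Sum>s<m. cos (real (ndist r s) * x))"
proof -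
  have c: "1 / 2 \<le> cos (real r * x)" if "r < m" for r
  proof -
    have "\<bar>real r * x\<bar> \<le> real m * (1 / real m)" unfolding abs_mult using assms that by (intro mult_mono) auto
    then have "\<bar>real r * x\<bar> \<le> \<bar>1::real\<bar>" using assms by simp
    then have "(real r * x)\<^sup>2 \<le> 1\<^sup>2" by (simp only: abs_le_square_iff)
    moreover have "1 - y\<^sup>2 / 2 \<le> cos y" for y :: real
    proof -
      have "\<bar>sin (y / 2)\<bar>\<^sup>2 \<le> \<bar>y / 2\<bar>\<^sup>2" by (intro power_mono abs_sin_x_le_abs_x) auto
      then have "(sin (y / 2))\<^sup>2 \<le> y\<^sup>2 / 4" by (simp only: power2_abs) (simp add: power_divide)
      then show ?thesis using cos_double_sin[of "y / 2"] by simp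
    qed
    ultimately show ?thesis by (smt (verit) field_sum_of_halves one_power2)
  qed
  have "real m / 2 = (\<Sum>r<m. 1 / 2)" by simp
  also have "\<dots> \<le> (\<Sum>r<m. cos (real r * x))" using c by (intro sum_mono) auto
  finally have "(real m / 2)\<^sup>2 \<le> (\<Sum>r<m. cos (real r * x))\<^sup>2" by (intro power_mono) auto
  then show ?thesis unfolding kernel_eq by (simp add: power_divide add_increasing2)
qed

text \<open>Since d <= d^2, the Gaussian values are dominated by a geometric sequence of ratio
  exp(-1/2) <= 2/3. Its sum is at most 3 on each side of the diagonal, hence 6 per row.\<close>

lemma gauss_double_sum: "(\<Sum>r<m. \<Sum>s<m. exp (- (real (ndist r s))\<^sup>2 / 2)) \<le> 6 * real m"
proof -
  define x where "x = exp (- 1 / 2 :: real)"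
  have "3 / 2 \<le> exp (1 / 2 :: real)" using exp_ge_add_one_self[of "1/2"] by simp
  then have "inverse (exp (1 / 2 :: real)) \<le> inverse (3 / 2)" by (intro le_imp_inverse_le) auto
  then have x: "0 < x" "x \<le> 2 / 3" by (auto simp: x_def exp_minus)
  have geo: "(\<Sum>d<k. x ^ d) \<le> 3" for k
  proof -
    have "(\<Sum>d<k. x ^ d) = (1 - x ^ k) / (1 - x)" using x by (simp add: sum_gp_strict)
    also have "\<dots> \<le> 1 / (1 - x)" using x by (intro divide_right_mono) auto
    also have "\<dots> \<le> 1 / (1 / 3)" using x by (intro divide_left_mono) auto
    finally show ?thesis by simp
  qed
  have row: "(\<Sum>s<m. exp (- (real (ndist r s))\<^sup>2 / 2)) \<le> 6" for r
  proof -
    have "exp (- (real d)\<^sup>2 / 2) \<le> x ^ d" for d :: nat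
    proof -
      have "real d \<le> (real d)\<^sup>2" by (cases d) (auto simp: power2_eq_square)
      then have "exp (- (real d)\<^sup>2 / 2) \<le> exp (real d * (- 1 / 2))" by simp
      moreover have "x ^ d = exp (real d * (- 1 / 2))" unfolding x_def by (rule exp_of_nat_mult[symmetric])
      ultimately show ?thesis by simp
    qed
    then have "(\<Sum>s<m. exp (- (real (ndist r s))\<^sup>2 / 2)) \<le> (\<Sum>s<m. x ^ ndist r s)" by (intro sum_mono)
    also have "\<dots> \<le> (\<Sum>s<m. (if s \<le> r then x ^ (r - s) else 0) + (if r \<le> s then x ^ (s - r) else 0))"
      using x by (intro sum_mono) (auto simp: ndist_def)
    also have "\<dots> = (\<Sum>s\<in>{..<m} \<inter> {..r}. x ^ (r - s)) + (\<Sum>s\<in>{..<m} \<inter> {r..}. x ^ (s - r))"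
      by (simp add: sum.distrib sum.inter_restrict)
    also have "(\<Sum>s\<in>{..<m} \<inter> {..r}. x ^ (r - s)) = (\<Sum>d\<in>(\<lambda>s. r - s) ` ({..<m} \<inter> {..r}). x ^ d)"
      by (subst sum.reindex) (auto simp: inj_on_def)
    also have "\<dots> \<le> (\<Sum>d<Suc r. x ^ d)" using x by (intro sum_mono2) auto
    also have "\<dots> \<le> 3" by (rule geo)
    also have "(\<Sum>s\<in>{..<m} \<inter> {r..}. x ^ (s - r)) = (\<Sum>d\<in>(\<lambda>s. s - r) ` ({..<m} \<inter> {r..}). x ^ d)"
      by (subst sum.reindex) (auto simp: inj_on_def)
    also have "\<dots> \<le> (\<Sum>d<m. x ^ d)" using x by (intro sum_mono2) auto
    also have "\<dots> \<le> 3" by (rule geo)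
    finally show ?thesis by simp
  qed
  have "(\<Sum>r<m. \<Sum>s<m. exp (- (real (ndist r s))\<^sup>2 / 2)) \<le> (\<Sum>r<m. 6)" by (intro sum_mono row)
  then show ?thesis by simp
qed

text \<open>Markov's inequality for the Fejer kernel, which is at least m^2/4 on the small ball.
  Integrating it term by term uses only integer frequencies up to \<open>m\<close> and gives at most
  12 pi m + m^2 e.\<close>

lemma small_ball_of_char:
  fixes g :: "real \<Rightarrow> real"
  assumes g: "continuous_on UNIV g" and m: "1 \<le> m"
    and ch: "\<And>r. r \<le> m \<Longrightarrow> (\<integral>t. cos (real r * g t) \<partial>lb (2*pi)) \<le> 2 * pi * exp (- (real r)\<^sup>2 / 2) + e"
  shows "measure lborel ({t. \<bar>g t\<bar> \<le> 1 / real m} \<inter> {0..2*pi}) \<le> 48 * pi / real m + 4 * e"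
proof -
  define G where "G t = (\<Sum>r<m. \<Sum>s<m. cos (real (ndist r s) * g t))" for t
  have contG: "continuous_on S G" for S unfolding G_def
    by (intro continuous_intros continuous_on_subset[OF g]) auto
  have "G t = (\<Sum>r<m. cos (real r * g t))\<^sup>2 + (\<Sum>r<m. sin (real r * g t))\<^sup>2" for t unfolding G_def by (rule kernel_eq)
  then have G0: "0 \<le> G t" for t by simp
  have m2: "0 < (real m)\<^sup>2 / 4" using m by simp
  have "measure lborel ({t. \<bar>g t\<bar> \<le> 1 / real m} \<inter> {0..2*pi}) \<le> measure lborel {t \<in> {0..2*pi}. (real m)\<^sup>2 / 4 \<le> G t}"
  proof (rule measure_mono_fmeasurable)
    show "{t. \<bar>g t\<bar> \<le> 1 / real m} \<inter> {0..2*pi} \<subseteq> {t \<in> {0..2*pi}. (real m)\<^sup>2 / 4 \<le> G t}"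
      using kernel_ge[OF m] by (auto simp: G_def)
    have "closed ({t. \<bar>g t\<bar> \<le> 1 / real m} \<inter> {0..2*pi})"
      using g by (intro closed_Int closed_Collect_le continuous_intros closed_atLeastAtMost)
    then show "{t. \<bar>g t\<bar> \<le> 1 / real m} \<inter> {0..2*pi} \<in> sets lborel" by simp
    have "closed ({t. (real m)\<^sup>2 / 4 \<le> G t} \<inter> {0..2*pi})"
      by (intro closed_Int closed_Collect_le continuous_intros closed_atLeastAtMost contG)
    moreover have "{t \<in> {0..2*pi}. (real m)\<^sup>2 / 4 \<le> G t} = {0..2*pi} \<inter> ({t. (real m)\<^sup>2 / 4 \<le> G t} \<inter> {0..2*pi})" by auto
    ultimately show "{t \<in> {0..2*pi}. (real m)\<^sup>2 / 4 \<le> G t} \<in> fmeasurable lborel"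
      using compact_Int_closed[OF compact_Icc] by (metis fmeasurable_compact)
  qed
  also have "\<dots> \<le> integral {0..2*pi} G / ((real m)\<^sup>2 / 4)"
    by (intro markov_inequality_Icc contG G0 m2)
  finally have bound: "measure lborel ({t. \<bar>g t\<bar> \<le> 1 / real m} \<inter> {0..2*pi}) \<le> integral {0..2*pi} G / ((real m)\<^sup>2 / 4)" .
  have "integral {0..2*pi} G = (\<integral>t. G t \<partial>lb (2*pi))" by (rule integral_lb(1)[symmetric, OF contG])
  also have "\<dots> = (\<Sum>r<m. \<Sum>s<m. (\<integral>t. cos (real (ndist r s) * g t) \<partial>lb (2*pi)))"
    unfolding G_def using g
    by (subst Bochner_Integration.integral_sum, (intro Bochner_Integration.integrable_sum integral_lb(2) continuous_intros; assumption),
        intro sum.cong refl Bochner_Integration.integral_sum integral_lb(2) continuous_intros)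
  also have "\<dots> \<le> (\<Sum>r<m. \<Sum>s<m. 2 * pi * exp (- (real (ndist r s))\<^sup>2 / 2) + e)"
    by (intro sum_mono ch ndist_le) auto
  also have "\<dots> = 2 * pi * (\<Sum>r<m. \<Sum>s<m. exp (- (real (ndist r s))\<^sup>2 / 2)) + (real m)\<^sup>2 * e"
    by (simp add: sum.distrib sum_distrib_left power2_eq_square)
  also have "\<dots> \<le> 2 * pi * (6 * real m) + (real m)\<^sup>2 * e"
    by (intro add_right_mono mult_left_mono gauss_double_sum) auto
  finally have "integral {0..2*pi} G / ((real m)\<^sup>2 / 4) \<le> (2 * pi * (6 * real m) + (real m)\<^sup>2 * e) / ((real m)\<^sup>2 / 4)"
    using m2 by (intro divide_right_mono) auto
  also have "\<dots> = 48 * pi / real m + 4 * e" using m by (simp add: field_simps power2_eq_square)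
  finally show ?thesis using bound by linarith
qed

section \<open>The limiting covariance\<close>

text \<open>Riemann sums of the integral of cos(d x) over [0, 1]. Multiplying by 2 sin(x/2)
  telescopes the sum into a closed form, which leaves an asymptotic evaluation.\<close>

lemma tendsto_mean_cos:
  assumes d: "0 < d"
  shows "(\<lambda>N. (\<Sum>k=1..N. cos (real k * (d / real N))) / real N) \<longlonglongrightarrow> sin d / d"
proof -
  have tel: "2 * sin (x / 2) * (\<Sum>k=1..N. cos (real k * x)) = sin (real N * x + x / 2) - sin (x / 2)" for N x
  proof (induction N)
    case (Suc N)
    have "2 * sin (x / 2) * cos (real (Suc N) * x) = sin (real (Suc N) * x + x / 2) - sin (real (Suc N) * x - x / 2)"
      by (simp add: sin_add sin_diff)
    moreover have "real (Suc N) * x - x / 2 = real N * x + x / 2" by (simp add: algebra_simps)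
    moreover have "2 * sin (x / 2) * (\<Sum>k=1..Suc N. cos (real k * x)) =
        2 * sin (x / 2) * (\<Sum>k=1..N. cos (real k * x)) + 2 * sin (x / 2) * cos (real (Suc N) * x)"
      by (simp add: distrib_left del: of_nat_Suc)
    ultimately show ?case using Suc by (simp only:)
  qed simp
  have "((\<lambda>N::nat. (sin(d+d/(2*real N)) - sin(d/(2*real N)))/(2*real N* sin(d/(2*real N)))) \<longlongrightarrow> sin d * inverse d) sequentially"
    using d by real_asymp
  then show ?thesis unfolding divide_inverse[of "sin d" d]
  proof (rule Lim_transform_eventually)
    have "\<forall>\<^sub>F N::nat in sequentially. 0 < sin (d / (2 * real N))" using d by real_asymp
    then show "\<forall>\<^sub>F N in sequentially. (sin(d+d/(2*real N)) - sin(d/(2*real N)))/(2*real N* sin(d/(2*real N)))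
      = (\<Sum>k=1..N. cos (real k * (d / real N))) / real N"
      using eventually_gt_at_top[of 0]
    proof eventually_elim
      case (elim N)
      have "2 * sin (d / (2 * real N)) * (\<Sum>k=1..N. cos (real k * (d / real N))) = sin (d + d / (2 * real N)) - sin (d / (2 * real N))"
        using tel[of "d / real N" N] elim by (simp add: mult.commute)
      then show ?case unfolding \<open>_ = sin (d + d / (2 * real N)) - sin (d / (2 * real N))\<close>[symmetric]
        using elim by simp
    qed
  qed
qed

lemma tendsto_pair_var:
  assumes d: "0 < d"
  shows "(\<lambda>N. pair_var \<alpha> \<beta> (d / real N) N) \<longlonglongrightarrow> \<alpha>\<^sup>2 + \<beta>\<^sup>2 + 2 * \<alpha> * \<beta> * (sin d / d)"
proof -
  have "(\<lambda>N. \<alpha>\<^sup>2 + \<beta>\<^sup>2 + 2 * \<alpha> * \<beta> * ((\<Sum>k=1..N. cos (real k * (d / real N))) / real N)) \<longlonglongrightarrow> \<alpha>\<^sup>2 + \<beta>\<^sup>2 + 2 * \<alpha> * \<beta> * (sin d / d)"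
    by (intro tendsto_intros tendsto_mean_cos d)
  then show ?thesis
  proof (rule Lim_transform_eventually)
    show "\<forall>\<^sub>F N in sequentially. \<alpha>\<^sup>2 + \<beta>\<^sup>2 + 2 * \<alpha> * \<beta> * ((\<Sum>k=1..N. cos (real k * (d / real N))) / real N) = pair_var \<alpha> \<beta> (d / real N) N"
      using eventually_gt_at_top[of 0]
      by eventually_elim (simp add: pair_var_def sum.distrib sum_distrib_left[symmetric] add_divide_distrib distrib_left)
  qed
qed

context trig_iid
begin

text \<open>The frequency range is allowed to grow: for m = \<open>freq_bound j\<close>, summing the
  second moments over r <= m costs O(m^5 / j^2), and the threshold 1/m^2 raises this to m^7 / j^2.
  With m^16 <= j the power m^7 is at most sqrt j, leaving the summable j^(-3/2).\<close>

lemma AE_dev_small: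
  "AE \<omega> in M. \<forall>\<^sub>F j in sequentially. \<forall>r\<le>freq_bound j. dev (2*pi) (real r) 0 0 (j^4) \<omega> < 1 / (real (freq_bound j))\<^sup>2"
proof -
  define Y where "Y j \<omega> = (\<Sum>r\<le>freq_bound j. dev (2*pi) (real r) 0 0 (j^4) \<omega>)" for j \<omega>
  define e where "e j = 9216 * K4 * real j powr (- 3 / 2)" for j
  have small: "1 \<le> m \<Longrightarrow> real m ^ 7 \<le> sqrt (real j)" if "m = freq_bound j" "1 \<le> j" for m j
  proof (rule real_le_rsqrt)
    assume m: "1 \<le> m"
    have "(real m ^ 7)\<^sup>2 = real m ^ 14" by (simp flip: power_mult)
    also have "\<dots> \<le> real m ^ 16" using m by (intro power_increasing) auto
    also have "\<dots> \<le> real j" using freq_bound_power that by simp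
    finally show "(real m ^ 7)\<^sup>2 \<le> real j" .
  qed
  have int: "integrable M (dev (2*pi) (real r) 0 0 (j^4))" if "1 \<le> j" for r j
    using that by (intro second_moment_pair(2)) auto
  \<comment> \<open>Integrability is demanded at every index, while
    \<open>second_moment_pair\<close> needs a positive degree; hence the shift to
    \<open>Suc j\<close>.\<close>
  have "AE \<omega> in M. \<forall>\<^sub>F j in sequentially. Y (Suc j) \<omega> < 1 / (real (freq_bound (Suc j)))\<^sup>2"
  proof (rule AE_eventually_less[where e="\<lambda>j. e (Suc j)"])
    show "integrable M (Y (Suc j))" for j unfolding Y_def by (intro Bochner_Integration.integrable_sum int) auto
    show "0 \<le> Y (Suc j) \<omega>" for j \<omega> unfolding Y_def by (intro sum_nonneg dev_nonneg)
    have "summable e" unfolding e_def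
      by (intro summable_mult) (simp add: summable_real_powr_iff)
    then show "summable (\<lambda>j. e (Suc j))" by (subst summable_Suc_iff)
    have "\<forall>\<^sub>F j in sequentially. 1 \<le> freq_bound j" using filterlim_freq_bound by (simp add: filterlim_at_top)
    then have "\<forall>\<^sub>F j in sequentially. 1 \<le> freq_bound (Suc j)" by (subst eventually_sequentially_Suc)
    then show "\<forall>\<^sub>F j in sequentially. 0 < 1 / (real (freq_bound (Suc j)))\<^sup>2 \<and> expectation (Y (Suc j)) \<le> e (Suc j) * (1 / (real (freq_bound (Suc j)))\<^sup>2)"
    proof eventually_elim
      case (elim j')
      define j where "j = Suc j'"
      define m where "m = freq_bound j"
      have j: "1 \<le> j" by (simp add: j_def)
      have m: "1 \<le> m" using elim by (simp add: m_def j_def)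
      have sqj: "sqrt (real (j^4)) = (real j)\<^sup>2" by (rule real_sqrt_unique) (auto simp flip: power_mult)
      have "expectation (Y j) = (\<Sum>r\<le>m. expectation (dev (2*pi) (real r) 0 0 (j^4)))"
        unfolding Y_def m_def by (intro Bochner_Integration.integral_sum int j)
      also have "\<dots> \<le> (\<Sum>r\<le>m. 4608 * K4 * real m ^ 4 / (real j)\<^sup>2)"
      proof (rule sum_mono)
        fix r assume r: "r \<in> {..m}"
        have "expectation (dev (2*pi) (real r) 0 0 (j^4)) \<le> 2304 * K4 * ((real r)\<^sup>2 + real r ^ 4) / (real j)\<^sup>2"
          using second_moment_pair(1)[of "2*pi" "j^4" "real r" 0 0] j unfolding sqj by simp
        also have "\<dots> \<le> 2304 * K4 * (real m ^ 4 + real m ^ 4) / (real j)\<^sup>2"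
        proof (intro divide_right_mono mult_left_mono add_mono)
          have "(real r)\<^sup>2 \<le> (real m)\<^sup>2" using r by (intro power_mono) auto
          also have "\<dots> \<le> real m ^ 4" using m by (intro power_increasing) auto
          finally show "(real r)\<^sup>2 \<le> real m ^ 4" .
          show "real r ^ 4 \<le> real m ^ 4" using r by (intro power_mono) auto
        qed (use K4_pos in auto)
        finally show "expectation (dev (2*pi) (real r) 0 0 (j^4)) \<le> 4608 * K4 * real m ^ 4 / (real j)\<^sup>2" by simp
      qed
      also have "\<dots> = (real m + 1) * (4608 * K4 * real m ^ 4 / (real j)\<^sup>2)" by simp
      also have "\<dots> \<le> (2 * real m) * (4608 * K4 * real m ^ 4 / (real j)\<^sup>2)"
        using m K4_pos by (intro mult_right_mono) auto
      also have "\<dots> = 9216 * K4 * (real m ^ 7) / (real j)\<^sup>2 * (1 / (real m)\<^sup>2)"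
        using m by (simp add: field_simps eval_nat_numeral)
      also have "\<dots> \<le> 9216 * K4 * sqrt (real j) / (real j)\<^sup>2 * (1 / (real m)\<^sup>2)"
        using small[OF m_def j m] K4_pos by (intro mult_right_mono divide_right_mono mult_left_mono) auto
      also have "9216 * K4 * sqrt (real j) / (real j)\<^sup>2 = e j"
      proof -
        have "sqrt (real j) / (real j)\<^sup>2 = real j powr (1/2) / real j powr 2" using j by (simp add: powr_half_sqrt)
        also have "\<dots> = real j powr (1/2 - 2)" by (rule powr_diff[symmetric])
        also have "(1/2 - 2 :: real) = - 3 / 2" by simp
        finally have "sqrt (real j) / (real j)\<^sup>2 = real j powr (- 3 / 2)" .
        then show ?thesis unfolding e_def by (metis times_divide_eq_right)
      qed
      finally show ?case using m by (simp add: m_def j_def)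
    qed
  qed
  then show ?thesis
  proof (rule AE_mp, intro AE_I2 impI)
    fix \<omega> assume "\<forall>\<^sub>F j in sequentially. Y (Suc j) \<omega> < 1 / (real (freq_bound (Suc j)))\<^sup>2"
    then have "\<forall>\<^sub>F j in sequentially. Y j \<omega> < 1 / (real (freq_bound j))\<^sup>2" by (subst (asm) eventually_sequentially_Suc)
    then show "\<forall>\<^sub>F j in sequentially. \<forall>r\<le>freq_bound j. dev (2*pi) (real r) 0 0 (j^4) \<omega> < 1 / (real (freq_bound j))\<^sup>2"
    proof eventually_elim
      case (elim j)
      have "dev (2*pi) (real r) 0 0 (j^4) \<omega> \<le> Y j \<omega>" if "r \<le> freq_bound j" for r
        unfolding Y_def using that by (intro member_le_sum dev_nonneg) auto
      then show ?case using elim by fastforce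
    qed
  qed
qed

lemma pair_continuous: "continuous_on S (pair \<alpha> \<beta> h n \<omega>)"
  unfolding pair_def by (intro continuous_intros f_continuous continuous_on_compose2[OF f_continuous[of UNIV]]) auto

text \<open>\<open>g\<close> stands for cosine or sine. Being 1-Lipschitz, it passes the L1 distance
  of the polynomials on to the characteristic functions; the offset \<open>h\<close> is the same for
  both degrees.\<close>

lemma pair_interpolation:
  assumes reg: "regular \<omega> (fr n)" and q: "0 \<le> q" "q \<le> 2*pi" and g: "continuous_on UNIV g" "\<And>x y. \<bar>g x - g y\<bar> \<le> \<bar>x - y\<bar>"
  shows "\<bar>(\<integral>t. g (pair \<alpha> \<beta> h n \<omega> t) \<partial>lb q) - (\<integral>t. g (pair \<alpha> \<beta> h (fr n ^ 4) \<omega> t) \<partial>lb q)\<bar>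
     \<le> (\<bar>\<alpha>\<bar> + \<bar>\<beta>\<bar>) * (100 / sqrt (real (fr n)))"
proof -
  let ?N = "fr n ^ 4"
  have cg: "continuous_on S (\<lambda>t. g (pair \<alpha> \<beta> h k \<omega> t))" for k S
    by (intro continuous_on_compose2[OF g(1)] pair_continuous) auto
  have cf: "continuous_on S (\<lambda>t. f k \<omega> (t + s))" for k s S
    by (intro continuous_intros continuous_on_compose2[OF f_continuous[of UNIV]]) auto
  have "\<bar>(\<integral>t. g (pair \<alpha> \<beta> h n \<omega> t) \<partial>lb q) - (\<integral>t. g (pair \<alpha> \<beta> h ?N \<omega> t) \<partial>lb q)\<bar>
     = \<bar>integral {0..q} (\<lambda>t. g (pair \<alpha> \<beta> h n \<omega> t) - g (pair \<alpha> \<beta> h ?N \<omega> t))\<bar>"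
    using cg by (simp add: integral_lb(1) integral_diff integrable_continuous_real)
  also have "\<dots> \<le> integral {0..q} (\<lambda>t. \<bar>\<alpha>\<bar> * \<bar>f n \<omega> (t + 0) - f ?N \<omega> (t + 0)\<bar> + \<bar>\<beta>\<bar> * \<bar>f n \<omega> (t + h) - f ?N \<omega> (t + h)\<bar>)"
    unfolding real_norm_def[symmetric]
  proof (rule integral_norm_bound_integral, unfold real_norm_def)
    fix t
    have "\<bar>g (pair \<alpha> \<beta> h n \<omega> t) - g (pair \<alpha> \<beta> h ?N \<omega> t)\<bar> \<le> \<bar>\<alpha> * (f n \<omega> t - f ?N \<omega> t) + \<beta> * (f n \<omega> (t + h) - f ?N \<omega> (t + h))\<bar>"
      using g(2)[of "pair \<alpha> \<beta> h n \<omega> t" "pair \<alpha> \<beta> h ?N \<omega> t"] by (simp add: pair_def algebra_simps)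
    also have "\<dots> \<le> \<bar>\<alpha>\<bar> * \<bar>f n \<omega> t - f ?N \<omega> t\<bar> + \<bar>\<beta>\<bar> * \<bar>f n \<omega> (t + h) - f ?N \<omega> (t + h)\<bar>"
      unfolding abs_mult[symmetric] by (rule abs_triangle_ineq)
    finally show "\<bar>g (pair \<alpha> \<beta> h n \<omega> t) - g (pair \<alpha> \<beta> h ?N \<omega> t)\<bar> \<le>
       \<bar>\<alpha>\<bar> * \<bar>f n \<omega> (t + 0) - f ?N \<omega> (t + 0)\<bar> + \<bar>\<beta>\<bar> * \<bar>f n \<omega> (t + h) - f ?N \<omega> (t + h)\<bar>" by simp
  qed (intro integrable_continuous_real continuous_intros cg cf)+
  also have "\<dots> \<le> integral {0..2*pi} (\<lambda>t. \<bar>\<alpha>\<bar> * \<bar>f n \<omega> (t + 0) - f ?N \<omega> (t + 0)\<bar> + \<bar>\<beta>\<bar> * \<bar>f n \<omega> (t + h) - f ?N \<omega> (t + h)\<bar>)"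
    using q by (intro integral_subset_le) (auto intro!: integrable_continuous_real continuous_intros cf f_continuous)
  also have "\<dots> = \<bar>\<alpha>\<bar> * integral {0..2*pi} (\<lambda>t. \<bar>f n \<omega> (t + 0) - f ?N \<omega> (t + 0)\<bar>) + \<bar>\<beta>\<bar> * integral {0..2*pi} (\<lambda>t. \<bar>f n \<omega> (t + h) - f ?N \<omega> (t + h)\<bar>)"
    by (subst integral_add) (auto intro!: integrable_continuous_real continuous_intros cf f_continuous)
  also have "\<dots> \<le> \<bar>\<alpha>\<bar> * (100 / sqrt (real (fr n))) + \<bar>\<beta>\<bar> * (100 / sqrt (real (fr n)))"
    by (intro add_mono mult_left_mono L1_interpolation reg) auto
  finally show ?thesis unfolding distrib_right .
qed

end

section \<open>Almost sure small ball estimates and the central limit theorem\<close>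

text \<open>Each frequency pair has its own null set, so only countably many can be treated at once.
  A Lipschitz bound uniform in \<open>n\<close> carries the limits from rational to real
  frequencies.\<close>

lemma tendsto_from_rationals:
  fixes F :: "nat \<Rightarrow> real \<Rightarrow> real \<Rightarrow> real"
  assumes rat: "\<And>a b. a \<in> \<rat> \<Longrightarrow> b \<in> \<rat> \<Longrightarrow> (\<lambda>n. F n a b) \<longlonglongrightarrow> V a b"
    and lip: "\<forall>\<^sub>F n in sequentially. \<forall>a b a' b'. \<bar>F n a b - F n a' b'\<bar> \<le> K * (\<bar>a - a'\<bar> + \<bar>b - b'\<bar>)"
    and V: "continuous_on UNIV (\<lambda>p. V (fst p) (snd p))" and K: "0 < K"
  shows "(\<lambda>n. F n a b) \<longlonglongrightarrow> V a b"
proof (rule tendstoI)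
  fix e :: real assume e: "0 < e"
  obtain d where d: "0 < d" "\<And>p. dist p (a, b) < d \<Longrightarrow> dist (V (fst p) (snd p)) (V a b) < e / 3"
    using V e unfolding continuous_on_iff by (metis UNIV_I divide_pos_pos fst_conv snd_conv zero_less_numeral)
  define \<eta> where "\<eta> = min (d / 2) (e / (6 * K))"
  have \<eta>: "0 < \<eta>" "2 * \<eta> \<le> d" "K * (2 * \<eta>) \<le> e / 3"
  proof -
    show "0 < \<eta>" "2 * \<eta> \<le> d" using d e K by (auto simp: \<eta>_def)
    have "\<eta> \<le> e / (6 * K)" by (simp add: \<eta>_def)
    then show "K * (2 * \<eta>) \<le> e / 3" using K by (simp add: field_simps)
  qed
  obtain a' where a': "a' \<in> \<rat>" "a < a'" "a' < a + \<eta>" using Rats_dense_in_real[of a "a + \<eta>"] \<eta> by auto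
  obtain b' where b': "b' \<in> \<rat>" "b < b'" "b' < b + \<eta>" using Rats_dense_in_real[of b "b + \<eta>"] \<eta> by auto
  have "dist (a', b') (a, b) \<le> \<bar>a' - a\<bar> + \<bar>b' - b\<bar>"
    unfolding dist_Pair_Pair dist_real_def using sqrt_sum_squares_le_sum_abs[of "\<bar>a'-a\<bar>" "\<bar>b'-b\<bar>"] by simp
  then have "dist (a', b') (a, b) < d" using a' b' \<eta> by linarith
  then have V3: "\<bar>V a' b' - V a b\<bar> < e / 3" using d(2)[of "(a', b')"] by (simp add: dist_real_def)
  have "\<forall>\<^sub>F n in sequentially. dist (F n a' b') (V a' b') < e / 3"
    using tendstoD[OF rat[OF a'(1) b'(1)], of "e/3"] e by simp
  then show "\<forall>\<^sub>F n in sequentially. dist (F n a b) (V a b) < e"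
    using lip
  proof eventually_elim
    case (elim n)
    have "\<bar>F n a b - F n a' b'\<bar> \<le> K * (\<bar>a - a'\<bar> + \<bar>b - b'\<bar>)" using elim(2) by blast
    also have "\<dots> \<le> K * (2 * \<eta>)" using a' b' K by (intro mult_left_mono) auto
    finally have "\<bar>F n a b - F n a' b'\<bar> \<le> e / 3" using \<eta> by linarith
    then show ?case using elim(1) V3 unfolding dist_real_def by linarith
  qed
qed

lemma abs_cos_diff_le: "\<bar>cos x - cos y\<bar> \<le> \<bar>x - y\<bar>" for x y :: real
proof -
  have "\<bar>cos x - cos y\<bar> = 2 * \<bar>sin ((x + y) / 2)\<bar> * \<bar>sin ((y - x) / 2)\<bar>"
    by (simp add: cos_diff_cos abs_mult)
  also have "\<dots> \<le> 2 * 1 * \<bar>(y - x) / 2\<bar>" by (intro mult_mono abs_sin_x_le_abs_x) auto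
  finally show ?thesis by simp
qed

lemma abs_sin_diff_le: "\<bar>sin x - sin y\<bar> \<le> \<bar>x - y\<bar>" for x y :: real
  using abs_cos_diff_le[of "x - pi/2" "y - pi/2"] by (simp add: cos_diff)

lemma cont_cos: "continuous_on UNIV (cos :: real \<Rightarrow> real)"
  and cont_sin: "continuous_on UNIV (sin :: real \<Rightarrow> real)"
  by (intro continuous_on_cos continuous_on_sin continuous_on_id)+

context trig_iid
begin

text \<open>\<open>small_ball_of_char\<close> with \<open>alpha = r\<close> and no second point. The
  error 101/m0, with m0 = \<open>freq_bound (fr n)\<close>, consists of 1/m0 from
  \<open>AE_dev_small\<close> and 100/m0 from interpolation, where r <= m0 and m0^2 <= sqrt j are
  used. The total 600 is 196, which exceeds 48 pi, plus 404.\<close>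

lemma AE_small_ball:
  "AE \<omega> in M. \<forall>\<^sub>F n in sequentially. \<forall>m. 1 \<le> m \<and> m \<le> freq_bound (fr n) \<longrightarrow>
     measure lborel ({t. \<bar>f n \<omega> t\<bar> \<le> 1 / real m} \<inter> {0..2*pi}) \<le> 600 / real m"
  using AE_dev_small AE_regular
proof eventually_elim
  case (elim \<omega>)
  have "\<forall>\<^sub>F n in sequentially. (\<forall>r\<le>freq_bound (fr n). dev (2*pi) (real r) 0 0 (fr n^4) \<omega> < 1 / (real (freq_bound (fr n)))\<^sup>2) \<and> regular \<omega> (fr n)"
    using eventually_compose_filterlim[OF eventually_conj[OF elim] filterlim_fr] by simp
  then show ?case
  proof eventually_elim
    case (elim n)
    define j where "j = fr n"
    define m0 where "m0 = freq_bound j"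
    have j: "2 \<le> j" using elim by (simp add: regular_def j_def)
    show ?case
    proof (intro allI impI, elim conjE)
      fix m assume m: "1 \<le> m" "m \<le> freq_bound (fr n)"
      then have m0: "m \<le> m0" "1 \<le> m0" by (auto simp: m0_def j_def)
      have "real m0 ^ 4 \<le> real m0 ^ 16" using m0 by (intro power_increasing) auto
      also have "\<dots> \<le> real j" using freq_bound_power[of j] j by (simp add: m0_def)
      finally have m04: "real m0 ^ 4 \<le> real j" .
      have sq: "(real m0)\<^sup>2 \<le> sqrt (real j)"
      proof (rule real_le_rsqrt)
        have "((real m0)\<^sup>2)\<^sup>2 = real m0 ^ 4" by (simp flip: power_mult)
        then show "((real m0)\<^sup>2)\<^sup>2 \<le> real j" using m04 by simp
      qed
      have ch: "(\<integral>t. cos (real r * f n \<omega> t) \<partial>lb (2*pi)) \<le> 2 * pi * exp (- (real r)\<^sup>2 / 2) + 101 / real m0" if r: "r \<le> m" for r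
      proof -
        have p: "pair (real r) 0 0 k \<omega> t = real r * f k \<omega> t" for k t by (simp add: pair_def)
        have pv: "pair_var (real r) 0 0 (j^4) = (real r)\<^sup>2" using j by (simp add: pair_var_def)
        have "((\<integral>t. cos (real r * f (j^4) \<omega> t) \<partial>lb (2*pi)) - exp (- (real r)\<^sup>2 / 2) * (2*pi))\<^sup>2 \<le> dev (2*pi) (real r) 0 0 (j^4) \<omega>"
          unfolding dev_def p pv by simp
        also have "\<dots> \<le> (1 / real m0)\<^sup>2" using elim r m0 by (auto simp: j_def m0_def power_divide less_imp_le)
        finally have "\<bar>(\<integral>t. cos (real r * f (j^4) \<omega> t) \<partial>lb (2*pi)) - exp (- (real r)\<^sup>2 / 2) * (2*pi)\<bar> \<le> 1 / real m0"
          using m0 by (simp only: abs_le_square_iff[symmetric]) simp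
        moreover have "\<bar>(\<integral>t. cos (real r * f n \<omega> t) \<partial>lb (2*pi)) - (\<integral>t. cos (real r * f (j^4) \<omega> t) \<partial>lb (2*pi))\<bar> \<le> real r * (100 / sqrt (real j))"
          using pair_interpolation[of \<omega> n "2*pi" cos "real r" 0 0] elim abs_cos_diff_le
          unfolding p by (simp add: j_def cont_cos)
        moreover have "real r * (100 / sqrt (real j)) \<le> 100 / real m0"
        proof -
          have "real r * (100 / sqrt (real j)) \<le> real m0 * (100 / (real m0)\<^sup>2)"
            using r m0 sq j by (intro mult_mono divide_left_mono) auto
          also have "\<dots> = 100 / real m0" using m0 by (simp add: power2_eq_square)
          finally show ?thesis .
        qed
        ultimately have "(\<integral>t. cos (real r * f n \<omega> t) \<partial>lb (2*pi)) \<le> exp (- (real r)\<^sup>2 / 2) * (2*pi) + (1 / real m0 + 100 / real m0)" by linarith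
        also have "1 / real m0 + 100 / real m0 = 101 / real m0" by (simp flip: add_divide_distrib)
        finally show ?thesis by (simp add: mult.commute)
      qed
      have "measure lborel ({t. \<bar>f n \<omega> t\<bar> \<le> 1 / real m} \<inter> {0..2*pi}) \<le> 48 * pi / real m + 4 * (101 / real m0)"
        by (rule small_ball_of_char[OF f_continuous m(1) ch])
      also have "\<dots> \<le> 196 / real m + 4 * (101 / real m)"
        using m0 m pi_less_4 by (intro add_mono mult_left_mono divide_left_mono divide_right_mono) auto
      also have "\<dots> = 600 / real m" by (simp flip: add_divide_distrib)
      finally show "measure lborel ({t. \<bar>f n \<omega> t\<bar> \<le> 1 / real m} \<inter> {0..2*pi}) \<le> 600 / real m" .
    qed
  qed
qed

lemma pair_lipschitz:
  assumes reg: "regular \<omega> (fr n)" and q: "0 \<le> q" "q \<le> 2*pi" and g: "continuous_on UNIV g" "\<And>x y. \<bar>g x - g y\<bar> \<le> \<bar>x - y\<bar>"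
  shows "\<bar>(\<integral>t. g (pair \<alpha> \<beta> h n \<omega> t) \<partial>lb q) - (\<integral>t. g (pair \<alpha>' \<beta>' h n \<omega> t) \<partial>lb q)\<bar>
     \<le> 48 * (\<bar>\<alpha> - \<alpha>'\<bar> + \<bar>\<beta> - \<beta>'\<bar>)"
proof -
  have cg: "continuous_on S (\<lambda>t. g (pair \<alpha> \<beta> h n \<omega> t))" for \<alpha> \<beta> S
    by (intro continuous_on_compose2[OF g(1)] pair_continuous) auto
  have cf: "continuous_on S (\<lambda>t. f k \<omega> (t + s))" for k s S
    by (intro continuous_intros continuous_on_compose2[OF f_continuous[of UNIV]]) auto
  have "\<bar>(\<integral>t. g (pair \<alpha> \<beta> h n \<omega> t) \<partial>lb q) - (\<integral>t. g (pair \<alpha>' \<beta>' h n \<omega> t) \<partial>lb q)\<bar>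
     = \<bar>integral {0..q} (\<lambda>t. g (pair \<alpha> \<beta> h n \<omega> t) - g (pair \<alpha>' \<beta>' h n \<omega> t))\<bar>"
    using cg by (simp add: integral_lb(1) integral_diff integrable_continuous_real)
  also have "\<dots> \<le> integral {0..q} (\<lambda>t. \<bar>\<alpha> - \<alpha>'\<bar> * \<bar>f n \<omega> (t + 0)\<bar> + \<bar>\<beta> - \<beta>'\<bar> * \<bar>f n \<omega> (t + h)\<bar>)"
    unfolding real_norm_def[symmetric]
  proof (rule integral_norm_bound_integral, unfold real_norm_def)
    fix t
    have "\<bar>g (pair \<alpha> \<beta> h n \<omega> t) - g (pair \<alpha>' \<beta>' h n \<omega> t)\<bar> \<le> \<bar>(\<alpha> - \<alpha>') * f n \<omega> t + (\<beta> - \<beta>') * f n \<omega> (t + h)\<bar>"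
      using g(2)[of "pair \<alpha> \<beta> h n \<omega> t" "pair \<alpha>' \<beta>' h n \<omega> t"] by (simp add: pair_def algebra_simps)
    also have "\<dots> \<le> \<bar>\<alpha> - \<alpha>'\<bar> * \<bar>f n \<omega> t\<bar> + \<bar>\<beta> - \<beta>'\<bar> * \<bar>f n \<omega> (t + h)\<bar>"
      unfolding abs_mult[symmetric] by (rule abs_triangle_ineq)
    finally show "\<bar>g (pair \<alpha> \<beta> h n \<omega> t) - g (pair \<alpha>' \<beta>' h n \<omega> t)\<bar> \<le>
       \<bar>\<alpha> - \<alpha>'\<bar> * \<bar>f n \<omega> (t + 0)\<bar> + \<bar>\<beta> - \<beta>'\<bar> * \<bar>f n \<omega> (t + h)\<bar>" by simp
  qed (intro integrable_continuous_real continuous_intros cg cf)+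
  also have "\<dots> \<le> integral {0..2*pi} (\<lambda>t. \<bar>\<alpha> - \<alpha>'\<bar> * \<bar>f n \<omega> (t + 0)\<bar> + \<bar>\<beta> - \<beta>'\<bar> * \<bar>f n \<omega> (t + h)\<bar>)"
    using q by (intro integral_subset_le) (auto intro!: integrable_continuous_real continuous_intros cf f_continuous)
  also have "\<dots> = \<bar>\<alpha> - \<alpha>'\<bar> * integral {0..2*pi} (\<lambda>t. \<bar>f n \<omega> (t + 0)\<bar>) + \<bar>\<beta> - \<beta>'\<bar> * integral {0..2*pi} (\<lambda>t. \<bar>f n \<omega> (t + h)\<bar>)"
    by (subst integral_add) (auto intro!: integrable_continuous_real continuous_intros cf f_continuous)
  also have "\<dots> \<le> \<bar>\<alpha> - \<alpha>'\<bar> * 48 + \<bar>\<beta> - \<beta>'\<bar> * 48"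
    by (intro add_mono mult_left_mono L1_f reg) auto
  finally show ?thesis by (simp add: distrib_left mult.commute)
qed

text \<open>The denominator is the fourth power rather than \<open>n\<close>, so the cell length is
  the same for \<open>n\<close> and for the fourth power it is compared with; interpolation then
  never has to vary the shift.\<close>

definition mesh :: "real \<Rightarrow> nat \<Rightarrow> real" where
  "mesh d n = d / real (fr n ^ 4)"

text \<open>Here the frequencies are fixed, so along j^4 the second moments are O(j^(-2)). The
  threshold j^(-1/2) tends to zero and still leaves a summable j^(-3/2).\<close>

lemma AE_dev_tendsto:
  assumes q: "0 \<le> q" "q \<le> 2*pi"
  shows "AE \<omega> in M. (\<lambda>j. dev q \<alpha> \<beta> (d / real (j^4)) (j^4) \<omega>) \<longlonglongrightarrow> 0"
proof -
  define C where "C = 2304 * K4 * ((\<bar>\<alpha>\<bar> + \<bar>\<beta>\<bar>)\<^sup>2 + (\<bar>\<alpha>\<bar> + \<bar>\<beta>\<bar>) ^ 4)"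
  have "AE \<omega> in M. \<forall>\<^sub>F j in sequentially. dev q \<alpha> \<beta> (d / real (Suc j^4)) (Suc j^4) \<omega> < real (Suc j) powr (- 1 / 2)"
  proof (rule AE_eventually_less[where e="\<lambda>j. C * real (Suc j) powr (- 3 / 2)"])
    show "integrable M (dev q \<alpha> \<beta> (d / real (Suc j ^ 4)) (Suc j ^ 4))" for j
      using q by (intro second_moment_pair(2)) auto
    have "summable (\<lambda>j. C * real j powr (- 3 / 2))" by (intro summable_mult) (simp add: summable_real_powr_iff)
    then show "summable (\<lambda>j. C * real (Suc j) powr (- 3 / 2))" by (subst summable_Suc_iff)
    have "expectation (dev q \<alpha> \<beta> (d / real (Suc j^4)) (Suc j^4)) \<le> C * real (Suc j) powr (- 3 / 2) * real (Suc j) powr (- 1 / 2)" for j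
    proof -
      have sqj: "sqrt (real (Suc j^4)) = (real (Suc j))\<^sup>2" by (rule real_sqrt_unique) (auto simp flip: power_mult)
      have "expectation (dev q \<alpha> \<beta> (d / real (Suc j^4)) (Suc j^4)) \<le> C / (real (Suc j))\<^sup>2"
        using second_moment_pair(1)[OF q, of "Suc j ^ 4" \<alpha> \<beta> "d / real (Suc j^4)"] unfolding sqj C_def by simp
      also have "\<dots> = C * real (Suc j) powr (- 2)" by (simp add: powr_minus divide_inverse)
      also have "real (Suc j) powr (- 2) = real (Suc j) powr (- 3 / 2) * real (Suc j) powr (- 1 / 2)"
        unfolding powr_add[symmetric] by simp
      finally show ?thesis by (simp only: mult.assoc)
    qed
    then show "\<forall>\<^sub>F j in sequentially. 0 < real (Suc j) powr (- 1 / 2) \<and>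
        expectation (dev q \<alpha> \<beta> (d / real (Suc j^4)) (Suc j^4)) \<le> C * real (Suc j) powr (- 3 / 2) * real (Suc j) powr (- 1 / 2)"
      by (intro always_eventually allI conjI) simp_all
  qed (rule dev_nonneg)
  then show ?thesis
  proof (rule AE_mp, intro AE_I2 impI)
    fix \<omega> assume *: "\<forall>\<^sub>F j in sequentially. dev q \<alpha> \<beta> (d / real (Suc j^4)) (Suc j^4) \<omega> < real (Suc j) powr (- 1 / 2)"
    have "(\<lambda>j. dev q \<alpha> \<beta> (d / real (Suc j^4)) (Suc j^4) \<omega>) \<longlonglongrightarrow> 0"
    proof (rule tendsto_sandwich[OF _ _ tendsto_const])
      show "(\<lambda>j. real (Suc j) powr (- 1 / 2)) \<longlonglongrightarrow> 0" by real_asymp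
    qed (use * in \<open>auto simp: dev_nonneg elim!: eventually_mono\<close>)
    then show "(\<lambda>j. dev q \<alpha> \<beta> (d / real (j^4)) (j^4) \<omega>) \<longlonglongrightarrow> 0" by (rule LIMSEQ_imp_Suc)
  qed
qed

text \<open>The limit holds along fourth powers for rational frequencies, where \<open>dev\<close>
  tends to 0 and the variance converges. It passes to all degrees by
  \<open>pair_interpolation\<close> and to all real frequencies by the uniform Lipschitz bound
  \<open>pair_lipschitz\<close>, so one null set serves every pair.\<close>

lemma AE_clt:
  assumes q: "0 \<le> q" "q \<le> 2*pi" and d: "0 < d"
  shows "AE \<omega> in M. \<forall>\<alpha> \<beta>.
     (\<lambda>n. \<integral>t. cos (pair \<alpha> \<beta> (mesh d n) n \<omega> t) \<partial>lb q) \<longlonglongrightarrow> q * exp (- (\<alpha>\<^sup>2 + \<beta>\<^sup>2 + 2 * \<alpha> * \<beta> * (sin d / d)) / 2) \<and>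
     (\<lambda>n. \<integral>t. sin (pair \<alpha> \<beta> (mesh d n) n \<omega> t) \<partial>lb q) \<longlonglongrightarrow> 0"
proof -
  have "AE \<omega> in M. \<forall>\<alpha>\<in>\<rat>. \<forall>\<beta>\<in>\<rat>. (\<lambda>j. dev q \<alpha> \<beta> (d / real (j^4)) (j^4) \<omega>) \<longlonglongrightarrow> 0"
  proof (subst AE_ball_countable[OF countable_rat], rule ballI)
    fix \<alpha> :: real
    show "AE \<omega> in M. \<forall>\<beta>\<in>\<rat>. (\<lambda>j. dev q \<alpha> \<beta> (d / real (j^4)) (j^4) \<omega>) \<longlonglongrightarrow> 0"
      by (subst AE_ball_countable[OF countable_rat], rule ballI) (rule AE_dev_tendsto[OF q])
  qed
  then show ?thesis using AE_regular
  proof eventually_elim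
    case (elim \<omega>)
    have reg: "\<forall>\<^sub>F n in sequentially. regular \<omega> (fr n)"
      using eventually_compose_filterlim[OF elim(2) filterlim_fr] .
    have j4: "filterlim (\<lambda>j::nat. j ^ 4) at_top sequentially"
      by (intro filterlim_subseq strict_monoI power_strict_mono) auto
    have isq: "(\<lambda>n. (\<bar>\<alpha>\<bar> + \<bar>\<beta>\<bar>) * (100 / sqrt (real (fr n)))) \<longlonglongrightarrow> 0" for \<alpha> \<beta> :: real
    proof -
      have "((\<lambda>j::nat. (\<bar>\<alpha>\<bar> + \<bar>\<beta>\<bar>) * (100 / sqrt (real j))) \<longlongrightarrow> 0) sequentially" by real_asymp
      then show ?thesis by (rule filterlim_compose[OF _ filterlim_fr])
    qed
    have rat: "(\<lambda>n. \<integral>t. cos (pair \<alpha> \<beta> (mesh d n) n \<omega> t) \<partial>lb q) \<longlonglongrightarrow> q * exp (- (\<alpha>\<^sup>2 + \<beta>\<^sup>2 + 2 * \<alpha> * \<beta> * (sin d / d)) / 2)"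
      "(\<lambda>n. \<integral>t. sin (pair \<alpha> \<beta> (mesh d n) n \<omega> t) \<partial>lb q) \<longlonglongrightarrow> 0"
      if "\<alpha> \<in> \<rat>" "\<beta> \<in> \<rat>" for \<alpha> \<beta>
    proof -
      let ?h = "\<lambda>j. d / real (j^4)"
      have dv: "(\<lambda>j. sqrt (dev q \<alpha> \<beta> (?h j) (j^4) \<omega>)) \<longlonglongrightarrow> 0"
        using tendsto_real_sqrt[of "\<lambda>j. dev q \<alpha> \<beta> (?h j) (j^4) \<omega>" 0 sequentially] elim(1) that by simp
      have c0: "(\<lambda>j. (\<integral>t. cos (pair \<alpha> \<beta> (?h j) (j^4) \<omega> t) \<partial>lb q) - exp (- pair_var \<alpha> \<beta> (?h j) (j^4) / 2) * q) \<longlonglongrightarrow> 0"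
        by (rule Lim_null_comparison[OF _ dv]) (auto simp: dev_def intro!: always_eventually real_le_rsqrt)
      have s0: "(\<lambda>j. (\<integral>t. sin (pair \<alpha> \<beta> (?h j) (j^4) \<omega> t) \<partial>lb q)) \<longlonglongrightarrow> 0"
        by (rule Lim_null_comparison[OF _ dv]) (auto simp: dev_def intro!: always_eventually real_le_rsqrt)
      have pv: "(\<lambda>j. pair_var \<alpha> \<beta> (?h j) (j^4)) \<longlonglongrightarrow> \<alpha>\<^sup>2 + \<beta>\<^sup>2 + 2 * \<alpha> * \<beta> * (sin d / d)"
        using filterlim_compose[OF tendsto_pair_var[OF d] j4] .
      have "(\<lambda>j. ((\<integral>t. cos (pair \<alpha> \<beta> (?h j) (j^4) \<omega> t) \<partial>lb q) - exp (- pair_var \<alpha> \<beta> (?h j) (j^4) / 2) * q) + exp (- pair_var \<alpha> \<beta> (?h j) (j^4) / 2) * q)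
         \<longlonglongrightarrow> 0 + exp (- (\<alpha>\<^sup>2 + \<beta>\<^sup>2 + 2 * \<alpha> * \<beta> * (sin d / d)) / 2) * q"
        by (intro tendsto_intros c0 pv) auto
      then have "(\<lambda>j. \<integral>t. cos (pair \<alpha> \<beta> (?h j) (j^4) \<omega> t) \<partial>lb q) \<longlonglongrightarrow> q * exp (- (\<alpha>\<^sup>2 + \<beta>\<^sup>2 + 2 * \<alpha> * \<beta> * (sin d / d)) / 2)"
        by (simp add: mult.commute)
      then have c1: "(\<lambda>n. \<integral>t. cos (pair \<alpha> \<beta> (mesh d n) (fr n^4) \<omega> t) \<partial>lb q) \<longlonglongrightarrow> q * exp (- (\<alpha>\<^sup>2 + \<beta>\<^sup>2 + 2 * \<alpha> * \<beta> * (sin d / d)) / 2)"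
        unfolding mesh_def by (rule filterlim_compose[OF _ filterlim_fr])
      have s1: "(\<lambda>n. \<integral>t. sin (pair \<alpha> \<beta> (mesh d n) (fr n^4) \<omega> t) \<partial>lb q) \<longlonglongrightarrow> 0"
        unfolding mesh_def by (rule filterlim_compose[OF s0 filterlim_fr])
      have "(\<lambda>n. (\<integral>t. cos (pair \<alpha> \<beta> (mesh d n) n \<omega> t) \<partial>lb q) - (\<integral>t. cos (pair \<alpha> \<beta> (mesh d n) (fr n^4) \<omega> t) \<partial>lb q)) \<longlonglongrightarrow> 0"
        by (rule Lim_null_comparison[OF _ isq[of \<alpha> \<beta>]])
          (use reg in \<open>eventually_elim, use pair_interpolation[OF _ q cont_cos abs_cos_diff_le] in \<open>simp\<close>\<close>)
      from tendsto_add[OF this c1]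
      show "(\<lambda>n. \<integral>t. cos (pair \<alpha> \<beta> (mesh d n) n \<omega> t) \<partial>lb q) \<longlonglongrightarrow> q * exp (- (\<alpha>\<^sup>2 + \<beta>\<^sup>2 + 2 * \<alpha> * \<beta> * (sin d / d)) / 2)" by simp
      have "(\<lambda>n. (\<integral>t. sin (pair \<alpha> \<beta> (mesh d n) n \<omega> t) \<partial>lb q) - (\<integral>t. sin (pair \<alpha> \<beta> (mesh d n) (fr n^4) \<omega> t) \<partial>lb q)) \<longlonglongrightarrow> 0"
        by (rule Lim_null_comparison[OF _ isq[of \<alpha> \<beta>]])
          (use reg in \<open>eventually_elim, use pair_interpolation[OF _ q cont_sin abs_sin_diff_le] in \<open>simp\<close>\<close>)
      from tendsto_add[OF this s1]
      show "(\<lambda>n. \<integral>t. sin (pair \<alpha> \<beta> (mesh d n) n \<omega> t) \<partial>lb q) \<longlonglongrightarrow> 0" by simp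
    qed
    show ?case
    proof (intro allI conjI)
      fix \<alpha> \<beta>
      show "(\<lambda>n. \<integral>t. cos (pair \<alpha> \<beta> (mesh d n) n \<omega> t) \<partial>lb q) \<longlonglongrightarrow> q * exp (- (\<alpha>\<^sup>2 + \<beta>\<^sup>2 + 2 * \<alpha> * \<beta> * (sin d / d)) / 2)"
      proof (rule tendsto_from_rationals[where K=48 and F="\<lambda>n \<alpha> \<beta>. \<integral>t. cos (pair \<alpha> \<beta> (mesh d n) n \<omega> t) \<partial>lb q"])
        show "continuous_on UNIV (\<lambda>p. q * exp (- ((fst p)\<^sup>2 + (snd p)\<^sup>2 + 2 * fst p * snd p * (sin d / d)) / 2))"
          by (intro continuous_intros) auto
        show "\<forall>\<^sub>F n in sequentially. \<forall>a b a' b'. \<bar>(\<integral>t. cos (pair a b (mesh d n) n \<omega> t) \<partial>lb q) - (\<integral>t. cos (pair a' b' (mesh d n) n \<omega> t) \<partial>lb q)\<bar> \<le> 48 * (\<bar>a - a'\<bar> + \<bar>b - b'\<bar>)"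
          using reg by eventually_elim (intro allI pair_lipschitz q cont_cos abs_cos_diff_le)
      qed (use rat in auto)
      show "(\<lambda>n. \<integral>t. sin (pair \<alpha> \<beta> (mesh d n) n \<omega> t) \<partial>lb q) \<longlonglongrightarrow> 0"
      proof (rule tendsto_from_rationals[where K=48 and F="\<lambda>n \<alpha> \<beta>. \<integral>t. sin (pair \<alpha> \<beta> (mesh d n) n \<omega> t) \<partial>lb q" and V="\<lambda>_ _. 0"])
        show "\<forall>\<^sub>F n in sequentially. \<forall>a b a' b'. \<bar>(\<integral>t. sin (pair a b (mesh d n) n \<omega> t) \<partial>lb q) - (\<integral>t. sin (pair a' b' (mesh d n) n \<omega> t) \<partial>lb q)\<bar> \<le> 48 * (\<bar>a - a'\<bar> + \<bar>b - b'\<bar>)"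
          using reg by eventually_elim (intro allI pair_lipschitz q cont_sin abs_sin_diff_le)
      qed (use rat in auto)
    qed
  qed
qed

end

section \<open>The density of zeros\<close>

text \<open>For a standard Gaussian pair \<open>(U, V)\<close> with correlation \<open>sin d / d\<close>, the event \<open>U V \<le> 0\<close> is
  \<open>|S| \<le> slope d |D|\<close>, where \<open>S\<close> and \<open>D\<close> are the independent normalised sum and difference.\<close>

definition slope :: "real \<Rightarrow> real" where
  "slope d = sqrt ((1 - sin d / d) / (1 + sin d / d))"

lemma sinc_bounds:
  fixes d :: real
  assumes "0 < d" "d \<le> 1" shows "0 < sin d / d" "sin d / d < 1"
proof -
  have "0 < sin d" using sin_gt_zero[of d] assms pi_gt3 by simp
  moreover have "sin d < d"
  proof -
    have "cos (d / 2) < cos 0" using assms pi_gt3 by (intro cos_monotone_0_pi) auto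
    moreover have "0 < sin (d / 2)" using sin_gt_zero[of "d / 2"] assms pi_gt3 by simp
    ultimately have "sin (d / 2) * cos (d / 2) < sin (d / 2) * 1" by (intro mult_strict_left_mono) auto
    moreover have "sin (d / 2) \<le> d / 2" using assms by (intro sin_x_le_x) auto
    moreover have "sin d = 2 * (sin (d / 2) * cos (d / 2))" using sin_double[of "d / 2"] by simp
    ultimately show ?thesis by linarith
  qed
  ultimately show "0 < sin d / d" "sin d / d < 1" using assms by auto
qed

lemma tendsto_ratio_fr: "(\<lambda>n. real (fr n ^ 4) / real n) \<longlonglongrightarrow> 1"
proof (rule tendsto_sandwich[OF _ _ tendsto_const])
  have f2: "\<forall>\<^sub>F n in sequentially. 2 \<le> fr n" using filterlim_fr by (simp add: filterlim_at_top)
  show "\<forall>\<^sub>F n in sequentially. 1 \<le> real (fr n ^ 4) / real n"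
    using eventually_gt_at_top[of 0]
  proof eventually_elim
    case (elim n)
    have "real n \<le> real (fr n ^ 4)" using fr_ge[of n] by (simp only: of_nat_le_iff)
    then show ?case using elim by simp
  qed
  show "\<forall>\<^sub>F n in sequentially. real (fr n ^ 4) / real n \<le> real (fr n) ^ 4 / (real (fr n) - 1) ^ 4"
    using f2
  proof eventually_elim
    case (elim n)
    have "(fr n - 1) ^ 4 < n" using elim fr_gt by simp
    then have "real ((fr n - 1) ^ 4) \<le> real n" by linarith
    then have le: "(real (fr n) - 1) ^ 4 \<le> real n" using elim by (simp add: of_nat_diff)
    have "0 < (real (fr n) - 1) ^ 4" using elim by simp
    moreover have "0 < real n" using calculation le by linarith
    ultimately have "real (fr n) ^ 4 / real n \<le> real (fr n) ^ 4 / (real (fr n) - 1) ^ 4"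
      using le by (intro divide_left_mono mult_pos_pos) auto
    then show ?case by simp
  qed
  have "((\<lambda>j::nat. real j ^ 4 / (real j - 1) ^ 4) \<longlongrightarrow> 1) sequentially" by real_asymp
  then show "(\<lambda>n. real (fr n) ^ 4 / (real (fr n) - 1) ^ 4) \<longlonglongrightarrow> 1" by (rule filterlim_compose[OF _ filterlim_fr])
qed

text \<open>More zeros than this in a cell of length \<open>mesh (1 / l^3) n\<close> would force \<open>f n\<close> to be smaller on a whole window
  than \<open>AE_not_small_on_windows\<close> allows.\<close>

definition cell_bound :: "nat \<Rightarrow> nat \<Rightarrow> nat" where
  "cell_bound l n = nat \<lceil>64 * pi * real l ^ 3 * real (logsq n) + 2 * ln (real n)\<rceil>"

lemma cell_bound_le:
  assumes "1 \<le> n"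
  shows "real (cell_bound l n) \<le> 64 * pi * real l ^ 3 * ((ln (real n))\<^sup>2 + 1) + 2 * ln (real n) + 1"
proof -
  have ln0: "0 \<le> ln (real n)" using assms by simp
  have "real (logsq n) \<le> (ln (real n))\<^sup>2 + 1" unfolding logsq_def by (simp add: of_nat_nat)
  then have "64 * pi * real l ^ 3 * real (logsq n) \<le> 64 * pi * real l ^ 3 * ((ln (real n))\<^sup>2 + 1)"
    by (intro mult_left_mono) auto
  moreover have "real (cell_bound l n) \<le> 64 * pi * real l ^ 3 * real (logsq n) + 2 * ln (real n) + 1"
    unfolding cell_bound_def using ln0 by (simp add: of_nat_nat)
  ultimately show ?thesis by linarith
qed

text \<open>Small balls reach down to 1/\<open>freq_bound (fr n)\<close>, roughly n^(-1/64) because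
  (n^(1/4))^(1/16) = n^(1/64). The worst count per cell, of order (ln n)^2 for fixed l, is
  negligible against this power, so cells beyond the controlled levels contribute nothing in the
  limit.\<close>

lemma tendsto_cell_bound:
  "(\<lambda>n. real (cell_bound l n) / real n) \<longlonglongrightarrow> 0"
  "(\<lambda>n. real (cell_bound l n) / real (freq_bound (fr n))) \<longlonglongrightarrow> 0"
proof -
  define c where "c = 64 * pi * real l ^ 3"
  have le: "real (cell_bound l n) \<le> c * ((ln (real n))\<^sup>2 + 1) + 2 * ln (real n) + 1" if "1 \<le> n" for n
    using cell_bound_le[OF that] by (simp add: c_def)
  show "(\<lambda>n. real (cell_bound l n) / real n) \<longlonglongrightarrow> 0"
  proof (rule tendsto_sandwich[OF _ _ tendsto_const])
    show "((\<lambda>n::nat. (c * ((ln (real n))\<^sup>2 + 1) + 2 * ln (real n) + 1) / real n) \<longlongrightarrow> 0) sequentially" by real_asymp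
    show "\<forall>\<^sub>F n in sequentially. real (cell_bound l n) / real n \<le> (c * ((ln (real n))\<^sup>2 + 1) + 2 * ln (real n) + 1) / real n"
      using eventually_ge_at_top[of 1] by eventually_elim (intro divide_right_mono le, auto)
  qed auto
  show "(\<lambda>n. real (cell_bound l n) / real (freq_bound (fr n))) \<longlonglongrightarrow> 0"
  proof (rule tendsto_sandwich[OF _ _ tendsto_const])
    show "((\<lambda>n::nat. (c * ((ln (real n))\<^sup>2 + 1) + 2 * ln (real n) + 1) / (real n powr (1 / 64) - 1)) \<longlongrightarrow> 0) sequentially" by real_asymp
    have "\<forall>\<^sub>F n::nat in sequentially. 0 < real n powr (1 / 64) - 1" by real_asymp
    then show "\<forall>\<^sub>F n in sequentially. real (cell_bound l n) / real (freq_bound (fr n)) \<le> (c * ((ln (real n))\<^sup>2 + 1) + 2 * ln (real n) + 1) / (real n powr (1 / 64) - 1)"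
      using eventually_ge_at_top[of 1]
    proof eventually_elim
      case (elim n)
      have "real n \<le> real (fr n) ^ 4" using fr_ge[of n] by (metis of_nat_le_iff of_nat_power)
      then have "real n powr (1 / 64) \<le> (real (fr n) ^ 4) powr (1 / 64)" using elim by (intro powr_mono2) auto
      also have "\<dots> = real (fr n) powr (1 / 16)"
      proof (cases "fr n = 0")
        case False
        then have "real (fr n) ^ 4 = real (fr n) powr real 4" by (subst powr_realpow) auto
        then show ?thesis by (simp only: powr_powr) simp
      qed simp
      also have "\<dots> - 1 \<le> real (freq_bound (fr n))" unfolding freq_bound_def by (simp add: of_nat_nat)
      finally have fb: "real n powr (1 / 64) - 1 \<le> real (freq_bound (fr n))" by simp
      have "real (cell_bound l n) / real (freq_bound (fr n)) \<le> real (cell_bound l n) / (real n powr (1 / 64) - 1)"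
        using fb elim by (intro divide_left_mono) auto
      also have "\<dots> \<le> (c * ((ln (real n))\<^sup>2 + 1) + 2 * ln (real n) + 1) / (real n powr (1 / 64) - 1)"
        using le[of n] elim by (intro divide_right_mono) auto
      finally show ?case .
    qed
  qed auto
qed

context trig_iid
begin

definition clt :: "real \<Rightarrow> real \<Rightarrow> 'w \<Rightarrow> bool" where
  "clt q d \<omega> \<longleftrightarrow> (\<forall>\<alpha> \<beta>.
     (\<lambda>n. \<integral>t. cos (pair \<alpha> \<beta> (mesh d n) n \<omega> t) \<partial>lb q) \<longlonglongrightarrow> q * exp (- (\<alpha>\<^sup>2 + \<beta>\<^sup>2 + 2 * \<alpha> * \<beta> * (sin d / d)) / 2) \<and>
     (\<lambda>n. \<integral>t. sin (pair \<alpha> \<beta> (mesh d n) n \<omega> t) \<partial>lb q) \<longlonglongrightarrow> 0)"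

definition sign_changes :: "nat \<Rightarrow> 'w \<Rightarrow> real \<Rightarrow> real set" where
  "sign_changes n \<omega> h = {t. f n \<omega> t * f n \<omega> (t + h) \<le> 0}"

text \<open>Dividing the sum and the difference of the two values by sqrt(2(1 + rho)) and sqrt(2(1 -
  rho)) gives asymptotically independent standard normals. A product u v is nonpositive exactly when
  |u + v| <= |u - v|, so the sign change event is a ratio event with ratio b / a.\<close>

lemma
  assumes clt: "clt q d \<omega>" and q: "0 < q" and d: "0 < d" "d \<le> 1"
  shows sign_changes_upper: "0 < e \<Longrightarrow> \<forall>\<^sub>F n in sequentially.
      measure lborel (sign_changes n \<omega> (mesh d n) \<inter> {0..q}) \<le> q * (2 / pi * slope d) + e"
    and sign_changes_lower: "0 < e \<Longrightarrow> 1 \<le> N \<Longrightarrow> slope d * real N \<le> 1 \<Longrightarrow> \<forall>\<^sub>F n in sequentially.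
      q * (sqrt (2 / pi) * slope d * (1 - (slope d * real N)\<^sup>2 / 2) * (sqrt (2 / pi) - 2 / real N)) - e
      \<le> measure lborel (sign_changes n \<omega> (mesh d n) \<inter> {0..q})"
proof -
  define \<rho> where "\<rho> = sin d / d"
  have \<rho>: "0 < \<rho>" "\<rho> < 1" using sinc_bounds[OF d] by (auto simp: \<rho>_def)
  define a where "a = sqrt (2 * (1 + \<rho>))"
  define b where "b = sqrt (2 * (1 - \<rho>))"
  have ab: "0 < a" "0 < b" "a\<^sup>2 = 2 * (1 + \<rho>)" "b\<^sup>2 = 2 * (1 - \<rho>)" using \<rho> by (auto simp: a_def b_def)
  have r: "slope d = b / a"
  proof -
    have "(1 - \<rho>) / (1 + \<rho>) = (2 * (1 - \<rho>)) / (2 * (1 + \<rho>))" by (rule mult_divide_mult_cancel_left[symmetric]) simp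
    then show ?thesis by (simp only: slope_def a_def b_def \<rho>_def[symmetric] real_sqrt_divide)
  qed
  have r0: "0 < slope d" using r ab by simp
  define S where "S n t = (f n \<omega> t + f n \<omega> (t + mesh d n)) / a" for n t
  define D where "D n t = (f n \<omega> t - f n \<omega> (t + mesh d n)) / b" for n t
  have cf: "continuous_on X (\<lambda>t. f n \<omega> (t + s))" for X n s
    by (intro continuous_on_compose2[OF f_continuous[of UNIV]] continuous_intros) auto
  have meas: "S n \<in> borel_measurable (lb q)" "D n \<in> borel_measurable (lb q)" for n
    unfolding S_def[abs_def] D_def[abs_def] using ab
    by (intro borel_lb continuous_intros f_continuous cf; simp)+
  have m: "measure (lb q) (space (lb q)) = q" using q by (intro measure_lb) simp
  have lin: "\<alpha> * S n t + \<beta> * D n t = pair (\<alpha> / a + \<beta> / b) (\<alpha> / a - \<beta> / b) (mesh d n) n \<omega> t" for \<alpha> \<beta> n t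
    by (simp add: S_def D_def pair_def add_divide_distrib diff_divide_distrib algebra_simps)
  \<comment> \<open>The substitution diagonalises the limiting quadratic form: the cross term
    disappears, which is asymptotic independence of \<open>S\<close> and \<open>D\<close>.\<close>
  have quad: "(\<alpha> / a + \<beta> / b)\<^sup>2 + (\<alpha> / a - \<beta> / b)\<^sup>2 + 2 * (\<alpha> / a + \<beta> / b) * (\<alpha> / a - \<beta> / b) * \<rho> = \<alpha>\<^sup>2 + \<beta>\<^sup>2" for \<alpha> \<beta>
  proof -
    have "(x + y)\<^sup>2 + (x - y)\<^sup>2 + 2 * (x + y) * (x - y) * \<rho> = x\<^sup>2 * (2 * (1 + \<rho>)) + y\<^sup>2 * (2 * (1 - \<rho>))" for x y :: real
      by (simp add: power2_eq_square algebra_simps)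
    from this[of "\<alpha> / a" "\<beta> / b"] have "(\<alpha> / a + \<beta> / b)\<^sup>2 + (\<alpha> / a - \<beta> / b)\<^sup>2 + 2 * (\<alpha> / a + \<beta> / b) * (\<alpha> / a - \<beta> / b) * \<rho>
        = (\<alpha> / a)\<^sup>2 * a\<^sup>2 + (\<beta> / b)\<^sup>2 * b\<^sup>2" by (simp only: ab(3,4))
    also have "\<dots> = \<alpha>\<^sup>2 + \<beta>\<^sup>2" using ab(1,2) by (simp add: power_divide)
    finally show ?thesis .
  qed
  have c: "(\<lambda>n. \<integral>t. cos (\<alpha> * S n t + \<beta> * D n t) \<partial>lb q) \<longlonglongrightarrow> q * exp (- (\<alpha>\<^sup>2 + \<beta>\<^sup>2) / 2)"
    and s: "(\<lambda>n. \<integral>t. sin (\<alpha> * S n t + \<beta> * D n t) \<partial>lb q) \<longlonglongrightarrow> 0" for \<alpha> \<beta>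
  proof -
    have *: "(\<lambda>n. \<integral>t. cos (pair (\<alpha> / a + \<beta> / b) (\<alpha> / a - \<beta> / b) (mesh d n) n \<omega> t) \<partial>lb q) \<longlonglongrightarrow>
        q * exp (- ((\<alpha> / a + \<beta> / b)\<^sup>2 + (\<alpha> / a - \<beta> / b)\<^sup>2 + 2 * (\<alpha> / a + \<beta> / b) * (\<alpha> / a - \<beta> / b) * (sin d / d)) / 2)"
      "(\<lambda>n. \<integral>t. sin (pair (\<alpha> / a + \<beta> / b) (\<alpha> / a - \<beta> / b) (mesh d n) n \<omega> t) \<partial>lb q) \<longlonglongrightarrow> 0"
      using clt unfolding clt_def by blast+
    show "(\<lambda>n. \<integral>t. cos (\<alpha> * S n t + \<beta> * D n t) \<partial>lb q) \<longlonglongrightarrow> q * exp (- (\<alpha>\<^sup>2 + \<beta>\<^sup>2) / 2)"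
      using *(1) unfolding lin \<rho>_def[symmetric] quad .
    show "(\<lambda>n. \<integral>t. sin (\<alpha> * S n t + \<beta> * D n t) \<partial>lb q) \<longlonglongrightarrow> 0"
      using *(2) unfolding lin .
  qed
  have G: "(\<lambda>n. measure (lb q) {x \<in> space (lb q). \<bar>S n x\<bar> \<le> a' \<and> \<bar>D n x\<bar> \<le> b'}) \<longlonglongrightarrow> q * Phi a' * Phi b'"
    if "0 \<le> a'" "0 \<le> b'" for a' b'
    using joint_levy[OF finite_measure_lb m q meas c s that] .
  \<comment> \<open>The marginal is not among the cases of \<open>G\<close>, where |S| is bounded by
    a finite number; it comes from the one-dimensional theorem with weight 1.\<close>
  have H: "(\<lambda>n. measure (lb q) {x \<in> space (lb q). \<bar>D n x\<bar> \<le> b'}) \<longlonglongrightarrow> q * Phi b'" if "0 \<le> b'" for b'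
  proof -
    have "(\<lambda>n. \<integral>x. (1::real) * indicat_real {-b'..b'} (D n x) \<partial>lb q) \<longlonglongrightarrow> q * Phi b'"
      using c[of 0] s[of 0] m q meas finite_measure_lb
      by (intro weighted_levy[where B=1 and w="\<lambda>_ _. 1"]) auto
    moreover have "(\<integral>x. (1::real) * indicat_real {-b'..b'} (D n x) \<partial>lb q) = measure (lb q) {x \<in> space (lb q). \<bar>D n x\<bar> \<le> b'}" for n
    proof -
      have "(\<integral>x. (1::real) * indicat_real {-b'..b'} (D n x) \<partial>lb q) = (\<integral>x. indicator {x \<in> space (lb q). \<bar>D n x\<bar> \<le> b'} x \<partial>lb q)"
        by (intro Bochner_Integration.integral_cong) (auto simp: indicator_def abs_le_iff)
      also have "\<dots> = measure (lb q) ({x \<in> space (lb q). \<bar>D n x\<bar> \<le> b'} \<inter> space (lb q))" by simp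
      finally show ?thesis by (simp add: Int_def conj_commute conj_left_commute)
    qed
    ultimately show ?thesis by simp
  qed
  have event: "measure (lb q) {x \<in> space (lb q). \<bar>S n x\<bar> \<le> slope d * \<bar>D n x\<bar>} = measure lborel (sign_changes n \<omega> (mesh d n) \<inter> {0..q})" for n
  proof -
    have "\<bar>S n t\<bar> \<le> slope d * \<bar>D n t\<bar> \<longleftrightarrow> f n \<omega> t * f n \<omega> (t + mesh d n) \<le> 0" for t
    proof -
      define u v where "u = f n \<omega> t" and "v = f n \<omega> (t + mesh d n)"
      have "\<bar>S n t\<bar> \<le> slope d * \<bar>D n t\<bar> \<longleftrightarrow> \<bar>u + v\<bar> / a \<le> \<bar>u - v\<bar> / a"
        using ab by (simp add: S_def D_def r u_def v_def)
      also have "\<dots> \<longleftrightarrow> \<bar>u + v\<bar> \<le> \<bar>u - v\<bar>" using ab by (simp add: divide_le_cancel)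
      also have "\<dots> \<longleftrightarrow> (u + v)\<^sup>2 \<le> (u - v)\<^sup>2" by (rule abs_le_square_iff)
      also have "\<dots> \<longleftrightarrow> u * v \<le> 0" by (simp add: power2_eq_square algebra_simps)
      finally show ?thesis by (simp add: u_def v_def)
    qed
    then have "{x \<in> space (lb q). \<bar>S n x\<bar> \<le> slope d * \<bar>D n x\<bar>} = sign_changes n \<omega> (mesh d n) \<inter> {0..q}"
      by (auto simp: space_lb sign_changes_def)
    then show ?thesis by (simp add: measure_restrict_space)
  qed
  show "\<forall>\<^sub>F n in sequentially. measure lborel (sign_changes n \<omega> (mesh d n) \<inter> {0..q}) \<le> q * (2 / pi * slope d) + e" if "0 < e"
    using ratio_event_upper[OF finite_measure_lb m q meas G H r0 that] unfolding event .
  show "\<forall>\<^sub>F n in sequentially.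
      q * (sqrt (2 / pi) * slope d * (1 - (slope d * real N)\<^sup>2 / 2) * (sqrt (2 / pi) - 2 / real N)) - e
      \<le> measure lborel (sign_changes n \<omega> (mesh d n) \<inter> {0..q})" if "0 < e" "1 \<le> N" "slope d * real N \<le> 1"
    using ratio_event_lower[OF finite_measure_lb m q meas G H r0 that] unfolding event .
qed

lemma phase_form:
  obtains r p where "\<And>t. f n \<omega> t = phase_poly r p n 0 t" "\<And>k. (r k)\<^sup>2 = sq \<omega> k / real n"
proof -
  have "\<forall>k. \<exists>r p. \<forall>x. (X (Inl k) \<omega> / sqrt (real n)) * cos x + (X (Inr k) \<omega> / sqrt (real n)) * sin x = r * cos (x + p)
      \<and> r\<^sup>2 = (X (Inl k) \<omega> / sqrt (real n))\<^sup>2 + (X (Inr k) \<omega> / sqrt (real n))\<^sup>2"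
    using phase_exists by blast
  then obtain r p where rp: "\<And>k x. (X (Inl k) \<omega> / sqrt (real n)) * cos x + (X (Inr k) \<omega> / sqrt (real n)) * sin x = r k * cos (x + p k)"
      "\<And>k. (r k)\<^sup>2 = (X (Inl k) \<omega> / sqrt (real n))\<^sup>2 + (X (Inr k) \<omega> / sqrt (real n))\<^sup>2"
    by metis
  have "f n \<omega> t = (\<Sum>k=1..n. (X (Inl k) \<omega> / sqrt (real n)) * cos (real k * t) + (X (Inr k) \<omega> / sqrt (real n)) * sin (real k * t))" for t
    by (simp add: f_def trig_poly_def sum_divide_distrib add_divide_distrib)
  then have "f n \<omega> t = phase_poly r p n 0 t" for t unfolding rp(1) by (simp add: phase_poly_def)
  moreover have "(r k)\<^sup>2 = sq \<omega> k / real n" for k by (simp add: rp(2) power_divide sq_def add_divide_distrib)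
  ultimately show ?thesis using that by blast
qed

definition spread_out :: "'w \<Rightarrow> bool" where
  "spread_out \<omega> \<longleftrightarrow> (\<forall>\<^sub>F n in sequentially. \<forall>t\<in>{0..2*pi}.
     \<exists>u. \<bar>u - t\<bar> \<le> 4 * pi * real (logsq n) / real n \<and> 1 / (16 * sqrt (real n)) < \<bar>f n \<omega> u\<bar>)"

text \<open>With \<open>n * h <= 1/8\<close>, a cell holding \<open>k = cell_bound l n\<close> zeros
  would by \<open>many_zeros_small\<close> force |f(u)| <= (n + 64) exp(|u - t|/h - k) at the point
  u supplied by \<open>spread_out\<close>. There |u - t|/h is at most the first summand of
  \<open>cell_bound\<close>, and the summand 2 ln n leaves (n + 64)/n^2, below 1/(16 sqrt n) for
  large n.\<close>

lemma few_zeros_in_cells: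
  assumes sp: "spread_out \<omega>" and reg: "\<forall>\<^sub>F j in sequentially. regular \<omega> j" and l: "2 \<le> l"
  shows "\<forall>\<^sub>F n in sequentially. \<forall>t\<in>{0..2*pi}. finite {z \<in> {t..t + mesh (1 / real l ^ 3) n}. f n \<omega> z = 0} \<and>
     card {z \<in> {t..t + mesh (1 / real l ^ 3) n}. f n \<omega> z = 0} \<le> cell_bound l n"
proof -
  have reg': "\<forall>\<^sub>F n in sequentially. regular \<omega> (fr n)"
    using eventually_compose_filterlim[OF reg filterlim_fr] .
  have as: "\<forall>\<^sub>F n::nat in sequentially. (real n + 64) / (real n)\<^sup>2 < 1 / (16 * sqrt (real n))" by real_asymp
  show ?thesis using sp[unfolded spread_out_def] reg' as
  proof eventually_elim
    case (elim n)
    define h where "h = mesh (1 / real l ^ 3) n"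
    define k where "k = cell_bound l n"
    have n: "1 \<le> n" "real (fr n ^ 4) \<le> 16 * real n" "(\<Sum>k=1..n. sq \<omega> k) \<le> 64 * real n"
      using sum_sq_le[OF elim(2)] by auto
    have nle: "real n \<le> real (fr n ^ 4)" using fr_ge[of n] by (simp only: of_nat_le_iff)
    have fr0: "0 < real (fr n ^ 4)" using nle n by linarith
    have l3: "8 \<le> real l ^ 3" using l power_mono[of 2 "real l" 3] by simp
    have h: "0 < h" "1 / h = real l ^ 3 * real (fr n ^ 4)" 
    proof -
      have "0 < real l ^ 3 * real (fr n ^ 4)" using fr0 l by (intro mult_pos_pos) auto
      then show "0 < h" "1 / h = real l ^ 3 * real (fr n ^ 4)" by (simp_all add: h_def mesh_def)
    qed
    have nh: "real n * h \<le> 1 / 8" "0 \<le> real n * h"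
    proof -
      have "real n * h = (real n / real (fr n ^ 4)) / real l ^ 3" by (simp add: h_def mesh_def)
      also have "\<dots> \<le> 1 / real l ^ 3" using nle fr0 l3 by (intro divide_right_mono) auto
      also have "\<dots> \<le> 1 / 8" using l3 l by (intro divide_left_mono) auto
      finally show "real n * h \<le> 1 / 8" .
    qed (use h in auto)
    have no: False if t: "t \<in> {0..2*pi}" and Z: "finite Z" "Z \<subseteq> {z \<in> {t..t + h}. f n \<omega> z = 0}" "card Z = k" for t Z
    proof -
      obtain r p where rp: "\<And>t. f n \<omega> t = phase_poly r p n 0 t" "\<And>k. (r k)\<^sup>2 = sq \<omega> k / real n"
        using phase_form by blast
      define B where "B = (\<Sum>k=1..n. \<bar>r k\<bar>)"
      have "B \<le> (\<Sum>k=1..n. 1 + (r k)\<^sup>2)" unfolding B_def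
      proof (rule sum_mono)
        fix k
        have "0 \<le> (\<bar>r k\<bar> - 1)\<^sup>2 + (r k)\<^sup>2 + 1" by simp
        then show "\<bar>r k\<bar> \<le> 1 + (r k)\<^sup>2" by (simp add: power2_diff)
      qed
      also have "\<dots> = real n + (\<Sum>k=1..n. sq \<omega> k) / real n" by (simp add: rp sum.distrib sum_divide_distrib)
      also have "\<dots> \<le> real n + 64" using n by (simp add: field_simps)
      finally have B: "B \<le> real n + 64" "0 \<le> B" by (auto simp: B_def sum_nonneg)
      obtain u where u: "\<bar>u - t\<bar> \<le> 4 * pi * real (logsq n) / real n" "1 / (16 * sqrt (real n)) < \<bar>f n \<omega> u\<bar>"
        using elim(1) t by blast
      have ex: "\<bar>u - t\<bar> / h \<le> 64 * pi * real l ^ 3 * real (logsq n)"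
      proof -
        have "\<bar>u - t\<bar> / h = \<bar>u - t\<bar> * (1 / h)" by simp
        also have "\<dots> \<le> (4 * pi * real (logsq n) / real n) * (real l ^ 3 * (16 * real n))"
          unfolding h(2) using u n by (intro mult_mono mult_left_mono) auto
        also have "\<dots> = 64 * pi * real l ^ 3 * real (logsq n)" using n by simp
        finally show ?thesis .
      qed
      have kk: "64 * pi * real l ^ 3 * real (logsq n) + 2 * ln (real n) \<le> real k"
        unfolding k_def cell_bound_def by linarith
      have "\<bar>f n \<omega> u\<bar> \<le> B * (real n * h) ^ k * exp (\<bar>u - t\<bar> / h)"
        unfolding rp(1)
        by (rule many_zeros_small[where F="phase_poly r p n" and Z=Z])
          (use Z h phase_poly_bound[of r p n] in \<open>auto simp: B_def rp(1) intro: phase_poly_deriv\<close>)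
      also have "\<dots> \<le> (real n + 64) * exp (- real k) * exp (64 * pi * real l ^ 3 * real (logsq n))"
      proof (intro mult_mono)
        have "(real n * h) ^ k \<le> (1 / 8) ^ k" using nh by (intro power_mono) auto
        also have "\<dots> \<le> exp (- 1) ^ k"
        proof (rule power_mono)
          have "inverse 8 \<le> inverse (exp (1::real))" using exp_le by (intro le_imp_inverse_le) auto
          then show "1 / 8 \<le> exp (- 1 :: real)" by (simp add: exp_minus inverse_eq_divide)
        qed auto
        also have "\<dots> = exp (- real k)" using exp_of_nat_mult[of k "-1::real"] by simp
        finally show "(real n * h) ^ k \<le> exp (- real k)" .
      qed (use B ex nh in auto)
      also have "\<dots> = (real n + 64) * exp (64 * pi * real l ^ 3 * real (logsq n) - real k)"
        by (simp add: exp_diff exp_minus field_simps)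
      also have "\<dots> \<le> (real n + 64) * exp (- (2 * ln (real n)))"
        using kk by (intro mult_left_mono) auto
      also have "exp (- (2 * ln (real n))) = 1 / (real n)\<^sup>2"
        using n exp_of_nat_mult[of 2 "ln (real n)"] by (simp add: exp_minus inverse_eq_divide)
      finally show False using u(2) elim(3) by simp
    qed
    show ?case unfolding h_def[symmetric] k_def[symmetric]
    proof
      fix t assume t: "t \<in> {0..2*pi}"
      let ?Z = "{z \<in> {t..t + h}. f n \<omega> z = 0}"
      have fin: "finite ?Z"
      proof (rule ccontr)
        assume "infinite ?Z"
        then obtain Z where "finite Z" "card Z = k" "Z \<subseteq> ?Z" using infinite_arbitrarily_large by blast
        then show False using no[OF t] by blast
      qed
      moreover have "card ?Z \<le> k"
      proof (rule ccontr)
        assume "\<not> card ?Z \<le> k"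
        then have "k \<le> card ?Z" by simp
        then obtain Z where "Z \<subseteq> ?Z" "card Z = k" "finite Z" by (rule obtain_subset_with_card_n)
        then show False using no[OF t] by blast
      qed
      ultimately show "finite ?Z \<and> card ?Z \<le> k" by blast
    qed
  qed
qed

end

section \<open>The density on initial intervals\<close>

text \<open>1 - sin d / d behaves like d^2/6 and 1 + sin d / d tends to 2, so \<open>slope d\<close>
  is asymptotic to d / sqrt 12. With d = l^(-3) the product \<open>slope d * l\<close> still
  vanishes; this allows l itself as the grid size in the lower ratio bound.\<close>

lemma tendsto_slope:
  "(\<lambda>l::nat. real l ^ 3 * slope (1 / real l ^ 3)) \<longlonglongrightarrow> sqrt (1 / 12)"
  "(\<lambda>l::nat. slope (1 / real l ^ 3) * real l) \<longlonglongrightarrow> 0"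
proof -
  have "(\<lambda>l::nat. real l ^ 3 * slope (1 / real l ^ 3)) \<longlonglongrightarrow> (1 / 12) powr (1 / 2)"
    unfolding slope_def by real_asymp
  then show 1: "(\<lambda>l::nat. real l ^ 3 * slope (1 / real l ^ 3)) \<longlonglongrightarrow> sqrt (1 / 12)"
    by (simp add: powr_half_sqrt)
  have "(\<lambda>l::nat. 1 / (real l)\<^sup>2) \<longlonglongrightarrow> 0" by real_asymp
  from tendsto_mult[OF 1 this]
  have "(\<lambda>l::nat. real l ^ 3 * slope (1 / real l ^ 3) * (1 / (real l)\<^sup>2)) \<longlonglongrightarrow> 0" by simp
  then show "(\<lambda>l::nat. slope (1 / real l ^ 3) * real l) \<longlonglongrightarrow> 0"
  proof (rule Lim_transform_eventually)
    show "\<forall>\<^sub>F l in sequentially. real l ^ 3 * slope (1 / real l ^ 3) * (1 / (real l)\<^sup>2) = slope (1 / real l ^ 3) * real l"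
      using eventually_gt_at_top[of 0] by eventually_elim (simp add: power2_eq_square power3_eq_cube)
  qed
qed

lemma density_constant: "2 / pi * sqrt (1 / 12) = 1 / (pi * sqrt 3)"
proof -
  have "sqrt 12 = 2 * sqrt 3" using real_sqrt_mult[of 4 3] by simp
  then show ?thesis by (simp add: real_sqrt_divide)
qed

context trig_iid
begin

definition zeros :: "nat \<Rightarrow> 'w \<Rightarrow> real \<Rightarrow> real set" where
  "zeros n \<omega> q = {z \<in> {0..q}. f n \<omega> z = 0}"

definition small_balls :: "'w \<Rightarrow> bool" where
  "small_balls \<omega> \<longleftrightarrow> (\<forall>\<^sub>F n in sequentially. \<forall>m. 1 \<le> m \<and> m \<le> freq_bound (fr n) \<longrightarrow>
     measure lborel ({t. \<bar>f n \<omega> t\<bar> \<le> 1 / real m} \<inter> {0..2*pi}) \<le> 600 / real m)"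

text \<open>With y = l^(-2), level k uses the threshold y^k. Since n h <= l^(-3) = y^(3/2), the
  Parseval term (n h)^(2k) / y^(2k) is at most y^k, the same order as the small ball. The levels
  from 2 on sum to O(y^2) = O(l^(-4)), which is of smaller order than the main term of order
  l^(-3).\<close>

lemma card_zeros_bound:
  assumes reg: "regular \<omega> (fr n)" and l: "2 \<le> l" and q: "0 \<le> q" "q \<le> 2*pi"
    and cells: "\<forall>t\<in>{0..2*pi}. finite {z \<in> {t..t + mesh (1 / real l ^ 3) n}. f n \<omega> z = 0} \<and>
       card {z \<in> {t..t + mesh (1 / real l ^ 3) n}. f n \<omega> z = 0} \<le> k0"
    and balls: "\<forall>m. 1 \<le> m \<and> m \<le> m0 \<longrightarrow> measure lborel ({t. \<bar>f n \<omega> t\<bar> \<le> 1 / real m} \<inter> {0..2*pi}) \<le> 600 / real m"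
    and m0: "l ^ 6 \<le> m0"
  shows "mesh (1 / real l ^ 3) n * real (card (zeros n \<omega> q)) \<le> mesh (1 / real l ^ 3) n * real k0
     + measure lborel (sign_changes n \<omega> (mesh (1 / real l ^ 3) n) \<inter> {0..q})
     + 2700 / real l ^ 4 + 900 * real k0 * (real l)\<^sup>2 / real m0"
proof -
  define h where "h = mesh (1 / real l ^ 3) n"
  define y where "y = 1 / (real l)\<^sup>2"
  obtain r p where rp: "\<And>t. f n \<omega> t = phase_poly r p n 0 t" "\<And>k. (r k)\<^sup>2 = sq \<omega> k / real n"
    using phase_form by blast
  let ?F = "phase_poly r p n"
  have n: "1 \<le> n" "(\<Sum>k=1..n. sq \<omega> k) \<le> 64 * real n" using sum_sq_le[OF reg] by auto
  have V: "(\<Sum>j=1..n. (r j)\<^sup>2) \<le> 64" unfolding rp(2) using n by (simp add: sum_divide_distrib[symmetric] field_simps)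
  have nle: "real n \<le> real (fr n ^ 4)" using fr_ge[of n] by (simp only: of_nat_le_iff)
  have fr0: "0 < real (fr n ^ 4)" using nle n by linarith
  have l0: "0 < real l" using l by simp
  have h: "0 < h" using fr0 l0 by (simp add: h_def mesh_def)
  have nh: "real n * h \<le> 1 / real l ^ 3"
  proof -
    have "real n * h = (real n / real (fr n ^ 4)) / real l ^ 3" by (simp add: h_def mesh_def)
    also have "\<dots> \<le> 1 / real l ^ 3" using nle fr0 l0 by (intro divide_right_mono) auto
    finally show ?thesis .
  qed
  have "4 \<le> (real l)\<^sup>2" using l power_mono[of 2 "real l" 2] by simp
  then have y: "0 < y" "y \<le> 1 / 4" unfolding y_def using l0 by (auto intro!: divide_left_mono)
  have "2 \<le> l\<^sup>2" using l power_mono[of 2 l 2] by simp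
  moreover have m01: "1 \<le> m0" using m0 l by (metis le_trans one_le_power one_le_numeral)
  \<comment> \<open>\<open>k1\<close> is the deepest level whose threshold l^(-2k) is still at least
    1/m0, so the small ball hypothesis applies. Maximality makes y^k1 at most l^2/m0, which pays for
    the factor \<open>k0\<close>.\<close>
  ultimately obtain k1 where k1: "(l\<^sup>2) ^ k1 \<le> m0" "m0 < (l\<^sup>2) ^ (k1 + 1)" using ex_power_ivl1[of "l\<^sup>2" m0] by blast
  have "2 \<le> k1"
  proof (rule ccontr)
    assume "\<not> 2 \<le> k1"
    then have "(l\<^sup>2) ^ (k1 + 1) \<le> (l\<^sup>2) ^ 2" using l by (intro power_increasing) auto
    also have "\<dots> = l ^ 4" by (simp flip: power_mult)
    also have "\<dots> \<le> l ^ 6" using l by (intro power_increasing) auto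
    finally show False using k1(2) m0 by simp
  qed
  have bad: "measure lborel (bad_set ?F h k \<inter> {0..q}) \<le> 900 * y ^ k" if k: "1 \<le> k" "k \<le> k1" for k
  proof -
    define m where "m = (l\<^sup>2) ^ k"
    have "m \<le> (l\<^sup>2) ^ k1" unfolding m_def using k l by (intro power_increasing) auto
    then have m: "1 \<le> m" "m \<le> m0" using k1 l by (auto simp: m_def)
    have ym: "1 / real m = y ^ k" by (simp add: m_def y_def power_divide)
    have cont: "continuous_on S (?F j)" for S j
      using deriv_family_continuous[of ?F, OF phase_poly_deriv] .
    have "measure lborel (bad_set ?F h k \<inter> {0..q}) \<le> measure lborel (bad_set ?F h k \<inter> {0..2*pi})"
    proof (rule measure_mono_fmeasurable)
      show "bad_set ?F h k \<inter> {0..q} \<in> sets lborel" using bad_set_borel[of ?F h k] cont by auto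
      show "bad_set ?F h k \<inter> {0..2*pi} \<in> fmeasurable lborel"
        using bad_set_borel[of ?F h k] cont by (intro fmeasurable_Int_fmeasurable[of "{0..2*pi}", THEN subst[OF Int_commute, of "\<lambda>S. S \<in> fmeasurable lborel"]] fmeasurable_compact) auto
    qed (use q in auto)
    also have "\<dots> \<le> measure lborel ({t. \<bar>?F 0 t\<bar> \<le> y ^ k} \<inter> {0..2*pi}) + pi * (real n * h) ^ (2 * k) * (\<Sum>j=1..n. (r j)\<^sup>2) / (y ^ k)\<^sup>2"
      using h y k by (intro bad_set_measure) auto
    also have "\<dots> \<le> 600 * y ^ k + 4 * (1 / real l ^ 3) ^ (2 * k) * 64 / (y ^ k)\<^sup>2"
    proof (intro add_mono divide_right_mono mult_mono V power_mono nh)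
      have "measure lborel ({t. \<bar>f n \<omega> t\<bar> \<le> 1 / real m} \<inter> {0..2*pi}) \<le> 600 / real m" using balls m by blast
      then show "measure lborel ({t. \<bar>?F 0 t\<bar> \<le> y ^ k} \<inter> {0..2*pi}) \<le> 600 * y ^ k"
        unfolding rp(1) ym[symmetric] by simp
    qed (use pi_less_4 h y in \<open>auto intro: sum_nonneg\<close>)
    also have "(1 / real l ^ 3) ^ (2 * k) = y ^ (3 * k)"
      by (simp add: y_def power_divide flip: power_mult)
    also have "y ^ (3 * k) = (y ^ k)\<^sup>2 * y ^ k" by (simp flip: power_mult power_add)
    \<comment> \<open>856 = 600 + 4 * 64, with 4 bounding pi and 64 the energy
      \<open>V\<close>.\<close>
    also have "600 * y ^ k + 4 * ((y ^ k)\<^sup>2 * y ^ k) * 64 / (y ^ k)\<^sup>2 = 856 * y ^ k" using y by simp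
    also have "\<dots> \<le> 900 * y ^ k" using zero_less_power[OF y(1), of k] by linarith
    finally show ?thesis .
  qed
  have "h * real (card {z \<in> {0..q}. ?F 0 z = 0}) \<le> h * real k0
     + measure lborel ({t. ?F 0 t * ?F 0 (t + h) \<le> 0} \<inter> {0..q})
     + measure lborel (bad_set ?F h 2 \<inter> {0..q})
     + (\<Sum>k=2..k1. measure lborel (bad_set ?F h k \<inter> {0..q}))
     + real k0 * measure lborel (bad_set ?F h k1 \<inter> {0..q})"
    using cells q unfolding h_def[symmetric] rp(1)
    by (intro card_zeros_upper phase_poly_deriv h \<open>2 \<le> k1\<close>) auto
  also have "\<dots> \<le> h * real k0 + measure lborel ({t. ?F 0 t * ?F 0 (t + h) \<le> 0} \<inter> {0..q})
     + 900 * y ^ 2 + (\<Sum>k=2..k1. 900 * y ^ k) + real k0 * (900 * y ^ k1)"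
    using \<open>2 \<le> k1\<close> by (intro add_mono add_left_mono mult_left_mono sum_mono bad order_refl) auto
  also have "(\<Sum>k=2..k1. 900 * y ^ k) \<le> 1800 * y ^ 2"
  proof -
    have "(\<Sum>k=2..k1. y ^ k) = (y ^ 2 - y ^ Suc k1) / (1 - y)" using y \<open>2 \<le> k1\<close> by (subst sum_gp) auto
    also have "\<dots> \<le> y ^ 2 / (1 / 2)" using y by (intro frac_le) auto
    finally show ?thesis by (simp add: sum_distrib_left[symmetric])
  qed
  also have "real k0 * (900 * y ^ k1) \<le> 900 * real k0 * (real l)\<^sup>2 / real m0"
  proof -
    have "real m0 \<le> (real l)\<^sup>2 * ((real l)\<^sup>2) ^ k1"
      using k1(2) by (metis less_imp_le of_nat_le_iff of_nat_power Suc_eq_plus1 power_Suc)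
    then have "1 / ((real l)\<^sup>2) ^ k1 \<le> (real l)\<^sup>2 / real m0" using m01 l0 by (simp add: field_simps)
    then have "y ^ k1 \<le> (real l)\<^sup>2 / real m0" by (simp add: y_def power_divide)
    then have "real k0 * (900 * y ^ k1) \<le> real k0 * (900 * ((real l)\<^sup>2 / real m0))" by (intro mult_left_mono) auto
    then show ?thesis by (simp add: mult_ac)
  qed
  finally have "h * real (card {z \<in> {0..q}. ?F 0 z = 0}) \<le> h * real k0 + measure lborel ({t. ?F 0 t * ?F 0 (t + h) \<le> 0} \<inter> {0..q})
     + 2700 * y ^ 2 + 900 * real k0 * (real l)\<^sup>2 / real m0" by simp
  moreover have "y ^ 2 = 1 / real l ^ 4" by (simp add: y_def power_divide flip: power_mult)
  ultimately show ?thesis unfolding zeros_def sign_changes_def rp(1) h_def by simp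
qed

text \<open>For fixed l, multiplying the cell estimates by 1/h = N l^3 and dividing by n yields
  asymptotic bounds \<open>U l\<close> and \<open>Lo l\<close>, because N/n tends to 1 and the cell
  counts are negligible. The bad levels contribute l^3 * 2700 / l^4, so both bounds tend to the
  density as l grows.\<close>

lemma zeros_density:
  assumes reg: "\<forall>\<^sub>F j in sequentially. regular \<omega> j" and sp: "spread_out \<omega>" and sb: "small_balls \<omega>"
    and q: "0 < q" "q \<le> 2*pi" and clt: "\<And>l. 2 \<le> l \<Longrightarrow> clt q (1 / real l ^ 3) \<omega>"
  shows "(\<lambda>n. real (card (zeros n \<omega> q)) / real n) \<longlonglongrightarrow> q / (pi * sqrt 3)"
proof -
  define U where "U l = q * (2 / pi) * (real l ^ 3 * slope (1 / real l ^ 3)) + 2700 / real l" for l :: nat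
  define Lo where "Lo l = q * (sqrt (2 / pi) * (real l ^ 3 * slope (1 / real l ^ 3)) * (1 - (slope (1 / real l ^ 3) * real l)\<^sup>2 / 2) * (sqrt (2 / pi) - 2 / real l))" for l :: nat
  have const: "q * (2 / pi) * sqrt (1 / 12) = q / (pi * sqrt 3)"
  proof -
    have "q * (2 / pi) * sqrt (1 / 12) = q * (2 / pi * sqrt (1 / 12))" by (rule mult.assoc)
    then show ?thesis unfolding density_constant by simp
  qed
  have Ulim: "U \<longlonglongrightarrow> q / (pi * sqrt 3)"
  proof -
    have "(\<lambda>l::nat. 2700 / real l) \<longlonglongrightarrow> 0" by (rule lim_const_over_n)
    then have "U \<longlonglongrightarrow> q * (2 / pi) * sqrt (1 / 12) + 0" unfolding U_def[abs_def] by (intro tendsto_intros tendsto_slope(1))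
    then show ?thesis using const by simp
  qed
  have Llim: "Lo \<longlonglongrightarrow> q / (pi * sqrt 3)"
  proof -
    have "(\<lambda>l::nat. 2 / real l) \<longlonglongrightarrow> 0" by (rule lim_const_over_n)
    then have "Lo \<longlonglongrightarrow> q * (sqrt (2 / pi) * sqrt (1 / 12) * (1 - 0\<^sup>2 / 2) * (sqrt (2 / pi) - 0))"
      unfolding Lo_def[abs_def] by (intro tendsto_intros tendsto_slope) auto
    also have "q * (sqrt (2 / pi) * sqrt (1 / 12) * (1 - 0\<^sup>2 / 2) * (sqrt (2 / pi) - 0)) = q * (sqrt (2 / pi) * sqrt (2 / pi)) * sqrt (1 / 12)"
      by (simp only: power_zero_numeral div_0 diff_zero mult_1_right mult_ac)
    also have "sqrt (2 / pi) * sqrt (2 / pi) = 2 / pi" by simp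
    also note const
    finally show ?thesis .
  qed
  have small: "\<forall>\<^sub>F l::nat in sequentially. slope (1 / real l ^ 3) * real l < 1"
    using order_tendstoD(2)[OF tendsto_slope(2), of 1] by simp
  have reg': "\<forall>\<^sub>F n in sequentially. regular \<omega> (fr n)"
    using eventually_compose_filterlim[OF reg filterlim_fr] .
  have inv_h: "real (fr n ^ 4) * real l ^ 3 * mesh (1 / real l ^ 3) n = 1" if "regular \<omega> (fr n)" "2 \<le> l" for n l
    using that by (simp add: mesh_def regular_def)
  have upper: "\<forall>\<^sub>F n in sequentially. real (card (zeros n \<omega> q)) / real n < U l + e" if l: "2 \<le> l" and e: "0 < e" for l e
  proof -
    define d where "d = 1 / real l ^ 3"
    have l3: "0 < real l ^ 3" using l by simp
    have "1 ^ 3 \<le> real l ^ 3" using l by (intro power_mono) auto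
    then have d: "0 < d" "d \<le> 1" using l3 by (auto simp: d_def)
    define e' where "e' = e / (2 * real l ^ 3)"
    have e': "0 < e'" "real l ^ 3 * e' = e / 2" using e l3 by (auto simp: e'_def)
    define W where "W n = real (cell_bound l n) / real n + (real (fr n ^ 4) / real n) *
       (real l ^ 3 * (q * (2 / pi * slope d) + e' + 2700 / real l ^ 4 + 900 * (real l)\<^sup>2 * (real (cell_bound l n) / real (freq_bound (fr n)))))" for n
    have "W \<longlonglongrightarrow> 0 + 1 * (real l ^ 3 * (q * (2 / pi * slope d) + e' + 2700 / real l ^ 4 + 900 * (real l)\<^sup>2 * 0))"
      unfolding W_def[abs_def] by (intro tendsto_intros tendsto_cell_bound tendsto_ratio_fr)
    also have "0 + 1 * (real l ^ 3 * (q * (2 / pi * slope d) + e' + 2700 / real l ^ 4 + 900 * (real l)\<^sup>2 * 0)) = U l + e / 2"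
    proof -
      have "real l ^ 3 * (2700 / real l ^ 4) = 2700 / real l" using l by (simp add: power4_eq_xxxx power3_eq_cube)
      moreover have "real l ^ 3 * (q * (2 / pi * slope d)) = q * (2 / pi) * (real l ^ 3 * slope d)" by (simp only: mult_ac)
      ultimately show ?thesis unfolding U_def d_def[symmetric] using e'(2) by (simp only: distrib_left mult_zero_right)
    qed
    finally have "\<forall>\<^sub>F n in sequentially. W n < U l + e" using e by (intro order_tendstoD(2)) auto
    moreover have "\<forall>\<^sub>F n in sequentially. l ^ 6 \<le> freq_bound (fr n)"
      using filterlim_compose[OF filterlim_freq_bound filterlim_fr] by (simp add: filterlim_at_top)
    moreover note few_zeros_in_cells[OF sp reg l] reg' sb[unfolded small_balls_def]
      sign_changes_upper[OF clt[OF l] q(1) d[unfolded d_def] e'(1), folded d_def]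
    ultimately show ?thesis
    proof eventually_elim
      case (elim n)
      define h where "h = mesh d n"
      define N where "N = real (card (zeros n \<omega> q))"
      have n: "0 < real n" using sum_sq_le(3)[OF elim(4)] by simp
      have ih: "real (fr n ^ 4) * real l ^ 3 * h = 1" using inv_h[OF elim(4) l] by (simp add: h_def d_def)
      have fr0: "0 \<le> real (fr n ^ 4) * real l ^ 3" by simp
      have "h * N \<le> h * real (cell_bound l n) + measure lborel (sign_changes n \<omega> h \<inter> {0..q}) + 2700 / real l ^ 4 + 900 * real (cell_bound l n) * (real l)\<^sup>2 / real (freq_bound (fr n))"
        using card_zeros_bound[OF elim(4) l _ q(2) elim(3) elim(5) elim(2)] q by (simp add: h_def d_def N_def)
      also have "\<dots> \<le> h * real (cell_bound l n) + (q * (2 / pi * slope d) + e') + 2700 / real l ^ 4 + 900 * real (cell_bound l n) * (real l)\<^sup>2 / real (freq_bound (fr n))"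
        using elim(6) unfolding h_def by simp
      finally have "(real (fr n ^ 4) * real l ^ 3) * (h * N) \<le> (real (fr n ^ 4) * real l ^ 3) *
          (h * real (cell_bound l n) + (q * (2 / pi * slope d) + e') + 2700 / real l ^ 4 + 900 * real (cell_bound l n) * (real l)\<^sup>2 / real (freq_bound (fr n)))"
        by (rule mult_left_mono[OF _ fr0])
      also have "(real (fr n ^ 4) * real l ^ 3) * (h * N) = (real (fr n ^ 4) * real l ^ 3 * h) * N" by (simp only: mult.assoc)
      also have "\<dots> = N" unfolding ih by simp
      also have "(real (fr n ^ 4) * real l ^ 3) *
          (h * real (cell_bound l n) + (q * (2 / pi * slope d) + e') + 2700 / real l ^ 4 + 900 * real (cell_bound l n) * (real l)\<^sup>2 / real (freq_bound (fr n)))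
         = (real (fr n ^ 4) * real l ^ 3 * h) * real (cell_bound l n) + real (fr n ^ 4) * (real l ^ 3 * (q * (2 / pi * slope d) + e' + 2700 / real l ^ 4 + 900 * (real l)\<^sup>2 * (real (cell_bound l n) / real (freq_bound (fr n)))))"
        by (simp add: algebra_simps)
      finally have "N \<le> real (cell_bound l n) + real (fr n ^ 4) * (real l ^ 3 * (q * (2 / pi * slope d) + e' + 2700 / real l ^ 4 + 900 * (real l)\<^sup>2 * (real (cell_bound l n) / real (freq_bound (fr n)))))"
        unfolding ih by simp
      then have "N / real n \<le> (real (cell_bound l n) + real (fr n ^ 4) * (real l ^ 3 * (q * (2 / pi * slope d) + e' + 2700 / real l ^ 4 + 900 * (real l)\<^sup>2 * (real (cell_bound l n) / real (freq_bound (fr n)))))) / real n"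
        by (intro divide_right_mono) auto
      also have "\<dots> = W n" unfolding W_def by (simp add: add_divide_distrib)
      finally show ?case using elim(1) by (simp add: N_def)
    qed
  qed
  have lower: "\<forall>\<^sub>F n in sequentially. Lo l - e < real (card (zeros n \<omega> q)) / real n"
    if l: "2 \<le> l" and e: "0 < e" and sl: "slope (1 / real l ^ 3) * real l < 1" for l e
  proof -
    define d where "d = 1 / real l ^ 3"
    have l3: "0 < real l ^ 3" using l by simp
    have "1 ^ 3 \<le> real l ^ 3" using l by (intro power_mono) auto
    then have d: "0 < d" "d \<le> 1" using l3 by (auto simp: d_def)
    define e' where "e' = e / (2 * real l ^ 3)"
    have e': "0 < e'" "real l ^ 3 * e' = e / 2" using e l3 by (auto simp: e'_def)
    define B where "B = q * (sqrt (2 / pi) * slope d * (1 - (slope d * real l)\<^sup>2 / 2) * (sqrt (2 / pi) - 2 / real l)) - e'"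
    have Bl: "real l ^ 3 * B = Lo l - e / 2"
    proof -
      have gen: "x * (q * (A * s * C * D) - u) = q * (A * (x * s) * C * D) - x * u" for x A s C D u :: real
        by (simp add: algebra_simps)
      show ?thesis unfolding B_def Lo_def d_def[symmetric] gen e'(2) ..
    qed
    define W where "W n = (real (fr n ^ 4) / real n) * (real l ^ 3 * B) - 1 / real n" for n
    have "(\<lambda>n. 1 / real n) \<longlonglongrightarrow> 0" by (rule lim_const_over_n)
    then have "W \<longlonglongrightarrow> 1 * (real l ^ 3 * B) - 0"
      unfolding W_def[abs_def] by (intro tendsto_intros tendsto_ratio_fr)
    then have "\<forall>\<^sub>F n in sequentially. Lo l - e < W n" unfolding Bl using e by (intro order_tendstoD(1)) auto
    moreover have "\<forall>\<^sub>F n in sequentially. B \<le> measure lborel (sign_changes n \<omega> (mesh d n) \<inter> {0..q})"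
      unfolding B_def using sign_changes_lower[OF clt[OF l] q(1) d[unfolded d_def] e'(1), of l, folded d_def] l sl by (simp add: d_def)
    moreover note few_zeros_in_cells[OF sp reg l] reg'
    ultimately show ?thesis
    proof eventually_elim
      case (elim n)
      define h where "h = mesh d n"
      define N where "N = real (card (zeros n \<omega> q))"
      have n: "0 < real n" using sum_sq_le(3)[OF elim(4)] by simp
      have ih: "real (fr n ^ 4) * real l ^ 3 * h = 1" using inv_h[OF elim(4) l] by (simp add: h_def d_def)
      have fr0: "0 \<le> real (fr n ^ 4) * real l ^ 3" by simp
      have h: "0 < h" using ih fr0 by (metis mult_not_zero not_one_less_zero not_less_iff_gr_or_eq mult_nonneg_nonpos less_imp_le zero_less_one not_le)
      have fin: "finite {z \<in> {0..q}. f n \<omega> z = 0}"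
        by (rule finite_zeros_Icc[OF h]) (use elim(3) q in \<open>auto simp: h_def d_def\<close>)
      have cl: "closed (sign_changes n \<omega> h)" unfolding sign_changes_def
        by (intro closed_Collect_le continuous_intros f_continuous continuous_on_compose2[OF f_continuous[of UNIV]]) auto
      \<comment> \<open>\<open>card_zeros_lower\<close> only covers starting points up to
        \<open>q - h\<close>. The last stretch has measure \<open>h\<close>, worth a single zero,
        which is the 1/n subtracted in \<open>W\<close>.\<close>
      have "measure lborel (sign_changes n \<omega> h \<inter> {0..q}) \<le> measure lborel ((sign_changes n \<omega> h \<inter> {0..q-h}) \<union> {q-h..q})"
      proof (rule measure_mono_fmeasurable)
        show "(sign_changes n \<omega> h \<inter> {0..q-h}) \<union> {q-h..q} \<in> fmeasurable lborel"
          using cl by (intro fmeasurable_compact compact_Un closed_Int_compact) auto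
      qed (use cl in auto)
      also have "\<dots> \<le> measure lborel (sign_changes n \<omega> h \<inter> {0..q-h}) + measure lborel {q-h..q}"
        using cl by (intro measure_Un_le) auto
      also have "measure lborel (sign_changes n \<omega> h \<inter> {0..q-h}) \<le> h * N"
        using card_zeros_lower[OF f_continuous h fin] by (simp add: N_def zeros_def sign_changes_def)
      also have "measure lborel {q-h..q} = h" using h by simp
      finally have "B \<le> h * N + h" using elim(2) by (simp add: h_def)
      then have "(real (fr n ^ 4) * real l ^ 3) * B \<le> (real (fr n ^ 4) * real l ^ 3) * (h * N + h)"
        by (rule mult_left_mono[OF _ fr0])
      also have "\<dots> = (real (fr n ^ 4) * real l ^ 3 * h) * N + (real (fr n ^ 4) * real l ^ 3 * h)" by (simp add: algebra_simps)
      also have "\<dots> = N + 1" unfolding ih by simp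
      finally have "((real (fr n ^ 4) * real l ^ 3) * B - 1) / real n \<le> N / real n" by (intro divide_right_mono) auto
      moreover have "((real (fr n ^ 4) * real l ^ 3) * B - 1) / real n = W n" unfolding W_def by (simp add: diff_divide_distrib mult.assoc)
      ultimately show ?case using elim(1) by (simp add: N_def)
    qed
  qed
  show ?thesis
  proof (rule tendstoI)
    fix e :: real assume e: "0 < e"
    have "\<forall>\<^sub>F l in sequentially. U l < q / (pi * sqrt 3) + e / 2 \<and> q / (pi * sqrt 3) - e / 2 < Lo l \<and> slope (1 / real l ^ 3) * real l < 1 \<and> 2 \<le> l"
      using e by (intro eventually_conj order_tendstoD(2)[OF Ulim] order_tendstoD(1)[OF Llim] small eventually_ge_at_top) auto
    then obtain l where l: "U l < q / (pi * sqrt 3) + e / 2" "q / (pi * sqrt 3) - e / 2 < Lo l" "slope (1 / real l ^ 3) * real l < 1" "2 \<le> l"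
      using eventually_happens sequentially_bot by blast
    show "\<forall>\<^sub>F n in sequentially. dist (real (card (zeros n \<omega> q)) / real n) (q / (pi * sqrt 3)) < e"
      using upper[OF l(4) half_gt_zero[OF e]] lower[OF l(4) half_gt_zero[OF e] l(3)]
    proof eventually_elim
      case (elim n)
      then show ?case using l unfolding dist_real_def by linarith
    qed
  qed
qed

end

section \<open>From initial intervals to all intervals\<close>

text \<open>Counts are monotone in the interval, so the count on [x, y] is squeezed between
  differences of counts on initial intervals with endpoints in \<open>D\<close>; no regularity in x
  or y is needed. Thus countably many almost sure limits yield the statement for all intervals
  simultaneously.\<close>

lemma counting_density_extend:
  fixes F :: "nat \<Rightarrow> real \<Rightarrow> real"
  assumes fin: "\<forall>\<^sub>F n in sequentially. finite {z \<in> {0..Q}. F n z = 0}"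
    and D: "D \<subseteq> {0..Q}"
    and left: "\<And>u e. 0 \<le> u \<Longrightarrow> u \<le> Q \<Longrightarrow> 0 < e \<Longrightarrow> \<exists>q\<in>D. u - e \<le> q \<and> q \<le> u"
    and right: "\<And>u e. 0 \<le> u \<Longrightarrow> u \<le> Q \<Longrightarrow> 0 < e \<Longrightarrow> \<exists>q\<in>D. u \<le> q \<and> q \<le> u + e"
    and lim: "\<And>q. q \<in> D \<Longrightarrow> (\<lambda>n. real (card {z \<in> {0..q}. F n z = 0}) / real n) \<longlonglongrightarrow> q / c"
    and c: "0 < c" and xy: "0 \<le> x" "x \<le> y" "y \<le> Q"
  shows "(\<lambda>n. real (card {z \<in> {x..y}. F n z = 0}) / real n) \<longlonglongrightarrow> (y - x) / c"
proof (rule tendstoI)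
  fix \<epsilon> :: real assume "0 < \<epsilon>"
  define e where "e = \<epsilon> * c / 4"
  have e: "0 < e" "2 * e / c = \<epsilon> / 2" using c \<open>0 < \<epsilon>\<close> by (auto simp: e_def)
  define N where "N n I = real (card {z \<in> I. F n z = 0})" for n and I :: "real set"
  obtain x1 where x1: "x1 \<in> D" "x - e \<le> x1" "x1 \<le> x" using left[of x e] xy e by auto
  obtain x2 where x2: "x2 \<in> D" "x \<le> x2" "x2 \<le> x + e" using right[of x e] xy e by auto
  obtain y1 where y1: "y1 \<in> D" "y - e \<le> y1" "y1 \<le> y" using left[of y e] xy e by auto
  obtain y2 where y2: "y2 \<in> D" "y \<le> y2" "y2 \<le> y + e" using right[of y e] xy e by auto
  have pos: "0 \<le> x1" "y2 \<le> Q" "x2 \<le> Q" using D x1 y2 x2 by auto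
  have "(\<lambda>n. N n {0..y2} / real n + 1 / real n - N n {0..x1} / real n) \<longlonglongrightarrow> y2 / c + 0 - x1 / c"
    unfolding N_def by (intro tendsto_intros lim lim_const_over_n x1 y2)
  moreover have "(y2 - x1) / c \<le> (y - x + 2 * e) / c" using c x1 y2 by (intro divide_right_mono) auto
  then have "y2 / c + 0 - x1 / c < (y - x) / c + \<epsilon>" using e \<open>0 < \<epsilon>\<close> unfolding add_divide_distrib diff_divide_distrib by linarith
  ultimately have up: "\<forall>\<^sub>F n in sequentially. N n {0..y2} / real n + 1 / real n - N n {0..x1} / real n < (y - x) / c + \<epsilon>"
    by (rule order_tendstoD(2))
  have "(\<lambda>n. N n {0..y1} / real n - N n {0..x2} / real n) \<longlonglongrightarrow> y1 / c - x2 / c"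
    unfolding N_def by (intro tendsto_intros lim x2 y1)
  moreover have "(y - x - 2 * e) / c \<le> (y1 - x2) / c" using c x2 y1 by (intro divide_right_mono) auto
  then have "(y - x) / c - \<epsilon> < y1 / c - x2 / c" using e \<open>0 < \<epsilon>\<close> unfolding add_divide_distrib diff_divide_distrib by linarith
  ultimately have lo: "\<forall>\<^sub>F n in sequentially. (y - x) / c - \<epsilon> < N n {0..y1} / real n - N n {0..x2} / real n"
    by (rule order_tendstoD(1))
  show "\<forall>\<^sub>F n in sequentially. dist (real (card {z \<in> {x..y}. F n z = 0}) / real n) ((y - x) / c) < \<epsilon>"
    using up lo fin
  proof eventually_elim
    case (elim n)
    let ?Z = "\<lambda>I. {z \<in> I. F n z = 0}"
    have fin: "finite (?Z I)" if "I \<subseteq> {0..Q}" for I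
      using elim(3) by (rule finite_subset[rotated]) (use that in auto)
    have "card (?Z {x..y}) + card (?Z {0..x1}) = card (?Z {x..y} \<union> ?Z {0..x1}) + card (?Z {x..y} \<inter> ?Z {0..x1})"
      using xy pos x1 by (intro card_Un_Int fin) auto
    \<comment> \<open>As \<open>x1 <= x\<close>, the two intervals share at most the point
      \<open>x\<close>; this is the extra 1/n in the upper estimate.\<close>
    also have "\<dots> \<le> card (?Z {0..y2}) + card {x}"
      using xy pos x1 y2 by (intro add_mono card_mono fin) auto
    finally have "N n {x..y} + N n {0..x1} \<le> N n {0..y2} + 1" unfolding N_def by simp
    then have "(N n {x..y} + N n {0..x1}) / real n \<le> (N n {0..y2} + 1) / real n" by (rule divide_right_mono) simp
    moreover have "card (?Z {0..y1}) \<le> card (?Z {x..y} \<union> ?Z {0..x2})"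
      using xy pos x2 y1 by (intro card_mono finite_UnI fin) auto
    then have "N n {0..y1} \<le> N n {x..y} + N n {0..x2}"
      unfolding N_def using card_Un_le[of "?Z {x..y}" "?Z {0..x2}"] by linarith
    then have "N n {0..y1} / real n \<le> (N n {x..y} + N n {0..x2}) / real n" by (rule divide_right_mono) simp
    ultimately show ?case using elim(1,2) unfolding N_def[symmetric] dist_real_def add_divide_distrib by linarith
  qed
qed

context trig_iid begin

lemma AE_zeros_density:
  "AE \<omega> in M. \<forall>x y. 0 \<le> x \<and> x \<le> y \<and> y \<le> 2*pi \<longrightarrow>
     (\<lambda>n. real (card {z \<in> {x..y}. f n \<omega> z = 0}) / real n) \<longlonglongrightarrow> (y - x) / (pi * sqrt 3)"
proof -
  \<comment> \<open>The endpoint 2 pi is irrational and must be added, since it has to be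
    approximated from the right within the interval.\<close>
  define D where "D = {q \<in> {0..2*pi}. q \<in> \<rat> \<or> q = 2*pi}"
  have "countable D" by (rule countable_subset[of _ "insert (2*pi) \<rat>"]) (auto simp: D_def countable_rat)
  have "AE \<omega> in M. \<forall>q\<in>D. \<forall>l\<in>{2::nat..}. clt q (1 / real l ^ 3) \<omega>"
  proof (subst AE_ball_countable[OF \<open>countable D\<close>], rule ballI)
    fix q assume "q \<in> D"
    then have "AE \<omega> in M. clt q (1 / real l ^ 3) \<omega>" if "2 \<le> l" for l
      unfolding clt_def using that by (intro AE_clt) (auto simp: D_def)
    then show "AE \<omega> in M. \<forall>l\<in>{2::nat..}. clt q (1 / real l ^ 3) \<omega>"
      by (subst AE_ball_countable) auto
  qed
  with AE_regular AE_not_small_on_windows[folded spread_out_def] AE_small_ball[folded small_balls_def] show ?thesis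
  proof eventually_elim
    case (elim \<omega>)
    have fin: "\<forall>\<^sub>F n in sequentially. finite {z \<in> {0..2*pi}. f n \<omega> z = 0}"
    proof -
      have "\<forall>\<^sub>F n in sequentially. regular \<omega> (fr n)"
        using eventually_compose_filterlim[OF elim(1) filterlim_fr] .
      with few_zeros_in_cells[OF elim(2,1) order_refl] show ?thesis
      proof eventually_elim
        case (elim n)
        have "0 < mesh (1 / real 2 ^ 3) n" using elim(2) by (auto simp: mesh_def regular_def)
        then show ?case by (rule finite_zeros_Icc) (use elim(1) in auto)
      qed
    qed
    have lim: "(\<lambda>n. real (card {z \<in> {0..q}. f n \<omega> z = 0}) / real n) \<longlonglongrightarrow> q / (pi * sqrt 3)" if "q \<in> D" for q
    \<comment> \<open>\<open>zeros_density\<close> requires a positive length; for q = 0 there is at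
      most one zero.\<close>
    proof (cases "q = 0")
      case True
      have "card {z \<in> {0..q}. f n \<omega> z = 0} \<le> card {0::real}" for n using True by (intro card_mono) auto
      then have "norm (real (card {z \<in> {0..q}. f n \<omega> z = 0}) / real n) \<le> 1 / real n" for n
        by (auto intro!: divide_right_mono)
      then have "(\<lambda>n. real (card {z \<in> {0..q}. f n \<omega> z = 0}) / real n) \<longlonglongrightarrow> 0"
        by (intro Lim_null_comparison[OF always_eventually lim_const_over_n]) auto
      then show ?thesis using True by simp
    next
      case False
      then show ?thesis using zeros_density[OF elim(1,2,3), of q] elim(4) that
        by (auto simp: zeros_def D_def)
    qed
    show ?case
    proof (intro allI impI)
      fix x y assume xy: "0 \<le> x \<and> x \<le> y \<and> y \<le> 2*pi"
      show "(\<lambda>n. real (card {z \<in> {x..y}. f n \<omega> z = 0}) / real n) \<longlonglongrightarrow> (y - x) / (pi * sqrt 3)"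
      proof (rule counting_density_extend[where D=D, OF fin])
        fix u e :: real assume u: "0 \<le> u" "u \<le> 2*pi" "0 < e"
        show "\<exists>q\<in>D. u - e \<le> q \<and> q \<le> u"
        proof (cases "u = 0")
          case True
          then show ?thesis using u by (intro bexI[of _ 0]) (auto simp: D_def)
        next
          case False
          then obtain r where "r \<in> \<rat>" "max 0 (u - e) < r" "r < u" using Rats_dense_in_real[of "max 0 (u - e)" u] u by auto
          then show ?thesis using u by (intro bexI[of _ r]) (auto simp: D_def)
        qed
        show "\<exists>q\<in>D. u \<le> q \<and> q \<le> u + e"
        proof (cases "u = 2*pi")
          case True
          then show ?thesis using u by (intro bexI[of _ "2*pi"]) (auto simp: D_def)
        next
          case False
          then obtain r where "r \<in> \<rat>" "u < r" "r < min (2*pi) (u + e)" using Rats_dense_in_real[of u "min (2*pi) (u + e)"] u by auto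
          then show ?thesis using u by (intro bexI[of _ r]) (auto simp: D_def)
        qed
      qed (use xy lim in \<open>auto simp: D_def\<close>)
    qed
  qed
qed

end

theorem theorem6:
  fixes M :: "'w measure" and a b :: "nat \<Rightarrow> 'w \<Rightarrow> real"
  assumes "prob_space M"
    and indep: "prob_space.indep_vars M (\<lambda>_. borel)
                  (\<lambda>i. case i of Inl k \<Rightarrow> a k | Inr k \<Rightarrow> b k)
                  (Inl ` {1..} \<union> Inr ` {1..})"
    and same_distr: "\<forall>k\<ge>1. distr M borel (a k) = distr M borel (a 1)
                         \<and> distr M borel (b k) = distr M borel (a 1)"
    and symmetric: "distr M borel (\<lambda>\<omega>. - a 1 \<omega>) = distr M borel (a 1)"
    and unit_var: "prob_space.variance M (a 1) = 1"
    and fourth: "integrable M (\<lambda>\<omega>. (a 1 \<omega>) ^ 4)"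
  shows "(AE \<omega> in M.
            (\<lambda>n. real (num_zeros (trig_poly (\<lambda>k. a k \<omega>) (\<lambda>k. b k \<omega>) n) {0..2*pi}) / real n)
              \<longlonglongrightarrow> 2 / sqrt 3)
       \<and> (AE \<omega> in M. \<forall>x y. 0 \<le> x \<and> x \<le> y \<and> y \<le> 2*pi \<longrightarrow>
            (\<lambda>n. real (num_zeros (trig_poly (\<lambda>k. a k \<omega>) (\<lambda>k. b k \<omega>) n) {x..y}) / real n)
              \<longlonglongrightarrow> (y - x) / (pi * sqrt 3))"
proof -
  interpret prob_space M by fact
  have a1 [measurable]: "a 1 \<in> borel_measurable M"
    using indep unfolding indep_vars_def by (force dest!: bspec[of _ _ "Inl 1"])
  define X where "X i = (case i of Inl k \<Rightarrow> a k | Inr k \<Rightarrow> b k)" for i :: "nat + nat"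
  \<comment> \<open>Symmetry makes the mean zero, so the variance hypothesis becomes the second
    moment condition of the locale.\<close>
  have mean: "expectation (a 1) = 0"
  proof -
    have "expectation (\<lambda>\<omega>. - a 1 \<omega>) = (\<integral>x. x \<partial>distr M borel (\<lambda>\<omega>. - a 1 \<omega>))" by (subst integral_distr) (use a1 in auto)
    also have "\<dots> = expectation (a 1)" unfolding symmetric by (subst integral_distr) (use a1 in auto)
    finally show ?thesis by simp
  qed
  interpret law: real_distribution "distr M borel (a 1)" by (rule real_distribution_distr[OF a1])
  interpret trig_iid M X "distr M borel (a 1)"
  proof (unfold trig_iid_def, unfold_locales)
    show "indep_vars (\<lambda>_. borel) X (Inl ` {1..} \<union> Inr ` {1..})" unfolding X_def[abs_def] by (rule indep)
    show "distr (distr M borel (a 1)) borel uminus = distr M borel (a 1)"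
      using symmetric by (subst distr_distr) (use a1 in \<open>auto simp: comp_def\<close>)
    show "(\<integral>x. x\<^sup>2 \<partial>distr M borel (a 1)) = 1" using unit_var mean by (subst integral_distr) (use a1 in auto)
    show "integrable (distr M borel (a 1)) (\<lambda>x. x ^ 4)" using fourth by (subst integrable_distr_eq) (use a1 in auto)
    show "distr M borel (X i) = distr M borel (a 1)" if "i \<in> Inl ` {1..} \<union> Inr ` {1..}" for i
    proof (cases i)
      case (Inl k)
      then have "1 \<le> k" using that by auto
      then show ?thesis unfolding X_def Inl sum.case using same_distr by blast
    next
      case (Inr k)
      then have "1 \<le> k" using that by auto
      then show ?thesis unfolding X_def Inr sum.case using same_distr by blast
    qed
  qed
  have dens: "AE \<omega> in M. \<forall>x y. 0 \<le> x \<and> x \<le> y \<and> y \<le> 2*pi \<longrightarrow>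
            (\<lambda>n. real (num_zeros (trig_poly (\<lambda>k. a k \<omega>) (\<lambda>k. b k \<omega>) n) {x..y}) / real n)
              \<longlonglongrightarrow> (y - x) / (pi * sqrt 3)"
    using AE_zeros_density unfolding f_def num_zeros_def X_def sum.case .
  then have "AE \<omega> in M. (\<lambda>n. real (num_zeros (trig_poly (\<lambda>k. a k \<omega>) (\<lambda>k. b k \<omega>) n) {0..2*pi}) / real n)
              \<longlonglongrightarrow> 2 / sqrt 3"
  proof eventually_elim
    case (elim \<omega>)
    then show ?case by (elim allE[of _ 0] allE[of _ "2*pi"]) simp
  qed
  with dens show ?thesis by blast
qed

end
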